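(* There exists an absolute constant $C_2\le 64$ such that the following holds. Under the data model below, take any covariance splitting $\Sigma=\Sigma_1\oplus\Sigma_2$ with $\Sigma_2\ne0$, let $\|\cdot\|$ be an arbitrary norm on $\mathbb{R}^d$, and fix $\delta\le1/4$. Let $P$ be the Euclidean orthogonal projection onto the column space of $\Sigma_2$, let $H\sim N(0,I_d)$, and let $v^* \in \arg\min_{v\in\partial\|\Sigma_2^{1/2}H\|_*}\|v\|_{\Sigma_2}$. Suppose there exist $\epsilon_1,\epsilon_2\ge0$ such that with probability at least $1-\delta/4$, $$\|v^*\|_{\Sigma_2} \le (1+\epsilon_1)\,\mathbb{E}\|v^*\|_{\Sigma_2}\quad\text{and}\quad \|Pv^*\|^2\le 1+\epsilon_2 .$$ Let $$\epsilon = C_2\left(\sqrt{\frac{\log(1/\delta)}{r_{\|\cdot\|}(\Sigma_2)}} + \sqrt{\frac{\log(1/\delta)}{n}} + (1+\epsilon_1)^2\frac{n}{R_{\|\cdot\|}(\Sigma_2)} + \epsilon_2\right).$$ If $\epsilon\le1$, then with probability at least $1-\delta$, any minimal $\|\cdot\|$-norm interpolator $\hat w$ satisfies $$\|\hat w\| \le \|w^*\| + (1+\epsilon)^{1/2}\,\sigma\,\frac{\sqrt n}{\mathbb{E}\|\Sigma_2^{1/2}H\|_*}.$$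
   Context: Data model: $d \ge n$; $\Sigma \in \mathbb{R}^{d\times d}$ positive semidefinite; $w^* \in \mathbb{R}^d$ arbitrary; $\sigma\ge0$. $X \in \mathbb{R}^{n\times d}$ has i.i.d. rows $X_i\sim N(0,\Sigma)$, $\xi\sim N(0,\sigma^2I_n)$ independent of $X$, $Y=Xw^*+\xi$. $\hat w\in\arg\min\{\|w\|: Xw=Y\}$. $\|x\|_A^2:=\langle x,Ax\rangle$. Covariance splitting: $\Sigma=\Sigma_1\oplus\Sigma_2$ means $\Sigma=\Sigma_1+\Sigma_2$, both positive semidefinite, with orthogonal column spaces. Dual norm $\|u\|_*=\max_{\|v\|=1}\langle v,u\rangle$; its subgradient set $\partial\|u\|_* = \{v:\|v\|=1,\ \langle v,u\rangle = \|u\|_*\}$. Effective $\|\cdot\|$-ranks of positive semidefinite $A$: with $H\sim N(0,I_d)$ and $v_A^*\in\arg\min_{v\in\partial\|A^{1/2}H\|_*}\|v\|_A$, $r_{\|\cdot\|}(A) = \left(\mathbb{E}\|A^{1/2}H\|_*/\sup_{\|w\|\le1}\|w\|_A\right)^2$ and $R_{\|\cdot\|}(A) = \left(\mathbb{E}\|A^{1/2}H\|_*/\mathbb{E}\|v_A^*\|_A\right)^2$. *)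

theory Defs
  imports "HOL-Probability.Probability"
begin

text \<open>Vectors of R^k are represented as functions nat => real vanishing at indices >= k;
  matrices as nat => nat => real.\<close>

type_synonym vect = "nat \<Rightarrow> real"
type_synonym matr = "nat \<Rightarrow> nat \<Rightarrow> real"

definition vsp :: "nat \<Rightarrow> vect set" where
  "vsp d = {x. \<forall>i\<ge>d. x i = 0}"

definition ip :: "nat \<Rightarrow> vect \<Rightarrow> vect \<Rightarrow> real" where
  "ip d x y = (\<Sum>i<d. x i * y i)"

definition matvec :: "nat \<Rightarrow> nat \<Rightarrow> matr \<Rightarrow> vect \<Rightarrow> vect" where
  "matvec m k A x = (\<lambda>i. if i < m then (\<Sum>j<k. A i j * x j) else 0)"

definition mmul :: "nat \<Rightarrow> matr \<Rightarrow> matr \<Rightarrow> matr" where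
  "mmul d A B = (\<lambda>i j. if i < d \<and> j < d then (\<Sum>k<d. A i k * B k j) else 0)"

definition sq_mat :: "nat \<Rightarrow> matr \<Rightarrow> bool" where
  "sq_mat d A \<longleftrightarrow> (\<forall>i j. (d \<le> i \<or> d \<le> j) \<longrightarrow> A i j = 0)"

definition psd :: "nat \<Rightarrow> matr \<Rightarrow> bool" where
  "psd d A \<longleftrightarrow> sq_mat d A \<and> (\<forall>i<d. \<forall>j<d. A i j = A j i)
     \<and> (\<forall>x\<in>vsp d. 0 \<le> ip d x (matvec d d A x))"

definition msqrt :: "nat \<Rightarrow> matr \<Rightarrow> matr" where
  "msqrt d A = (THE S. psd d S \<and> mmul d S S = A)"

definition colsp :: "nat \<Rightarrow> matr \<Rightarrow> vect set" where
  "colsp d A = matvec d d A ` vsp d"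

definition cov_split :: "nat \<Rightarrow> matr \<Rightarrow> matr \<Rightarrow> matr \<Rightarrow> bool" where
  "cov_split d S S1 S2 \<longleftrightarrow> S = (\<lambda>i j. S1 i j + S2 i j) \<and> psd d S1 \<and> psd d S2
     \<and> (\<forall>u\<in>colsp d S1. \<forall>v\<in>colsp d S2. ip d u v = 0)"

definition proj :: "nat \<Rightarrow> vect set \<Rightarrow> vect \<Rightarrow> vect" where
  "proj d V x = (THE y. y \<in> V \<and> (\<forall>z\<in>V. ip d (\<lambda>i. x i - y i) z = 0))"

definition is_norm :: "nat \<Rightarrow> (vect \<Rightarrow> real) \<Rightarrow> bool" where
  "is_norm d N \<longleftrightarrow> (\<forall>x\<in>vsp d. 0 \<le> N x) \<and> (\<forall>x\<in>vsp d. N x = 0 \<longleftrightarrow> x = (\<lambda>_. 0))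
     \<and> (\<forall>x\<in>vsp d. \<forall>c. N (\<lambda>i. c * x i) = \<bar>c\<bar> * N x)
     \<and> (\<forall>x\<in>vsp d. \<forall>y\<in>vsp d. N (\<lambda>i. x i + y i) \<le> N x + N y)"

definition dnorm :: "nat \<Rightarrow> (vect \<Rightarrow> real) \<Rightarrow> vect \<Rightarrow> real" where
  "dnorm d N u = Sup {ip d v u | v. v \<in> vsp d \<and> N v = 1}"

text \<open>subgradient set of the dual norm at u\<close>
definition subdual :: "nat \<Rightarrow> (vect \<Rightarrow> real) \<Rightarrow> vect \<Rightarrow> vect set" where
  "subdual d N u = {v \<in> vsp d. N v = 1 \<and> ip d v u = dnorm d N u}"

definition anorm :: "nat \<Rightarrow> matr \<Rightarrow> vect \<Rightarrow> real" where
  "anorm d A x = sqrt (ip d x (matvec d d A x))"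

definition gaussfield :: "('i \<Rightarrow> real) measure" where
  "gaussfield = PiM UNIV (\<lambda>_. density lborel std_normal_density)"

definition gvec :: "nat \<Rightarrow> (nat \<Rightarrow> real) \<Rightarrow> vect" where
  "gvec d \<omega> = (\<lambda>i. if i < d then \<omega> i else 0)"

definition Edual :: "nat \<Rightarrow> (vect \<Rightarrow> real) \<Rightarrow> matr \<Rightarrow> real" where
  "Edual d N A = (\<integral>\<omega>. dnorm d N (matvec d d (msqrt d A) (gvec d \<omega>)) \<partial>(gaussfield :: (nat \<Rightarrow> real) measure))"

text \<open>minimal A-norm over the subgradient set at A^{1/2} h (= ||v_A^*||_A)\<close>
definition vmin :: "nat \<Rightarrow> (vect \<Rightarrow> real) \<Rightarrow> matr \<Rightarrow> vect \<Rightarrow> real" where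
  "vmin d N A h = Inf (anorm d A ` subdual d N (matvec d d (msqrt d A) h))"

definition is_vstar :: "nat \<Rightarrow> (vect \<Rightarrow> real) \<Rightarrow> matr \<Rightarrow> vect \<Rightarrow> vect \<Rightarrow> bool" where
  "is_vstar d N A h v \<longleftrightarrow> v \<in> subdual d N (matvec d d (msqrt d A) h)
     \<and> (\<forall>u\<in>subdual d N (matvec d d (msqrt d A) h). anorm d A v \<le> anorm d A u)"

definition rk_small :: "nat \<Rightarrow> (vect \<Rightarrow> real) \<Rightarrow> matr \<Rightarrow> real" where
  "rk_small d N A = (Edual d N A / Sup {anorm d A w | w. w \<in> vsp d \<and> N w \<le> 1})\<^sup>2"

definition rk_big :: "nat \<Rightarrow> (vect \<Rightarrow> real) \<Rightarrow> matr \<Rightarrow> real" where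
  "rk_big d N A = (Edual d N A /
     (\<integral>\<omega>. vmin d N A (gvec d \<omega>) \<partial>(gaussfield :: (nat \<Rightarrow> real) measure)))\<^sup>2"

text \<open>Data model.  The sample point \<omega> : (nat \<times> nat) + nat => real is an i.i.d. N(0,1) field;
  Z i j = \<omega> (Inl (i,j)), X = Z Sigma^{1/2} (rows X_i = Sigma^{1/2} Z_i ~ N(0,Sigma)),
  xi i = sigma * \<omega> (Inr i) ~ N(0, sigma^2), Y = X w* + xi.\<close>
definition dataX :: "nat \<Rightarrow> nat \<Rightarrow> matr \<Rightarrow> ((nat \<times> nat) + nat \<Rightarrow> real) \<Rightarrow> matr" where
  "dataX n d S \<omega> = (\<lambda>i j. if i < n \<and> j < d then (\<Sum>k<d. msqrt d S j k * \<omega> (Inl (i, k))) else 0)"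

definition dataY :: "nat \<Rightarrow> nat \<Rightarrow> matr \<Rightarrow> vect \<Rightarrow> real \<Rightarrow> ((nat \<times> nat) + nat \<Rightarrow> real) \<Rightarrow> vect" where
  "dataY n d S w \<sigma> \<omega> = (\<lambda>i. if i < n then matvec n d (dataX n d S \<omega>) w i + \<sigma> * \<omega> (Inr i) else 0)"

definition min_interp :: "nat \<Rightarrow> nat \<Rightarrow> (vect \<Rightarrow> real) \<Rightarrow> matr \<Rightarrow> vect \<Rightarrow> vect set" where
  "min_interp n d N X Y = {w \<in> vsp d. matvec n d X w = Y \<and>
      (\<forall>w'\<in>vsp d. matvec n d X w' = Y \<longrightarrow> N w \<le> N w')}"

end

theory Submission
  imports Defs
begin

text \<open>
  Every interpolator bounds the norm of a minimal one, so it is enough to find \<open>p\<close> in the column space of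
  \<open>S2\<close> with \<open>N p \<le> sqrt (1 + \<epsilon>2)\<close> and \<open>Z R p = \<kappa> g\<close>, where \<open>R = msqrt d S2\<close>, \<open>\<sigma> g\<close> is the noise and
  \<open>\<kappa> = sqrt (1 + \<epsilon>2) E / sqrt ((1 + \<epsilon>) n)\<close> with \<open>E\<close> the expected dual norm; then \<open>wstar + (\<sigma> / \<kappa>) p\<close>
  interpolates.

  If there is no such \<open>p\<close>, then by convexity some unit vector \<open>\<lambda>\<close> satisfies
  \<open>\<langle>R p, Z^T \<lambda>\<rangle> < \<kappa> \<langle>\<lambda>, g\<rangle>\<close> for all admissible \<open>p\<close>. By Gordon's comparison inequality the probability of
  this is at most twice that of \<open>\<langle>R p, H\<rangle> + |R p| \<langle>\<lambda>, G\<rangle> \<le> \<kappa> \<langle>\<lambda>, g\<rangle>\<close> for some \<open>\<lambda>\<close> and all \<open>p\<close>. Taking for \<open>p\<close>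
  the projection of \<open>v\<^sup>*\<close> forces the dual norm of \<open>R H\<close> to be at most \<open>|\<kappa> g - s G|\<close>, where \<open>s\<close> is the
  \<open>S2\<close>-norm of \<open>v\<^sup>*\<close>. This contradicts the concentration of the dual norm around \<open>E\<close> and of \<open>|\<kappa> g - s G|\<close>
  around \<open>sqrt (n (\<kappa>\<^sup>2 + s\<^sup>2))\<close>.

  Gordon's inequality is obtained by replacing the increments of one Gaussian process by those of the other,
  one small step at a time (Lindeberg); the indicator of the event is smoothed by a product of ramps, whose
  gradient lies in the Lorentz cone. Concentration is the Maurey--Pisier rotation argument.
\<close>

section \<open>Gaussian fields\<close>

text \<open>Failure to interpolate has the form "some direction, all points". This is the order of
  quantifiers that Gordon's inequality controls, and convexity serves only to produce the direction.
  Three obstacles shape the proof. The families of directions and points are uncountable, so dense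
  sequences and two monotone limits are used. The indicator is discontinuous, so ramps replace it.
  The threshold contains the noise, so the comparison is made for fixed noise and then integrated.

  Each point \<open>p\<close> is recorded as the cone vector \<open>(R p, |R p|)\<close>. For a
  single direction the two processes are then the same standard Gaussian vector tested by the same
  functionals. Only two different directions \<open>\<lambda>\<close> and \<open>\<lambda>'\<close>
  have to be compared. There the contracted covariances differ by
  \<open>1 - \<langle>\<lambda>, \<lambda>'\<rangle>\<close> times the Lorentz product of two
  gradients, which is nonnegative.\<close>

abbreviation gauss1 :: "real measure" where
  "gauss1 \<equiv> density lborel std_normal_density"

lemma prob_space_gauss1: "prob_space gauss1"
  by (rule prob_space_normal_density) simp

lemma sets_gauss1 [measurable_cong, simp]: "sets gauss1 = sets borel"
  by simp

interpretation gauss1: prob_space gauss1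
  by (rule prob_space_gauss1)

lemma prob_space_gaussfield: "prob_space gaussfield"
  unfolding gaussfield_def by (intro prob_space_PiM prob_space_gauss1)

interpretation gaussfield: prob_space gaussfield
  by (rule prob_space_gaussfield)

lemma space_gaussfield [simp]: "space gaussfield = UNIV"
  by (simp add: gaussfield_def space_PiM PiE_UNIV_domain)

lemma sets_gaussfield [measurable_cong]: "sets gaussfield = sets (PiM UNIV (\<lambda>_. borel))"
  unfolding gaussfield_def by (intro sets_PiM_cong) auto

lemma measurable_gaussfield_component [measurable]: "(\<lambda>\<omega>. \<omega> i) \<in> borel_measurable gaussfield"
  by (simp add: measurable_cong_sets[OF sets_gaussfield refl])

lemma measurable_into_field:
  assumes "\<And>j. (\<lambda>x. f x j) \<in> borel_measurable M"
  shows "f \<in> measurable M (PiM UNIV (\<lambda>_. borel))"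
  using measurable_abs_UNIV[of "\<lambda>j x. f x j", OF assms] by simp

lemma measurable_into_gaussfield:
  assumes "\<And>j. (\<lambda>x. f x j) \<in> borel_measurable M"
  shows "f \<in> measurable M gaussfield"
  using measurable_into_field[OF assms] by (simp add: measurable_cong_sets[OF refl sets_gaussfield])

lemma distr_cong_sets: "sets N = sets N' \<Longrightarrow> distr M N f = distr M N' f"
  by (rule distr_cong) auto

lemma distr_gaussfield_component: "distr gaussfield borel (\<lambda>\<omega>. \<omega> i) = gauss1"
proof -
  have "distr (PiM UNIV (\<lambda>_. gauss1)) gauss1 (\<lambda>\<omega>. \<omega> i) = gauss1"
    by (rule distr_PiM_component) (auto simp: prob_space_gauss1)
  from trans[OF distr_cong_sets this, of borel] show ?thesis
    unfolding gaussfield_def by simp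
qed

lemma distr_id_gaussfield: "distr gaussfield (PiM UNIV (\<lambda>_. borel)) (\<lambda>\<omega>. \<omega>) = gaussfield"
  by (rule distr_id2) (simp add: sets_gaussfield)

lemma indep_vars_gaussfield:
  "prob_space.indep_vars gaussfield (\<lambda>_. borel) (\<lambda>i \<omega>. \<omega> i) UNIV"
proof (subst gaussfield.indep_vars_iff_distr_eq_PiM')
  show "distr gaussfield (Pi\<^sub>M UNIV (\<lambda>i. borel)) (\<lambda>x. \<lambda>i\<in>UNIV. x i)
      = (\<Pi>\<^sub>M i\<in>UNIV. distr gaussfield borel (\<lambda>\<omega>. \<omega> i))"
    unfolding distr_gaussfield_component gaussfield_def[symmetric] restrict_UNIV
    by (rule distr_id_gaussfield)
qed auto

lemma indep_vars_blocks:
  assumes "disjoint_family K"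
    and "\<And>j. Y j \<in> measurable (PiM (K j) (\<lambda>_. borel)) M'"
  shows "prob_space.indep_vars gaussfield (\<lambda>_. M') (\<lambda>j \<omega>. Y j (restrict \<omega> (K j))) UNIV"
  using gaussfield.indep_vars_compose2[OF
      gaussfield.indep_vars_restrict[OF indep_vars_gaussfield, of UNIV K], of Y "\<lambda>_. M'"] assms
  by (simp add: restrict_def)

lemma distributed_component:
  "distributed gaussfield lborel (\<lambda>\<omega>. \<omega> i) std_normal_density"
  unfolding distributed_def
  using trans[OF distr_cong_sets distr_gaussfield_component, of lborel i] by simp

lemma distr_unit_combination:
  assumes fin: "finite S" and unit: "(\<Sum>i\<in>S. (a i)\<^sup>2) = 1"
  shows "distr gaussfield borel (\<lambda>\<omega>. \<Sum>i\<in>S. a i * \<omega> i) = gauss1"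
proof -
  \<comment> \<open>Zero coefficients are removed because a normal density of standard deviation 0
    does not describe a point mass.\<close>
  let ?S = "{i\<in>S. a i \<noteq> 0}"
  have S: "finite ?S" "?S \<noteq> {}"
  proof -
    show "?S \<noteq> {}"
    proof
      assume "?S = {}"
      then have "(\<Sum>i\<in>S. (a i)\<^sup>2) = 0"
        by (intro sum.neutral) auto
      with unit show False by simp
    qed
  qed (use fin in auto)
  have un: "(\<Sum>i\<in>?S. (a i)\<^sup>2) = 1"
    unfolding unit[symmetric] by (rule sum.mono_neutral_left) (use fin in auto)
  have ind: "gaussfield.indep_vars (\<lambda>_. borel) (\<lambda>i \<omega>. a i * \<omega> i) ?S"
    by (rule gaussfield.indep_vars_compose2[OF
          gaussfield.indep_vars_subset[OF indep_vars_gaussfield], of ?S "\<lambda>i x. a i * x" "\<lambda>_. borel"]) simp_all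
  have dist: "distributed gaussfield lborel (\<lambda>\<omega>. a i * \<omega> i) (normal_density 0 \<bar>a i\<bar>)" if "i \<in> ?S" for i
    using gaussfield.normal_density_affine[OF distributed_component, of "a i" 0 i] that by simp
  have "distributed gaussfield lborel (\<lambda>\<omega>. \<Sum>i\<in>?S. a i * \<omega> i)
      (normal_density (\<Sum>i\<in>?S. 0) (sqrt (\<Sum>i\<in>?S. \<bar>a i\<bar>\<^sup>2)))"
    by (rule gaussfield.sum_indep_normal[OF S ind]) (use dist in auto)
  then have "distributed gaussfield lborel (\<lambda>\<omega>. \<Sum>i\<in>?S. a i * \<omega> i) std_normal_density"
    using un by simp
  moreover have "(\<lambda>\<omega>. \<Sum>i\<in>?S. a i * \<omega> i) = (\<lambda>\<omega>. \<Sum>i\<in>S. a i * \<omega> i)"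
    by (intro ext, rule sum.mono_neutral_left) (use fin in auto)
  ultimately have "distr gaussfield lborel (\<lambda>\<omega>. \<Sum>i\<in>S. a i * \<omega> i) = gauss1"
    by (simp add: distributed_def)
  from trans[OF distr_cong_sets this, of borel] show ?thesis
    by simp
qed

text \<open>Linear forms on disjoint sets of coordinates are independent, and unit coefficients keep
  each of them standard normal. Reindexing, reflection, mixing two fields and the blocks of the
  comparison are all instances.\<close>

lemma distr_gaussfield_blocks:
  fixes S :: "'j \<Rightarrow> 'i set"
  assumes disj: "disjoint_family S" and fin: "\<And>j. finite (S j)"
    and unit: "\<And>j. (\<Sum>i\<in>S j. (a j i)\<^sup>2) = 1"
  shows "distr gaussfield gaussfield (\<lambda>\<omega> j. \<Sum>i\<in>S j. a j i * \<omega> i) = gaussfield"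
proof -
  let ?Y = "\<lambda>j \<omega>. \<Sum>i\<in>S j. a j i * \<omega> i"
  have "gaussfield.indep_vars (\<lambda>_. borel) (\<lambda>j \<omega>. ?Y j (restrict \<omega> (S j))) UNIV"
    by (rule indep_vars_blocks[OF disj])
       (intro borel_measurable_sum borel_measurable_times borel_measurable_const measurable_component_singleton)
  then have ind: "gaussfield.indep_vars (\<lambda>_. borel) ?Y UNIV"
    by simp
  have "distr gaussfield (PiM UNIV (\<lambda>_. borel)) (\<lambda>\<omega>. \<lambda>j\<in>UNIV. ?Y j \<omega>)
      = (\<Pi>\<^sub>M j\<in>UNIV. distr gaussfield borel (?Y j))"
    by (rule gaussfield.indep_vars_iff_distr_eq_PiM'[THEN iffD1, OF _ _ ind]) auto
  then have "distr gaussfield (PiM UNIV (\<lambda>_. borel)) (\<lambda>\<omega> j. ?Y j \<omega>) = gaussfield"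
    by (simp add: restrict_UNIV distr_unit_combination[OF fin unit] gaussfield_def[symmetric])
  from trans[OF distr_cong_sets[OF sets_gaussfield] this] show ?thesis .
qed

lemma distr_gaussfield_reindex:
  fixes g :: "'j \<Rightarrow> 'i"
  assumes "inj g"
  shows "distr gaussfield gaussfield (\<lambda>\<omega> j. \<omega> (g j)) = gaussfield"
proof -
  have "disjoint_family (\<lambda>j. {g j})"
    using assms by (auto simp: disjoint_family_on_def inj_eq)
  from distr_gaussfield_blocks[OF this, of "\<lambda>_ _. 1"] show ?thesis
    by simp
qed

lemma inj_Inl_Inr: "inj Inl" "inj Inr"
  by (auto simp: inj_def)

text \<open>Realises two independent fields inside one, so that statements about a pair reduce to
  independence of the coordinates of a single field.\<close>

lemma distr_halves:
  "distr gaussfield (gaussfield \<Otimes>\<^sub>M gaussfield)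
     (\<lambda>\<omega>. (\<lambda>i. \<omega> (Inl i :: 'i + 'i), \<lambda>i. \<omega> (Inr i))) = gaussfield \<Otimes>\<^sub>M gaussfield"
proof -
  have "gaussfield.indep_var (PiM (range Inl) (\<lambda>_. borel)) (\<lambda>\<omega>. restrict (\<lambda>i. \<omega> i) (range Inl))
      (PiM (range (Inr :: 'i \<Rightarrow> 'i + 'i)) (\<lambda>_. borel)) (\<lambda>\<omega>. restrict (\<lambda>i. \<omega> i) (range Inr))"
    by (rule gaussfield.indep_var_restrict[OF indep_vars_gaussfield]) auto
  from gaussfield.indep_var_compose[OF this, of "\<lambda>f i. f (Inl i)" gaussfield "\<lambda>f i. f (Inr i)" gaussfield]
  have "gaussfield.indep_var gaussfield (\<lambda>\<omega> i. \<omega> (Inl i :: 'i + 'i)) gaussfield (\<lambda>\<omega> i. \<omega> (Inr i))"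
    by (simp add: comp_def measurable_into_gaussfield measurable_component_singleton)
  then have "distr gaussfield gaussfield (\<lambda>\<omega> i. \<omega> (Inl i :: 'i + 'i)) \<Otimes>\<^sub>M
      distr gaussfield gaussfield (\<lambda>\<omega> i. \<omega> (Inr i :: 'i + 'i)) =
      distr gaussfield (gaussfield \<Otimes>\<^sub>M gaussfield) (\<lambda>\<omega>. (\<lambda>i. \<omega> (Inl i :: 'i + 'i), \<lambda>i. \<omega> (Inr i)))"
    using gaussfield.indep_var_distribution_eq[THEN iffD1] by blast
  then show ?thesis
    unfolding distr_gaussfield_reindex[OF inj_Inl_Inr(1)] distr_gaussfield_reindex[OF inj_Inl_Inr(2)]
    by (rule sym)
qed

lemma measurable_case_sum:
  "(\<lambda>p. case_sum (fst p) (snd p)) \<in> measurable (gaussfield \<Otimes>\<^sub>M gaussfield) gaussfield"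
proof (rule measurable_into_gaussfield)
  fix j :: "'a + 'b"
  show "(\<lambda>p. case_sum (fst p) (snd p) j) \<in> borel_measurable (gaussfield \<Otimes>\<^sub>M gaussfield)"
    by (cases j) (auto intro: measurable_compose[OF measurable_fst measurable_gaussfield_component]
        measurable_compose[OF measurable_snd measurable_gaussfield_component])
qed

lemma measurable_halves:
  "(\<lambda>\<omega>. (\<lambda>i. \<omega> (f i), \<lambda>i. \<omega> (g i))) \<in> measurable gaussfield (gaussfield \<Otimes>\<^sub>M gaussfield)"
  by (intro measurable_Pair measurable_into_gaussfield) auto

lemma measurable_reindex: "(\<lambda>\<omega> i. \<omega> (f i)) \<in> measurable gaussfield gaussfield"
  by (intro measurable_into_gaussfield) auto

text \<open>\<open>distr_halves\<close> requires equal index types. The proof therefore takes two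
  fields over the sum type and keeps the left half of the first and the right half of the second;
  inside one larger field this is the injective reindexing \<open>?g\<close>.\<close>

lemma distr_case_sum:
  "distr (gaussfield \<Otimes>\<^sub>M gaussfield) gaussfield (\<lambda>p. case_sum (fst p) (snd p)) =
    (gaussfield :: ('i + 'j \<Rightarrow> real) measure)"
proof -
  let ?X = "\<lambda>\<omega> i. \<omega> (Inl i :: 'i + 'j) :: real" and ?Y = "\<lambda>\<omega> i. \<omega> (Inr i :: 'i + 'j) :: real"
  let ?P = "gaussfield \<Otimes>\<^sub>M gaussfield :: (('i + 'j \<Rightarrow> real) \<times> ('i + 'j \<Rightarrow> real)) measure"
  let ?Q = "gaussfield \<Otimes>\<^sub>M gaussfield :: (('i \<Rightarrow> real) \<times> ('j \<Rightarrow> real)) measure"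
  let ?g = "map_sum Inl Inr :: 'i + 'j \<Rightarrow> ('i + 'j) + ('i + 'j)"
  have "distr gaussfield gaussfield ?X \<Otimes>\<^sub>M distr gaussfield gaussfield ?Y =
      distr ?P ?Q (\<lambda>(x, y). (?X x, ?Y y))"
    by (rule pair_measure_distr)
       (auto intro!: measurable_reindex prob_space_imp_sigma_finite gaussfield.prob_space_distr)
  then have 1: "?Q = distr ?P ?Q (\<lambda>(x, y). (?X x, ?Y y))"
    unfolding distr_gaussfield_reindex[OF inj_Inl_Inr(1)] distr_gaussfield_reindex[OF inj_Inl_Inr(2)] .
  have 2: "(\<lambda>(x, y). (?X x, ?Y y)) \<in> measurable ?P ?Q"
    unfolding case_prod_beta
    by (intro measurable_Pair measurable_into_gaussfield
        measurable_compose[OF measurable_fst measurable_gaussfield_component]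
        measurable_compose[OF measurable_snd measurable_gaussfield_component])
  have 3: "(\<lambda>p. case_sum (fst p) (snd p)) \<circ> ((\<lambda>(x, y). (?X x, ?Y y)) \<circ>
      (\<lambda>\<omega>. (\<lambda>i. \<omega> (Inl i), \<lambda>i. \<omega> (Inr i)))) = (\<lambda>\<omega> j. \<omega> (?g j))"
    by (auto simp: fun_eq_iff split: sum.split)
  have "distr ?Q gaussfield (\<lambda>p. case_sum (fst p) (snd p))
      = distr gaussfield gaussfield (\<lambda>\<omega> j. \<omega> (?g j))"
    by (subst 1, subst distr_halves[symmetric], subst distr_distr[OF 2 measurable_halves],
        subst distr_distr[OF measurable_case_sum measurable_comp[OF measurable_halves 2]], subst 3, rule refl)
  also have "\<dots> = gaussfield"
    by (intro distr_gaussfield_reindex injI) (auto simp: map_sum_def split: sum.splits)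
  finally show ?thesis .
qed

section \<open>Rotations and exponential moments\<close>

text \<open>Two one-dimensional substitutions: \<open>u = c * x + s * y\<close> at fixed
  \<open>y\<close>, then \<open>v = (y - s * u) / c\<close> at fixed \<open>u\<close>. Their
  Jacobians cancel; the division by \<open>c\<close> is the reason for
  \<open>c \<noteq> 0\<close>.\<close>

lemma nn_integral_pair_rotation:
  fixes F :: "real \<times> real \<Rightarrow> ennreal"
  assumes [measurable]: "F \<in> borel_measurable (lborel \<Otimes>\<^sub>M lborel)"
    and c: "c \<noteq> 0" and cs: "c\<^sup>2 + s\<^sup>2 = (1::real)"
  shows "(\<integral>\<^sup>+x. \<integral>\<^sup>+y. F (c * x + s * y, - s * x + c * y) \<partial>lborel \<partial>lborel) =
    (\<integral>\<^sup>+u. \<integral>\<^sup>+v. F (u, v) \<partial>lborel \<partial>lborel)"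
proof -
  have c1: "\<bar>1 / c\<bar> * \<bar>c\<bar> = 1" using c by simp
  have inner: "(\<integral>\<^sup>+x. F (c * x + s * y, - s * x + c * y) \<partial>lborel)
      = ennreal \<bar>1 / c\<bar> * (\<integral>\<^sup>+u. F (u, - s * u / c + 1 / c * y) \<partial>lborel)" for y
  proof -
    have eq: "- s * (s * y + c * x) / c + 1 / c * y = - s * x + c * y" for x
    proof -
      have "- s * (s * y + c * x) / c + 1 / c * y = ((1 - s\<^sup>2) * y - s * c * x) / c"
        using c by (simp add: field_simps power2_eq_square)
      also have "1 - s\<^sup>2 = c\<^sup>2" using cs by simp
      finally show ?thesis using c by (simp add: field_simps power2_eq_square)
    qed
    have "(\<integral>\<^sup>+u. F (u, - s * u / c + 1 / c * y) \<partial>lborel)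
        = ennreal \<bar>c\<bar> * (\<integral>\<^sup>+x. F (s * y + c * x, - s * (s * y + c * x) / c + 1 / c * y) \<partial>lborel)"
      by (rule nn_integral_real_affine) (use c in auto)
    also have "\<dots> = ennreal \<bar>c\<bar> * (\<integral>\<^sup>+x. F (c * x + s * y, - s * x + c * y) \<partial>lborel)"
      unfolding eq by (simp add: add.commute)
    finally show ?thesis
      using c1 by (simp add: mult.assoc[symmetric] ennreal_mult[symmetric])
  qed
  have "(\<integral>\<^sup>+x. \<integral>\<^sup>+y. F (c * x + s * y, - s * x + c * y) \<partial>lborel \<partial>lborel)
      = (\<integral>\<^sup>+y. \<integral>\<^sup>+x. F (c * x + s * y, - s * x + c * y) \<partial>lborel \<partial>lborel)"
    by (rule lborel_pair.Fubini') simp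
  also have "\<dots> = ennreal \<bar>1 / c\<bar> * (\<integral>\<^sup>+y. \<integral>\<^sup>+u. F (u, - s * u / c + 1 / c * y) \<partial>lborel \<partial>lborel)"
    unfolding inner by (rule nn_integral_cmult) simp
  also have "(\<integral>\<^sup>+y. \<integral>\<^sup>+u. F (u, - s * u / c + 1 / c * y) \<partial>lborel \<partial>lborel)
      = (\<integral>\<^sup>+u. \<integral>\<^sup>+y. F (u, - s * u / c + 1 / c * y) \<partial>lborel \<partial>lborel)"
    by (rule lborel_pair.Fubini') simp
  also have "ennreal \<bar>1 / c\<bar> * \<dots> = (\<integral>\<^sup>+u. ennreal \<bar>1 / c\<bar> * (\<integral>\<^sup>+y. F (u, - s * u / c + 1 / c * y) \<partial>lborel) \<partial>lborel)"
    by (rule nn_integral_cmult[symmetric]) simp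
  also have "\<dots> = (\<integral>\<^sup>+u. \<integral>\<^sup>+v. F (u, v) \<partial>lborel \<partial>lborel)"
  proof (rule nn_integral_cong)
    fix u
    show "ennreal \<bar>1 / c\<bar> * (\<integral>\<^sup>+y. F (u, - s * u / c + 1 / c * y) \<partial>lborel) = (\<integral>\<^sup>+v. F (u, v) \<partial>lborel)"
      by (rule nn_integral_real_affine[symmetric]) (use c in auto)
  qed
  finally show ?thesis .
qed

lemma nn_integral_gauss1_pair:
  fixes f :: "real \<times> real \<Rightarrow> ennreal"
  assumes [measurable]: "f \<in> borel_measurable (borel \<Otimes>\<^sub>M borel)"
  shows "(\<integral>\<^sup>+p. f p \<partial>(gauss1 \<Otimes>\<^sub>M gauss1)) =
    (\<integral>\<^sup>+x. \<integral>\<^sup>+y. ennreal (std_normal_density x * std_normal_density y) * f (x, y) \<partial>lborel \<partial>lborel)"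
proof -
  have "(\<integral>\<^sup>+p. f p \<partial>(gauss1 \<Otimes>\<^sub>M gauss1)) = (\<integral>\<^sup>+x. \<integral>\<^sup>+y. f (x, y) \<partial>gauss1 \<partial>gauss1)"
    by (rule gauss1.nn_integral_fst[symmetric]) simp
  also have "\<dots> = (\<integral>\<^sup>+x. ennreal (std_normal_density x) * (\<integral>\<^sup>+y. ennreal (std_normal_density y) * f (x, y) \<partial>lborel) \<partial>lborel)"
    by (simp add: nn_integral_density)
  also have "\<dots> = (\<integral>\<^sup>+x. \<integral>\<^sup>+y. ennreal (std_normal_density x * std_normal_density y) * f (x, y) \<partial>lborel \<partial>lborel)"
    by (intro nn_integral_cong, subst nn_integral_cmult[symmetric]) (simp_all add: ennreal_mult mult.assoc)
  finally show ?thesis .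
qed

lemma distr_gauss1_rotation:
  assumes c: "c \<noteq> 0" and cs: "c\<^sup>2 + s\<^sup>2 = (1::real)"
  shows "distr (gauss1 \<Otimes>\<^sub>M gauss1) (borel \<Otimes>\<^sub>M borel) (\<lambda>p. (c * fst p + s * snd p, - s * fst p + c * snd p))
    = gauss1 \<Otimes>\<^sub>M gauss1" (is "distr ?P ?B ?T = _")
proof (rule measure_eqI)
  show "sets (distr ?P ?B ?T) = sets ?P"
    by (simp cong: sets_pair_measure_cong)
next
  fix A assume "A \<in> sets (distr ?P ?B ?T)"
  then have A [measurable]: "A \<in> sets (borel \<Otimes>\<^sub>M borel)" by simp
  have T [measurable]: "?T \<in> measurable ?B ?B" by measurable
  have T': "?T \<in> measurable ?P ?B"
    using T by (simp cong: measurable_cong_sets sets_pair_measure_cong)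
  have sA: "A \<in> sets ?P" using A by (simp cong: sets_pair_measure_cong)
  have dens: "std_normal_density x * std_normal_density y =
      std_normal_density (c * x + s * y) * std_normal_density (- s * x + c * y)" for x y
  proof -
    have "(c * x + s * y)\<^sup>2 + (- s * x + c * y)\<^sup>2 = (c\<^sup>2 + s\<^sup>2) * (x\<^sup>2 + y\<^sup>2)"
      by (simp add: power2_eq_square algebra_simps)
    then have e: "- (c * x + s * y)\<^sup>2 / 2 + - (- s * x + c * y)\<^sup>2 / 2 = - x\<^sup>2 / 2 + - y\<^sup>2 / 2"
      using cs by (simp add: field_simps)
    show ?thesis
      unfolding std_normal_density_def
      using arg_cong[OF e, of exp] by (simp only: exp_add mult.assoc mult.left_commute)
  qed
  define F where "F = (\<lambda>p. ennreal (std_normal_density (fst p) * std_normal_density (snd p)) * indicator A p)"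
  have F [measurable]: "F \<in> borel_measurable (lborel \<Otimes>\<^sub>M lborel)"
    unfolding F_def by (simp cong: measurable_cong_sets sets_pair_measure_cong)
  have "emeasure (distr ?P ?B ?T) A = (\<integral>\<^sup>+q. indicator A q \<partial>distr ?P ?B ?T)"
    using A by simp
  also have "\<dots> = (\<integral>\<^sup>+p. indicator A (?T p) \<partial>?P)"
    by (rule nn_integral_distr[OF T']) simp
  also have "\<dots> = (\<integral>\<^sup>+x. \<integral>\<^sup>+y. F (c * x + s * y, - s * x + c * y) \<partial>lborel \<partial>lborel)"
  proof -
    have m: "(\<lambda>p. indicator A (?T p) :: ennreal) \<in> borel_measurable ?B"
      by measurable
    show ?thesis
      unfolding nn_integral_gauss1_pair[OF m] F_def fst_conv snd_conv dens[symmetric] ..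
  qed
  also have "\<dots> = (\<integral>\<^sup>+x. \<integral>\<^sup>+y. F (x, y) \<partial>lborel \<partial>lborel)"
    by (rule nn_integral_pair_rotation[OF F c cs])
  also have "\<dots> = (\<integral>\<^sup>+p. indicator A p \<partial>?P)"
    by (subst nn_integral_gauss1_pair) (simp_all add: F_def)
  also have "\<dots> = emeasure ?P A"
    using sA by simp
  finally show "emeasure (distr ?P ?B ?T) A = emeasure ?P A" .
qed

lemma distr_component_pair:
  "distr gaussfield (borel \<Otimes>\<^sub>M borel) (\<lambda>\<omega>. (\<omega> (Inl i), \<omega> (Inr i :: 'i + 'i))) = gauss1 \<Otimes>\<^sub>M gauss1"
proof -
  let ?P = "gaussfield \<Otimes>\<^sub>M gaussfield :: (('i \<Rightarrow> real) \<times> ('i \<Rightarrow> real)) measure"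
  let ?B = "borel \<Otimes>\<^sub>M borel :: (real \<times> real) measure"
  have "distr gaussfield borel (\<lambda>\<omega>. \<omega> i) \<Otimes>\<^sub>M distr gaussfield borel (\<lambda>\<omega>. \<omega> i)
      = distr ?P ?B (\<lambda>(x, y). (x i, y i))"
    by (rule pair_measure_distr)
       (auto intro!: prob_space_imp_sigma_finite gaussfield.prob_space_distr)
  then have 1: "gauss1 \<Otimes>\<^sub>M gauss1 = distr ?P ?B (\<lambda>(x, y). (x i, y i))"
    unfolding distr_gaussfield_component .
  have 2: "(\<lambda>(x, y). (x i, y i)) \<in> measurable ?P ?B"
    unfolding case_prod_beta by measurable
  show ?thesis
    by (subst 1, subst distr_halves[symmetric], subst distr_distr[OF 2 measurable_halves]) (simp add: comp_def)
qed

text \<open>The planes of \<open>Inl i\<close> and \<open>Inr i\<close> are independent, so one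
  planar rotation suffices. The joint law of both rotated copies is wanted: an increment along the
  rotation path depends on the current point and on its velocity.\<close>

lemma distr_gaussfield_rotation:
  fixes c s :: real
  assumes c: "c \<noteq> 0" and cs: "c\<^sup>2 + s\<^sup>2 = 1"
  shows "distr (gaussfield \<Otimes>\<^sub>M gaussfield) (gaussfield \<Otimes>\<^sub>M gaussfield)
      (\<lambda>p. (\<lambda>i. c * fst p i + s * snd p i, \<lambda>i. - s * fst p i + c * snd p (i::'i)))
    = gaussfield \<Otimes>\<^sub>M gaussfield" (is "distr ?P ?P ?R = ?P")
proof -
  let ?B = "borel \<Otimes>\<^sub>M borel :: (real \<times> real) measure"
  let ?K = "\<lambda>i. {Inl i, Inr i} :: ('i + 'i) set"
  let ?V = "\<lambda>i \<omega>. (\<omega> (Inl i), \<omega> (Inr i :: 'i + 'i)) :: real \<times> real"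
  let ?T = "\<lambda>p. (c * fst p + s * snd p, - s * fst p + c * snd p)"
  let ?H = "\<lambda>\<omega>. (\<lambda>i. \<omega> (Inl i), \<lambda>i. \<omega> (Inr i :: 'i + 'i)) :: ('i \<Rightarrow> real) \<times> ('i \<Rightarrow> real)"
  let ?U = "\<lambda>w. (\<lambda>i. fst (w i), \<lambda>i. snd (w i)) :: ('i \<Rightarrow> real) \<times> ('i \<Rightarrow> real)"
  have disj: "disjoint_family ?K"
    by (auto simp: disjoint_family_on_def)
  have T [measurable]: "?T \<in> measurable ?B ?B" by measurable
  have pV: "(\<lambda>f. (f (Inl i), f (Inr i))) \<in> measurable (PiM (?K i) (\<lambda>_. borel)) ?B" for i :: 'i
    by (intro measurable_Pair measurable_component_singleton) auto
  have "gaussfield.indep_vars (\<lambda>_. ?B) (\<lambda>i \<omega>. (\<lambda>f. (f (Inl i), f (Inr i))) (restrict \<omega> (?K i))) UNIV"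
    by (rule indep_vars_blocks[OF disj pV])
  then have ind: "gaussfield.indep_vars (\<lambda>_. ?B) ?V UNIV"
    by simp
  have ind': "gaussfield.indep_vars (\<lambda>_. ?B) (\<lambda>i \<omega>. ?T (?V i \<omega>)) UNIV"
    by (rule gaussfield.indep_vars_compose2[OF ind T])
  have V: "?V i \<in> measurable gaussfield ?B" for i by measurable
  have TV: "(\<lambda>\<omega>. ?T (?V i \<omega>)) \<in> measurable gaussfield ?B" for i by measurable
  have dV: "distr gaussfield ?B (?V i) = gauss1 \<Otimes>\<^sub>M gauss1" for i
    by (rule distr_component_pair)
  have dTV: "distr gaussfield ?B (\<lambda>\<omega>. ?T (?V i \<omega>)) = gauss1 \<Otimes>\<^sub>M gauss1" for i
  proof -
    have "distr gaussfield ?B (\<lambda>\<omega>. ?T (?V i \<omega>)) = distr (distr gaussfield ?B (?V i)) ?B ?T"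
      by (subst distr_distr[OF T V]) (simp add: comp_def)
    also have "\<dots> = gauss1 \<Otimes>\<^sub>M gauss1"
      unfolding dV by (rule distr_gauss1_rotation[OF c cs])
    finally show ?thesis .
  qed
  have "distr gaussfield (PiM UNIV (\<lambda>_. ?B)) (\<lambda>\<omega>. \<lambda>i\<in>UNIV. ?V i \<omega>)
      = (\<Pi>\<^sub>M i\<in>UNIV. distr gaussfield ?B (?V i))"
    by (rule gaussfield.indep_vars_iff_distr_eq_PiM'[THEN iffD1, OF _ _ ind]) (use V in auto)
  then have W: "distr gaussfield (PiM UNIV (\<lambda>_. ?B)) (\<lambda>\<omega> i. ?V i \<omega>) = (\<Pi>\<^sub>M i\<in>UNIV. gauss1 \<Otimes>\<^sub>M gauss1)"
    unfolding dV restrict_UNIV .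
  have "distr gaussfield (PiM UNIV (\<lambda>_. ?B)) (\<lambda>\<omega>. \<lambda>i\<in>UNIV. ?T (?V i \<omega>))
      = (\<Pi>\<^sub>M i\<in>UNIV. distr gaussfield ?B (\<lambda>\<omega>. ?T (?V i \<omega>)))"
    by (rule gaussfield.indep_vars_iff_distr_eq_PiM'[THEN iffD1, OF _ _ ind']) (use TV in auto)
  then have TW: "distr gaussfield (PiM UNIV (\<lambda>_. ?B)) (\<lambda>\<omega> i. ?T (?V i \<omega>)) = (\<Pi>\<^sub>M i\<in>UNIV. gauss1 \<Otimes>\<^sub>M gauss1)"
    unfolding dTV restrict_UNIV .
  have mW: "(\<lambda>\<omega> i. ?V i \<omega>) \<in> measurable gaussfield (PiM UNIV (\<lambda>_. ?B))"
    by (rule measurable_abs_UNIV[OF V])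
  have mTW: "(\<lambda>\<omega> i. ?T (?V i \<omega>)) \<in> measurable gaussfield (PiM UNIV (\<lambda>_. ?B))"
    by (rule measurable_abs_UNIV[OF TV])
  have comp: "(\<lambda>w. w i) \<in> measurable (PiM UNIV (\<lambda>_::'i. ?B)) ?B" for i
    by (rule measurable_component_singleton) simp
  have mU: "?U \<in> measurable (PiM UNIV (\<lambda>_. ?B)) ?P"
    by (intro measurable_Pair measurable_into_gaussfield measurable_compose[OF comp measurable_fst]
        measurable_compose[OF comp measurable_snd])
  have mR: "?R \<in> measurable ?P ?P"
    by (intro measurable_Pair measurable_into_gaussfield) measurable
  have "distr ?P ?P ?R = distr gaussfield ?P (?R \<circ> ?H)"
    by (subst distr_halves[symmetric], rule distr_distr[OF mR measurable_halves])
  also have "?R \<circ> ?H = ?U \<circ> (\<lambda>\<omega> i. ?T (?V i \<omega>))"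
    by (simp add: fun_eq_iff)
  also have "distr gaussfield ?P (?U \<circ> (\<lambda>\<omega> i. ?T (?V i \<omega>))) = distr gaussfield ?P (?U \<circ> (\<lambda>\<omega> i. ?V i \<omega>))"
    unfolding distr_distr[OF mU mTW, symmetric] distr_distr[OF mU mW, symmetric] W TW ..
  also have "?U \<circ> (\<lambda>\<omega> i. ?V i \<omega>) = ?H"
    by (simp add: fun_eq_iff)
  finally show ?thesis
    unfolding distr_halves .
qed

lemma distr_gaussfield_sum:
  fixes p q :: real
  assumes pq: "p\<^sup>2 + q\<^sup>2 = 1"
  shows "distr (gaussfield \<Otimes>\<^sub>M gaussfield) gaussfield (\<lambda>w i. p * fst w i + q * snd w i) = gaussfield"
proof -
  have m: "(\<lambda>w i. p * fst w i + q * snd w i) \<in> measurable (gaussfield \<Otimes>\<^sub>M gaussfield) gaussfield"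
    by (intro measurable_into_gaussfield) measurable
  have "disjoint_family (\<lambda>i. {Inl i, Inr i})"
    by (auto simp: disjoint_family_on_def)
  from distr_gaussfield_blocks[OF this, of "\<lambda>_. case_sum (\<lambda>_. p) (\<lambda>_. q)"] pq show ?thesis
    by (subst distr_halves[symmetric], subst distr_distr[OF m measurable_halves]) (simp add: comp_def)
qed

lemma exp_std_normal_density:
  "exp (t * x) * std_normal_density x = exp (t\<^sup>2 / 2) * normal_density t 1 x"
proof -
  have "t * x + - x\<^sup>2 / 2 = t\<^sup>2 / 2 + - (x - t)\<^sup>2 / 2"
    by (simp add: power2_eq_square field_simps)
  then have "exp (t * x) * exp (- x\<^sup>2 / 2) = exp (t\<^sup>2 / 2) * exp (- (x - t)\<^sup>2 / 2)"
    by (metis exp_add)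
  then show ?thesis
    by (simp add: normal_density_def)
qed

lemma gauss1_exp:
  shows "integrable gauss1 (\<lambda>x. exp (t * x))" and "(\<integral>x. exp (t * x) \<partial>gauss1) = exp (t\<^sup>2 / 2)"
proof -
  have *: "std_normal_density x * exp (t * x) = exp (t\<^sup>2 / 2) * normal_density t 1 x" for x
    using exp_std_normal_density[of t x] by (simp add: mult.commute)
  have "integrable lborel (\<lambda>x. std_normal_density x * exp (t * x))"
    unfolding * by simp
  then show "integrable gauss1 (\<lambda>x. exp (t * x))"
    by (subst integrable_density) auto
  have "(\<integral>x. exp (t * x) \<partial>gauss1) = (\<integral>x. std_normal_density x * exp (t * x) \<partial>lborel)"
    by (subst integral_density) auto
  then show "(\<integral>x. exp (t * x) \<partial>gauss1) = exp (t\<^sup>2 / 2)"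
    unfolding * by simp
qed

lemma gaussfield_integrable_component:
  assumes "integrable gauss1 g"
  shows "integrable gaussfield (\<lambda>\<omega>. g (\<omega> i) :: real)" and "(\<integral>\<omega>. g (\<omega> i) \<partial>gaussfield) = (\<integral>x. g x \<partial>gauss1)"
proof -
  have g: "g \<in> borel_measurable borel"
    using borel_measurable_integrable[OF assms] by (simp add: measurable_cong_sets[OF sets_gauss1 refl])
  show "integrable gaussfield (\<lambda>\<omega>. g (\<omega> i))"
    using assms g integrable_distr_eq[OF measurable_gaussfield_component g, of i]
    by (simp add: distr_gaussfield_component)
  show "(\<integral>\<omega>. g (\<omega> i) \<partial>gaussfield) = (\<integral>x. g x \<partial>gauss1)"
    using integral_distr[OF measurable_gaussfield_component g, of i]
    by (simp add: distr_gaussfield_component)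
qed

lemma indep_vars_component_fun:
  assumes "\<And>i. g i \<in> borel_measurable borel"
  shows "gaussfield.indep_vars (\<lambda>_. borel) (\<lambda>i \<omega>. g i (\<omega> i) :: real) J"
  using gaussfield.indep_vars_compose2[OF gaussfield.indep_vars_subset[OF indep_vars_gaussfield], of J g "\<lambda>_. borel"] assms
  by simp

lemma gaussfield_exp_linear:
  assumes "finite J"
  shows "integrable gaussfield (\<lambda>\<omega>. exp (\<Sum>i\<in>J. u i * \<omega> i))"
    and "(\<integral>\<omega>. exp (\<Sum>i\<in>J. u i * \<omega> i) \<partial>gaussfield) = exp ((\<Sum>i\<in>J. (u i)\<^sup>2) / 2)"
proof -
  note I = gaussfield_integrable_component[OF gauss1_exp(1)]
  have ind: "gaussfield.indep_vars (\<lambda>_. borel) (\<lambda>i \<omega>. exp (u i * \<omega> i)) J"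
    by (rule indep_vars_component_fun) auto
  show "integrable gaussfield (\<lambda>\<omega>. exp (\<Sum>i\<in>J. u i * \<omega> i))"
    unfolding exp_sum[OF assms] by (rule gaussfield.indep_vars_integrable[OF assms ind I(1)])
  show "(\<integral>\<omega>. exp (\<Sum>i\<in>J. u i * \<omega> i) \<partial>gaussfield) = exp ((\<Sum>i\<in>J. (u i)\<^sup>2) / 2)"
    unfolding exp_sum[OF assms] gaussfield.indep_vars_lebesgue_integral[OF assms ind I(1)] I(2) gauss1_exp(2)
    by (simp add: exp_sum[OF assms] sum_divide_distrib)
qed

text \<open>The common majorant of what follows: it dominates exponentials of Lipschitz functions in
  the concentration argument and cubic remainders in the comparison.\<close>

lemma integrable_exp_abs_sum:
  assumes "finite J"
  shows "integrable gaussfield (\<lambda>\<omega>. exp (t * (\<Sum>i\<in>J. \<bar>\<omega> i\<bar>)))"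
proof -
  have b: "exp (t * \<bar>x\<bar>) \<le> exp (t * x) + exp (- t * x)" for x :: real
    by (cases "x \<ge> 0") (simp_all add: add_increasing add_increasing2)
  have "integrable gauss1 (\<lambda>x. exp (t * \<bar>x\<bar>))"
    by (rule Bochner_Integration.integrable_bound[OF Bochner_Integration.integrable_add[OF gauss1_exp(1)[of t] gauss1_exp(1)[of "-t"]]])
       (use b in \<open>auto intro: order_trans\<close>)
  note I = gaussfield_integrable_component(1)[OF this]
  have ind: "gaussfield.indep_vars (\<lambda>_. borel) (\<lambda>i \<omega>. exp (t * \<bar>\<omega> i\<bar>)) J"
    by (rule indep_vars_component_fun) auto
  show ?thesis
    unfolding sum_distrib_left exp_sum[OF assms]
    by (rule gaussfield.indep_vars_integrable[OF assms ind I])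
qed

section \<open>Concentration of sublinear functionals\<close>

text \<open>\<open>support\<close> makes \<open>f\<close> a maximum of linear functionals of
  Euclidean norm at most \<open>L\<close>. The maximiser at \<open>x\<close> serves as a gradient,
  so concentration is obtained without differentiating \<open>f\<close>. The dual norm of a
  transformed Gaussian vector and the Euclidean norm both have this form.\<close>

locale sublinear_functional =
  fixes J :: "'i set" and L :: real and f :: "('i \<Rightarrow> real) \<Rightarrow> real"
  assumes finite_J: "finite J" and L_nonneg: "0 \<le> L"
    and measurable_f [measurable]: "f \<in> borel_measurable gaussfield"
    and support: "\<exists>u. (\<Sum>i\<in>J. (u i)\<^sup>2) \<le> L\<^sup>2 \<and> f x = (\<Sum>i\<in>J. u i * x i) \<and> (\<forall>y. (\<Sum>i\<in>J. u i * y i) \<le> f y)"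
begin

abbreviation l1 :: "('i \<Rightarrow> real) \<Rightarrow> real" where
  "l1 x \<equiv> \<Sum>i\<in>J. \<bar>x i\<bar>"

lemma abs_linear_le:
  assumes "(\<Sum>i\<in>J. (u i)\<^sup>2) \<le> L\<^sup>2"
  shows "\<bar>\<Sum>i\<in>J. u i * x i\<bar> \<le> L * l1 x"
proof -
  have u: "\<bar>u i\<bar> \<le> L" if "i \<in> J" for i
  proof -
    have "(u i)\<^sup>2 \<le> (\<Sum>i\<in>J. (u i)\<^sup>2)"
      using that finite_J by (intro member_le_sum) auto
    then show ?thesis
      using assms L_nonneg abs_le_square_iff[of "u i" L] by simp
  qed
  have "\<bar>\<Sum>i\<in>J. u i * x i\<bar> \<le> (\<Sum>i\<in>J. \<bar>u i * x i\<bar>)" by (rule sum_abs)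
  also have "\<dots> \<le> (\<Sum>i\<in>J. L * \<bar>x i\<bar>)"
    by (intro sum_mono) (simp add: abs_mult mult_right_mono u)
  finally show ?thesis by (simp add: sum_distrib_left)
qed

lemma abs_f_le: "\<bar>f x\<bar> \<le> L * l1 x"
  using support[of x] abs_linear_le by metis

lemma integrable_exp_f: "integrable gaussfield (\<lambda>x. exp (t * f x))"
proof (rule Bochner_Integration.integrable_bound[OF integrable_exp_abs_sum[OF finite_J, of "\<bar>t\<bar> * L"]])
  show "AE x in gaussfield. norm (exp (t * f x)) \<le> norm (exp (\<bar>t\<bar> * L * l1 x))"
  proof (rule AE_I2)
    fix x
    have "t * f x \<le> \<bar>t\<bar> * \<bar>f x\<bar>" by (metis abs_ge_self abs_mult)
    also have "\<dots> \<le> \<bar>t\<bar> * (L * l1 x)" by (intro mult_left_mono abs_f_le) auto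
    finally show "norm (exp (t * f x)) \<le> norm (exp (\<bar>t\<bar> * L * l1 x))" by (simp add: mult.assoc)
  qed
qed simp

lemma integrable_f: "integrable gaussfield f"
proof (rule Bochner_Integration.integrable_bound[OF Bochner_Integration.integrable_add[OF integrable_exp_f[of 1] integrable_exp_f[of "-1"]]])
  show "AE x in gaussfield. norm (f x) \<le> norm (exp (1 * f x) + exp (- 1 * f x))"
  proof (rule AE_I2)
    fix x
    have "f x \<le> exp (f x)" "- f x \<le> exp (- f x)" "0 < exp (f x)" "0 < exp (- f x)"
      using exp_ge_add_one_self[of "f x"] exp_ge_add_one_self[of "- f x"] by (linarith, linarith, auto)
    then have "\<bar>f x\<bar> \<le> exp (f x) + exp (- f x)" by linarith
    then show "norm (f x) \<le> norm (exp (1 * f x) + exp (- 1 * f x))" by simp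
  qed
qed simp

text \<open>Only the functional \<open>u\<close> supporting \<open>f\<close> at the starting point
  enters: the increment is at most \<open>(1 - c) * f x - s * \<langle>u, y\<rangle>\<close>. As
  \<open>y\<close> is independent of \<open>x\<close>, the linear term integrates to the Gaussian
  factor; the term with \<open>1 - c\<close> is of second order in the angle.\<close>

lemma rotation_increment_bound:
  assumes c: "c \<le> 1" and t: "0 \<le> t"
  shows "(\<integral>\<^sup>+p. ennreal (exp (t * (f (fst p) - f (\<lambda>i. c * fst p i + s * snd p i)))) \<partial>(gaussfield \<Otimes>\<^sub>M gaussfield))
    \<le> ennreal (exp (t\<^sup>2 * s\<^sup>2 * L\<^sup>2 / 2)) * (\<integral>\<^sup>+x. ennreal (exp (t * (1 - c) * L * l1 x)) \<partial>gaussfield)"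
proof -
  have mc: "(\<lambda>p i. c * fst p i + s * snd p i) \<in> measurable (gaussfield \<Otimes>\<^sub>M gaussfield) (gaussfield :: ('i \<Rightarrow> real) measure)"
    by (intro measurable_into_gaussfield) measurable
  note [measurable] = measurable_compose[OF mc measurable_f]
  have inner: "(\<integral>\<^sup>+y. ennreal (exp (t * (f x - f (\<lambda>i. c * x i + s * y i)))) \<partial>gaussfield)
      \<le> ennreal (exp (t\<^sup>2 * s\<^sup>2 * L\<^sup>2 / 2)) * ennreal (exp (t * (1 - c) * L * l1 x))" for x
  proof -
    obtain u where u: "(\<Sum>i\<in>J. (u i)\<^sup>2) \<le> L\<^sup>2" "f x = (\<Sum>i\<in>J. u i * x i)" "\<And>y. (\<Sum>i\<in>J. u i * y i) \<le> f y"
      using support[of x] by blast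
    have le: "t * (f x - f (\<lambda>i. c * x i + s * y i)) \<le> t * (1 - c) * L * l1 x + (\<Sum>i\<in>J. (- t * s * u i) * y i)" for y
    proof -
      have "f x - f (\<lambda>i. c * x i + s * y i) \<le> f x - (\<Sum>i\<in>J. u i * (c * x i + s * y i))"
        using u(3)[of "\<lambda>i. c * x i + s * y i"] by simp
      also have "\<dots> = (1 - c) * f x - s * (\<Sum>i\<in>J. u i * y i)"
        unfolding u(2) by (simp add: algebra_simps sum.distrib sum_subtractf sum_distrib_left)
      also have "\<dots> \<le> (1 - c) * (L * l1 x) - s * (\<Sum>i\<in>J. u i * y i)"
        using c abs_f_le[of x] by (intro diff_right_mono mult_left_mono) auto
      finally have "t * (f x - f (\<lambda>i. c * x i + s * y i)) \<le> t * ((1 - c) * (L * l1 x) - s * (\<Sum>i\<in>J. u i * y i))"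
        using t by (rule mult_left_mono)
      also have "\<dots> = t * (1 - c) * L * l1 x + (\<Sum>i\<in>J. (- t * s * u i) * y i)"
        by (simp add: algebra_simps sum_distrib_left sum_negf sum_subtractf)
      finally show ?thesis .
    qed
    have "(\<integral>\<^sup>+y. ennreal (exp (t * (f x - f (\<lambda>i. c * x i + s * y i)))) \<partial>gaussfield)
        \<le> (\<integral>\<^sup>+y. ennreal (exp (t * (1 - c) * L * l1 x)) * ennreal (exp (\<Sum>i\<in>J. (- t * s * u i) * y i)) \<partial>gaussfield)"
      using le by (intro nn_integral_mono) (simp add: ennreal_mult[symmetric] exp_add[symmetric])
    also have "\<dots> = ennreal (exp (t * (1 - c) * L * l1 x)) * (\<integral>\<^sup>+y. ennreal (exp (\<Sum>i\<in>J. (- t * s * u i) * y i)) \<partial>gaussfield)"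
      by (rule nn_integral_cmult) simp
    also have "(\<integral>\<^sup>+y. ennreal (exp (\<Sum>i\<in>J. (- t * s * u i) * y i)) \<partial>gaussfield)
        = ennreal (exp ((\<Sum>i\<in>J. (- t * s * u i)\<^sup>2) / 2))"
      unfolding gaussfield_exp_linear(2)[OF finite_J, of "\<lambda>i. - t * s * u i", symmetric]
      by (rule nn_integral_eq_integral[OF gaussfield_exp_linear(1)[OF finite_J]]) auto
    also have "(\<Sum>i\<in>J. (- t * s * u i)\<^sup>2) = t\<^sup>2 * s\<^sup>2 * (\<Sum>i\<in>J. (u i)\<^sup>2)"
      by (simp add: power_mult_distrib sum_distrib_left)
    also have "ennreal (exp (t * (1 - c) * L * l1 x)) * ennreal (exp (t\<^sup>2 * s\<^sup>2 * (\<Sum>i\<in>J. (u i)\<^sup>2) / 2))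
        \<le> ennreal (exp (t * (1 - c) * L * l1 x)) * ennreal (exp (t\<^sup>2 * s\<^sup>2 * L\<^sup>2 / 2))"
      by (intro mult_left_mono ennreal_leI) (auto intro!: mult_left_mono u(1) divide_right_mono)
    finally show ?thesis by (simp add: mult.commute)
  qed
  have "(\<integral>\<^sup>+p. ennreal (exp (t * (f (fst p) - f (\<lambda>i. c * fst p i + s * snd p i)))) \<partial>(gaussfield \<Otimes>\<^sub>M gaussfield))
      = (\<integral>\<^sup>+x. \<integral>\<^sup>+y. ennreal (exp (t * (f x - f (\<lambda>i. c * x i + s * y i)))) \<partial>gaussfield \<partial>gaussfield)"
    by (subst gaussfield.nn_integral_fst[symmetric]) simp_all
  also have "\<dots> \<le> (\<integral>\<^sup>+x. ennreal (exp (t\<^sup>2 * s\<^sup>2 * L\<^sup>2 / 2)) * ennreal (exp (t * (1 - c) * L * l1 x)) \<partial>gaussfield)"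
    by (intro nn_integral_mono inner)
  also have "\<dots> = ennreal (exp (t\<^sup>2 * s\<^sup>2 * L\<^sup>2 / 2)) * (\<integral>\<^sup>+x. ennreal (exp (t * (1 - c) * L * l1 x)) \<partial>gaussfield)"
    by (rule nn_integral_cmult) simp
  finally show ?thesis .
qed

text \<open>Maurey and Pisier: the difference of two independent copies is the sum of the increments along the
  rotation path from one copy to the other, and each increment has, up to a rotation, the same law.\<close>

lemma exp_difference_bound_step:
  assumes m: "0 < (m::nat)" and t: "0 \<le> t"
  shows "(\<integral>\<^sup>+p. ennreal (exp (t * (f (fst p) - f (snd p)))) \<partial>(gaussfield \<Otimes>\<^sub>M gaussfield))
    \<le> ennreal (exp (t\<^sup>2 * pi\<^sup>2 * L\<^sup>2 / 8) * (\<integral>x. exp (t * pi\<^sup>2 / 8 / real m * L * l1 x) \<partial>gaussfield))"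
proof -
  let ?P = "gaussfield \<Otimes>\<^sub>M gaussfield :: (('i \<Rightarrow> real) \<times> ('i \<Rightarrow> real)) measure"
  \<comment> \<open>A quarter turn carries the first copy to the second; it is cut into
    \<open>m\<close> equal angles.\<close>
  define \<theta> where "\<theta> = pi / (2 * real m)"
  have \<theta>0: "0 \<le> \<theta>" using m by (simp add: \<theta>_def)
  define X where "X k p = (\<lambda>i. cos (real k * \<theta>) * fst p i + sin (real k * \<theta>) * snd p i)" for k and p :: "('i \<Rightarrow> real) \<times> ('i \<Rightarrow> real)"
  let ?g = "\<lambda>p. ennreal (exp (t * real m * (f (fst p) - f (\<lambda>i. cos \<theta> * fst p i + sin \<theta> * snd p i))))"
  have mX: "X k \<in> measurable ?P gaussfield" for k
    unfolding X_def by (intro measurable_into_gaussfield) measurable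
  note [measurable] = measurable_compose[OF mX measurable_f]
  have X0: "X 0 p = fst p" for p by (simp add: X_def)
  have m\<theta>: "real m * \<theta> = pi / 2" using m by (simp add: \<theta>_def)
  have Xm: "X m p = snd p" for p by (simp add: X_def m\<theta>)
  have mc: "(\<lambda>p i. cos \<theta> * fst p i + sin \<theta> * snd p i) \<in> measurable ?P (gaussfield :: ('i \<Rightarrow> real) measure)"
    by (intro measurable_into_gaussfield) measurable
  note [measurable] = measurable_compose[OF mc measurable_f]
  have step: "(\<integral>\<^sup>+p. ennreal (exp (t * real m * (f (X k p) - f (X (Suc k) p)))) \<partial>?P) = (\<integral>\<^sup>+p. ?g p \<partial>?P)" if "k < m" for k
  proof -
    let ?c = "cos (real k * \<theta>)" and ?s = "sin (real k * \<theta>)"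
    let ?R = "\<lambda>p. (\<lambda>i. ?c * fst p i + ?s * snd p i, \<lambda>i. - ?s * fst p i + ?c * snd p (i::'i))"
    \<comment> \<open>For \<open>k < m\<close> the angle stays below \<open>pi / 2\<close>, so its
      cosine is positive and the rotation lemma, which excludes a zero cosine, applies.\<close>
    have "real k * \<theta> < real m * \<theta>"
      using that m by (intro mult_strict_right_mono) (auto simp: \<theta>_def)
    then have "0 < ?c"
      using m\<theta> \<theta>0 by (intro cos_gt_zero_pi) (auto intro: less_le_trans[of _ 0])
    then have d: "distr ?P ?P ?R = ?P"
      by (intro distr_gaussfield_rotation) auto
    have mR: "?R \<in> measurable ?P ?P"
      by (intro measurable_Pair measurable_into_gaussfield) measurable
    have mg: "?g \<in> borel_measurable ?P" by measurable
    have "(\<integral>\<^sup>+p. ?g p \<partial>?P) = (\<integral>\<^sup>+p. ?g p \<partial>distr ?P ?P ?R)"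
      unfolding d ..
    also have "\<dots> = (\<integral>\<^sup>+p. ?g (?R p) \<partial>?P)"
      by (rule nn_integral_distr[OF mR]) (use mg in simp)
    also have "(\<lambda>p. ?g (?R p)) = (\<lambda>p. ennreal (exp (t * real m * (f (X k p) - f (X (Suc k) p)))))"
    proof -
      have "(\<lambda>i. cos \<theta> * (?c * a i + ?s * b i) + sin \<theta> * (- ?s * a i + ?c * b i)) = X (Suc k) (a, b)" for a b
        by (rule ext) (simp add: X_def distrib_right cos_add sin_add algebra_simps)
      then show ?thesis
        by (simp add: fun_eq_iff X_def)
    qed
    finally show ?thesis ..
  qed
  \<comment> \<open>Jensen for the average of \<open>m\<close> increments, each enlarged by the
    factor \<open>m\<close>. Averaging costs nothing afterwards, since by \<open>step\<close> all of
    them have the same exponential moment.\<close>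
  have conv: "exp (t * (f (fst p) - f (snd p))) \<le> (\<Sum>k<m. 1 / real m * exp (t * real m * (f (X k p) - f (X (Suc k) p))))" for p
  proof -
    have "f (fst p) - f (snd p) = (\<Sum>k<m. f (X k p) - f (X (Suc k) p))"
      using sum_lessThan_telescope'[of "\<lambda>k. f (X k p)" m] by (simp add: X0 Xm)
    then have "exp (t * (f (fst p) - f (snd p))) = exp (\<Sum>k<m. (1 / real m) *\<^sub>R (t * real m * (f (X k p) - f (X (Suc k) p))))"
      using m by (simp add: sum_distrib_left)
    also have "\<dots> \<le> (\<Sum>k<m. 1 / real m * exp (t * real m * (f (X k p) - f (X (Suc k) p))))"
      by (rule convex_on_sum[OF _ _ exp_convex]) (use m in auto)
    finally show ?thesis .
  qed
  have "(\<integral>\<^sup>+p. ennreal (exp (t * (f (fst p) - f (snd p)))) \<partial>?P)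
      \<le> (\<integral>\<^sup>+p. (\<Sum>k<m. ennreal (1 / real m) * ennreal (exp (t * real m * (f (X k p) - f (X (Suc k) p))))) \<partial>?P)"
  proof (rule nn_integral_mono)
    fix p
    have "(\<Sum>k<m. ennreal (1 / real m) * ennreal (exp (t * real m * (f (X k p) - f (X (Suc k) p)))))
       = ennreal (\<Sum>k<m. 1 / real m * exp (t * real m * (f (X k p) - f (X (Suc k) p))))"
    proof -
      have "ennreal (1 / real m) * ennreal (exp (t * real m * (f (X k p) - f (X (Suc k) p))))
          = ennreal (1 / real m * exp (t * real m * (f (X k p) - f (X (Suc k) p))))" for k
        by (rule ennreal_mult[symmetric]) auto
      then show ?thesis by (simp only:) (rule sum_ennreal, auto)
    qed
    then show "ennreal (exp (t * (f (fst p) - f (snd p)))) \<le> (\<Sum>k<m. ennreal (1 / real m) * ennreal (exp (t * real m * (f (X k p) - f (X (Suc k) p)))))"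
      using ennreal_leI[OF conv[of p]] by simp
  qed
  also have "\<dots> = (\<Sum>k<m. ennreal (1 / real m) * (\<integral>\<^sup>+p. ?g p \<partial>?P))"
    by (subst nn_integral_sum) (auto simp: nn_integral_cmult step)
  also have "\<dots> = (\<integral>\<^sup>+p. ?g p \<partial>?P)"
  proof -
    have "of_nat m * ennreal (1 / real m) = 1"
      using m by (simp add: ennreal_of_nat_eq_real_of_nat ennreal_mult[symmetric])
    then show ?thesis by (simp add: mult.assoc[symmetric])
  qed
  also have "\<dots> \<le> ennreal (exp ((t * real m)\<^sup>2 * (sin \<theta>)\<^sup>2 * L\<^sup>2 / 2)) *
      (\<integral>\<^sup>+x. ennreal (exp (t * real m * (1 - cos \<theta>) * L * l1 x)) \<partial>gaussfield)"
    using rotation_increment_bound[of "cos \<theta>" "t * real m" "sin \<theta>"] t by simp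
  also have "\<dots> \<le> ennreal (exp (t\<^sup>2 * pi\<^sup>2 * L\<^sup>2 / 8)) * (\<integral>\<^sup>+x. ennreal (exp (t * pi\<^sup>2 / 8 / real m * L * l1 x)) \<partial>gaussfield)"
  proof (intro mult_mono nn_integral_mono ennreal_leI)
    \<comment> \<open>The factor \<open>m\<^sup>2\<close> is compensated by
      \<open>sin \<theta> \<le> pi / (2 * m)\<close>, which leaves \<open>pi\<^sup>2 / 4\<close>. In
      contrast \<open>m * (1 - cos \<theta>)\<close> is of order \<open>1 / m\<close> and disappears
      in the limit.\<close>
    have "\<bar>sin \<theta>\<bar> \<le> \<theta>" using \<theta>0 abs_sin_x_le_abs_x[of \<theta>] by simp
    then have s2: "(sin \<theta>)\<^sup>2 \<le> \<theta>\<^sup>2" using \<theta>0 by (simp add: abs_le_square_iff[symmetric])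
    have "(t * real m)\<^sup>2 * (sin \<theta>)\<^sup>2 * L\<^sup>2 / 2 \<le> (t * real m)\<^sup>2 * \<theta>\<^sup>2 * L\<^sup>2 / 2"
      by (intro divide_right_mono mult_right_mono mult_left_mono s2) auto
    also have "\<dots> = t\<^sup>2 * pi\<^sup>2 * L\<^sup>2 / 8"
      using m by (simp add: \<theta>_def power_mult_distrib power_divide field_simps)
    finally show "exp ((t * real m)\<^sup>2 * (sin \<theta>)\<^sup>2 * L\<^sup>2 / 2) \<le> exp (t\<^sup>2 * pi\<^sup>2 * L\<^sup>2 / 8)" by simp
    fix x :: "'i \<Rightarrow> real"
    have "cos \<theta> = 1 - 2 * (sin (\<theta> / 2))\<^sup>2" using cos_double_sin[of "\<theta> / 2"] by simp
    moreover have "(sin (\<theta> / 2))\<^sup>2 \<le> (\<theta> / 2)\<^sup>2"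
      using abs_sin_x_le_abs_x[of "\<theta> / 2"] by (simp add: abs_le_square_iff[symmetric])
    ultimately have "1 - cos \<theta> \<le> \<theta>\<^sup>2 / 2" by (simp add: power2_eq_square)
    then have "real m * (1 - cos \<theta>) \<le> real m * (\<theta>\<^sup>2 / 2)" by (intro mult_left_mono) auto
    also have "\<dots> = pi\<^sup>2 / 8 / real m" using m by (simp add: \<theta>_def power2_eq_square field_simps)
    finally have "t * (real m * (1 - cos \<theta>)) * L * l1 x \<le> t * (pi\<^sup>2 / 8 / real m) * L * l1 x"
      using t L_nonneg by (intro mult_right_mono mult_left_mono sum_nonneg) auto
    then show "exp (t * real m * (1 - cos \<theta>) * L * l1 x) \<le> exp (t * pi\<^sup>2 / 8 / real m * L * l1 x)"
      by (simp add: mult.assoc)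
  qed auto
  also have "(\<integral>\<^sup>+x. ennreal (exp (t * pi\<^sup>2 / 8 / real m * L * l1 x)) \<partial>gaussfield)
      = ennreal (\<integral>x. exp (t * pi\<^sup>2 / 8 / real m * L * l1 x) \<partial>gaussfield)"
    by (rule nn_integral_eq_integral[OF integrable_exp_abs_sum[OF finite_J]]) auto
  finally show ?thesis
    by (simp add: ennreal_mult'')
qed

text \<open>As the subdivision is refined, the exponent of the correction factor tends to 0 under
  the majorant \<open>exp (a * l1 x)\<close>, so the factor itself tends to 1.\<close>

lemma exp_difference_bound:
  assumes t: "0 \<le> t"
  shows "(\<integral>\<^sup>+p. ennreal (exp (t * (f (fst p) - f (snd p)))) \<partial>(gaussfield \<Otimes>\<^sub>M gaussfield))
    \<le> ennreal (exp (t\<^sup>2 * pi\<^sup>2 * L\<^sup>2 / 8))"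
proof -
  define a where "a = t * pi\<^sup>2 / 8 * L"
  have a: "0 \<le> a" using t L_nonneg by (simp add: a_def)
  have "(\<lambda>m. \<integral>x. exp (a / real (Suc m) * l1 x) \<partial>gaussfield) \<longlonglongrightarrow> (\<integral>x. 1 \<partial>(gaussfield :: ('i \<Rightarrow> real) measure))"
  proof (rule integral_dominated_convergence)
    show "integrable gaussfield (\<lambda>x. exp (a * l1 x))"
      by (rule integrable_exp_abs_sum[OF finite_J])
    show "AE x in gaussfield. (\<lambda>m. exp (a / real (Suc m) * l1 x)) \<longlonglongrightarrow> 1"
    proof (rule AE_I2)
      fix x :: "'i \<Rightarrow> real"
      have "(\<lambda>m. a / real (Suc m) * l1 x) \<longlonglongrightarrow> 0 * l1 x"
        by (intro tendsto_mult tendsto_const LIMSEQ_Suc[OF lim_const_over_n])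
      from tendsto_exp[OF this] show "(\<lambda>m. exp (a / real (Suc m) * l1 x)) \<longlonglongrightarrow> 1" by simp
    qed
    fix m
    show "AE x in gaussfield. norm (exp (a / real (Suc m) * l1 x)) \<le> exp (a * l1 x)"
    proof (rule AE_I2)
      fix x :: "'i \<Rightarrow> real"
      have "a / real (Suc m) \<le> a" using a by (simp add: divide_le_eq mult_left_le field_simps)
      then show "norm (exp (a / real (Suc m) * l1 x)) \<le> exp (a * l1 x)"
        using mult_right_mono[of "a / real (Suc m)" a "l1 x"] by (simp add: sum_nonneg)
    qed
  qed simp_all
  then have "(\<lambda>m. exp (t\<^sup>2 * pi\<^sup>2 * L\<^sup>2 / 8) * (\<integral>x. exp (a / real (Suc m) * l1 x) \<partial>gaussfield))
      \<longlonglongrightarrow> exp (t\<^sup>2 * pi\<^sup>2 * L\<^sup>2 / 8) * 1"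
    by (intro tendsto_mult tendsto_const) (simp add: gaussfield.prob_space[simplified])
  then have "(\<lambda>m. ennreal (exp (t\<^sup>2 * pi\<^sup>2 * L\<^sup>2 / 8) * (\<integral>x. exp (a / real (Suc m) * l1 x) \<partial>gaussfield)))
      \<longlonglongrightarrow> ennreal (exp (t\<^sup>2 * pi\<^sup>2 * L\<^sup>2 / 8))"
    by (intro tendsto_ennrealI) simp
  then show ?thesis
  proof (rule LIMSEQ_le_const, intro exI allI impI)
    fix m
    have "t * pi\<^sup>2 / 8 / real (Suc m) * L * l1 x = a / real (Suc m) * l1 x" for x
      by (simp add: a_def)
    then show "(\<integral>\<^sup>+p. ennreal (exp (t * (f (fst p) - f (snd p)))) \<partial>(gaussfield \<Otimes>\<^sub>M gaussfield))
      \<le> ennreal (exp (t\<^sup>2 * pi\<^sup>2 * L\<^sup>2 / 8) * (\<integral>x. exp (a / real (Suc m) * l1 x) \<partial>gaussfield))"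
      using exp_difference_bound_step[of "Suc m", OF _ t] by simp
  qed
qed

lemma exp_expectation_product:
  assumes t: "0 \<le> t"
  shows "(\<integral>x. exp (t * f x) \<partial>gaussfield) * (\<integral>x. exp (- t * f x) \<partial>gaussfield) \<le> exp (t\<^sup>2 * pi\<^sup>2 * L\<^sup>2 / 8)"
proof -
  have e: "ennreal (\<integral>x. exp (s * f x) \<partial>gaussfield) = (\<integral>\<^sup>+x. ennreal (exp (s * f x)) \<partial>gaussfield)" for s
    by (rule nn_integral_eq_integral[OF integrable_exp_f, symmetric]) auto
  have "ennreal ((\<integral>x. exp (t * f x) \<partial>gaussfield) * (\<integral>x. exp (- t * f x) \<partial>gaussfield))
      = ennreal (\<integral>x. exp (t * f x) \<partial>gaussfield) * ennreal (\<integral>x. exp (- t * f x) \<partial>gaussfield)"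
    by (intro ennreal_mult integral_nonneg_AE) auto
  also have "\<dots> = (\<integral>\<^sup>+x. ennreal (exp (t * f x)) * (\<integral>\<^sup>+y. ennreal (exp (- t * f y)) \<partial>gaussfield) \<partial>gaussfield)"
    unfolding e by (rule nn_integral_multc[symmetric]) simp
  also have "\<dots> = (\<integral>\<^sup>+x. \<integral>\<^sup>+y. ennreal (exp (t * (f x - f y))) \<partial>gaussfield \<partial>gaussfield)"
    by (intro nn_integral_cong, subst nn_integral_cmult[symmetric])
       (auto simp: ennreal_mult[symmetric] exp_add[symmetric] right_diff_distrib)
  also have "\<dots> = (\<integral>\<^sup>+p. ennreal (exp (t * (f (fst p) - f (snd p)))) \<partial>(gaussfield \<Otimes>\<^sub>M gaussfield))"
    by (subst gaussfield.nn_integral_fst[symmetric]) simp_all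
  also have "\<dots> \<le> ennreal (exp (t\<^sup>2 * pi\<^sup>2 * L\<^sup>2 / 8))"
    by (rule exp_difference_bound[OF t])
  finally show ?thesis by (simp add: ennreal_le_iff)
qed

lemma exp_expectation_le: "exp (t * (\<integral>x. f x \<partial>gaussfield)) \<le> (\<integral>x. exp (t * f x) \<partial>gaussfield)"
proof -
  let ?E = "\<integral>x. f x \<partial>gaussfield"
  have "exp (t * ?E) = (\<integral>x. exp (t * ?E) * (1 + t * f x - t * ?E) \<partial>gaussfield)"
    using integrable_f by (simp add: gaussfield.prob_space[simplified])
  also have "\<dots> \<le> (\<integral>x. exp (t * f x) \<partial>gaussfield)"
  proof (rule integral_mono)
    fix x
    have "exp (t * ?E) * (1 + (t * f x - t * ?E)) \<le> exp (t * ?E) * exp (t * f x - t * ?E)"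
      by (intro mult_left_mono exp_ge_add_one_self) auto
    then show "exp (t * ?E) * (1 + t * f x - t * ?E) \<le> exp (t * f x)"
      by (simp add: exp_add[symmetric] add_diff_eq)
  qed (use integrable_f integrable_exp_f in auto)
  finally show ?thesis .
qed

text \<open>Passes from the difference of two copies to deviations from the mean: in
  \<open>exp_expectation_product\<close> the second factor is at least \<open>exp (- t * ?E)\<close>
  by Jensen and can be divided out. Negative \<open>t\<close> is covered by exchanging the
  factors.\<close>

lemma exp_expectation_bound:
  "(\<integral>x. exp (t * f x) \<partial>gaussfield) \<le> exp (t * (\<integral>x. f x \<partial>gaussfield) + t\<^sup>2 * pi\<^sup>2 * L\<^sup>2 / 8)"
proof -
  let ?E = "\<integral>x. f x \<partial>gaussfield"
  have "(\<integral>x. exp (t * f x) \<partial>gaussfield) * exp (- t * ?E)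
      \<le> (\<integral>x. exp (t * f x) \<partial>gaussfield) * (\<integral>x. exp (- t * f x) \<partial>gaussfield)"
    by (intro mult_left_mono exp_expectation_le integral_nonneg_AE) auto
  also have "\<dots> \<le> exp (t\<^sup>2 * pi\<^sup>2 * L\<^sup>2 / 8)"
    using exp_expectation_product[of t] exp_expectation_product[of "- t"]
    by (cases "0 \<le> t") (auto simp: mult.commute)
  finally have "(\<integral>x. exp (t * f x) \<partial>gaussfield) * exp (- t * ?E) * exp (t * ?E)
      \<le> exp (t\<^sup>2 * pi\<^sup>2 * L\<^sup>2 / 8) * exp (t * ?E)"
    by (intro mult_right_mono) auto
  then show ?thesis
    by (simp add: mult.assoc exp_add[symmetric] add.commute)
qed

lemma sets_f_ge: "{x. r \<le> t * f x} \<in> gaussfield.events"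
proof -
  have "{x \<in> space gaussfield. r \<le> t * f x} \<in> gaussfield.events" by measurable
  then show ?thesis by simp
qed

lemma exponential_tail:
  "measure gaussfield {x. r \<le> t * f x} \<le> exp (t * (\<integral>x. f x \<partial>gaussfield) + t\<^sup>2 * pi\<^sup>2 * L\<^sup>2 / 8 - r)"
proof -
  have "measure gaussfield {x. r \<le> t * f x} = measure gaussfield {x \<in> space gaussfield. exp r \<le> exp (t * f x)}"
    by simp
  also have "\<dots> \<le> (\<integral>x. exp (t * f x) \<partial>gaussfield) / exp r"
    by (rule integral_Markov_inequality_measure[OF integrable_exp_f, of "{}"]) auto
  also have "\<dots> \<le> exp (t * (\<integral>x. f x \<partial>gaussfield) + t\<^sup>2 * pi\<^sup>2 * L\<^sup>2 / 8) / exp r"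
    by (intro divide_right_mono exp_expectation_bound) auto
  finally show ?thesis by (simp add: exp_diff)
qed

lemma pi_squared_less: "pi\<^sup>2 < 10"
proof -
  have "pi < 3.15" using pi_approx by simp
  then have "pi\<^sup>2 < 3.15\<^sup>2" by (intro power_strict_mono) auto
  then show ?thesis by (simp add: power2_eq_square)
qed

text \<open>\<open>t\<close> minimises the quadratic exponent for a deviation of
  \<open>4 * sqrt l * L\<close>. The minimum is \<open>- (32 * l / pi\<^sup>2)\<close>, and
  \<open>pi\<^sup>2 < 10\<close> leaves the rate 3.\<close>

lemma tail_exponent_le:
  assumes "0 < L" "0 \<le> l" "t = 16 * sqrt l / (L * pi\<^sup>2)"
  shows "t\<^sup>2 * pi\<^sup>2 * L\<^sup>2 / 8 - t * (4 * sqrt l * L) \<le> - (3 * l)"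
proof -
  have "t\<^sup>2 * pi\<^sup>2 * L\<^sup>2 / 8 - t * (4 * sqrt l * L) = - (32 * l / pi\<^sup>2)"
  proof -
    have "t\<^sup>2 * pi\<^sup>2 * L\<^sup>2 / 8 = 32 * (sqrt l)\<^sup>2 / pi\<^sup>2"
      unfolding assms(3) power_divide power_mult_distrib
      using assms(1) by (simp add: field_simps power2_eq_square)
    moreover have "t * (4 * sqrt l * L) = 64 * (sqrt l)\<^sup>2 / pi\<^sup>2"
      unfolding assms(3) using assms(1) by (simp add: power2_eq_square)
    ultimately show ?thesis using assms(2) by simp
  qed
  moreover have "3 * l \<le> 32 * l / pi\<^sup>2"
  proof -
    have "3 * l * pi\<^sup>2 \<le> 3 * l * 10"
      using assms pi_squared_less by (intro mult_left_mono) auto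
    then show ?thesis using assms by (simp add: pos_le_divide_eq)
  qed
  ultimately show ?thesis by simp
qed

lemma lower_tail:
  assumes "0 < L" "0 \<le> l"
  shows "measure gaussfield {x. f x \<le> (\<integral>x. f x \<partial>gaussfield) - 4 * sqrt l * L} \<le> exp (- (3 * l))"
proof -
  let ?E = "\<integral>x. f x \<partial>gaussfield"
  define t where "t = 16 * sqrt l / (L * pi\<^sup>2)"
  have t: "0 \<le> t" using assms by (simp add: t_def)
  have "{x. f x \<le> ?E - 4 * sqrt l * L} \<subseteq> {x. - t * (?E - 4 * sqrt l * L) \<le> - t * f x}"
    using t by (auto intro: mult_left_mono)
  then have "measure gaussfield {x. f x \<le> ?E - 4 * sqrt l * L} \<le>
      measure gaussfield {x. - t * (?E - 4 * sqrt l * L) \<le> - t * f x}"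
    by (rule gaussfield.finite_measure_mono[OF _ sets_f_ge])
  also have "\<dots> \<le> exp (- t * ?E + (- t)\<^sup>2 * pi\<^sup>2 * L\<^sup>2 / 8 - (- t * (?E - 4 * sqrt l * L)))"
    by (rule exponential_tail)
  also have "\<dots> \<le> exp (- (3 * l))"
    using tail_exponent_le[OF assms t_def] by (simp add: algebra_simps)
  finally show ?thesis .
qed

lemma upper_tail:
  assumes "0 < L" "0 \<le> l"
  shows "measure gaussfield {x. (\<integral>x. f x \<partial>gaussfield) + 4 * sqrt l * L \<le> f x} \<le> exp (- (3 * l))"
proof -
  let ?E = "\<integral>x. f x \<partial>gaussfield"
  define t where "t = 16 * sqrt l / (L * pi\<^sup>2)"
  have t: "0 \<le> t" using assms by (simp add: t_def)
  have "{x. ?E + 4 * sqrt l * L \<le> f x} \<subseteq> {x. t * (?E + 4 * sqrt l * L) \<le> t * f x}"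
    using t by (auto intro: mult_left_mono)
  then have "measure gaussfield {x. ?E + 4 * sqrt l * L \<le> f x} \<le>
      measure gaussfield {x. t * (?E + 4 * sqrt l * L) \<le> t * f x}"
    by (rule gaussfield.finite_measure_mono[OF _ sets_f_ge])
  also have "\<dots> \<le> exp (t * ?E + t\<^sup>2 * pi\<^sup>2 * L\<^sup>2 / 8 - t * (?E + 4 * sqrt l * L))"
    by (rule exponential_tail)
  also have "\<dots> \<le> exp (- (3 * l))"
    using tail_exponent_le[OF assms t_def] by (simp add: algebra_simps)
  finally show ?thesis .
qed

end

section \<open>Positive semidefinite matrices\<close>

lemma ip_commute: "ip d x y = ip d y x"
  by (simp add: ip_def mult.commute)

lemma ip_diff_left: "ip d (\<lambda>i. x i - y i) z = ip d x z - ip d y z"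
  by (simp add: ip_def left_diff_distrib sum_subtractf)

lemma ip_scale_left: "ip d (\<lambda>i. c * x i) z = c * ip d x z"
  by (simp add: ip_def sum_distrib_left mult.assoc)

lemma ip_add_right: "ip d z (\<lambda>i. x i + y i) = ip d z x + ip d z y"
  by (simp add: ip_def distrib_left sum.distrib)

lemma ip_diff_right: "ip d z (\<lambda>i. x i - y i) = ip d z x - ip d z y"
  by (simp add: ip_def right_diff_distrib sum_subtractf)

lemma ip_scale_right: "ip d z (\<lambda>i. c * x i) = c * ip d z x"
  by (simp add: ip_def sum_distrib_left mult.left_commute)

lemma ip_sum_left: "ip d (\<lambda>i. \<Sum>k\<in>K. c k * v k i) z = (\<Sum>k\<in>K. c k * ip d (v k) z)"
  unfolding ip_def sum_distrib_right sum_distrib_left by (subst sum.swap) (simp add: mult.assoc)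

lemma ip_sum_right: "ip d z (\<lambda>i. \<Sum>k\<in>K. c k * v k i) = (\<Sum>k\<in>K. c k * ip d z (v k))"
  using ip_sum_left[of d c v K z] by (simp add: ip_commute)

lemma ip_zero_right [simp]: "ip d z (\<lambda>i. 0) = 0"
  by (simp add: ip_def)

lemma ip_nonneg [simp]: "0 \<le> ip d x x"
  by (simp add: ip_def sum_nonneg)

lemma ip_self_eq_0:
  assumes "x \<in> vsp d"
  shows "ip d x x = 0 \<longleftrightarrow> x = (\<lambda>_. 0)"
proof
  assume "ip d x x = 0"
  then have "\<forall>i\<in>{..<d}. x i * x i = 0"
    unfolding ip_def by (subst (asm) sum_nonneg_eq_0_iff) auto
  then have "x i = 0" for i
    using assms by (cases "i < d") (auto simp: vsp_def)
  then show "x = (\<lambda>_. 0)" by auto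
qed (simp add: ip_def)

lemma vsp_add: "x \<in> vsp d \<Longrightarrow> y \<in> vsp d \<Longrightarrow> (\<lambda>i. x i + y i) \<in> vsp d"
  and vsp_diff: "x \<in> vsp d \<Longrightarrow> y \<in> vsp d \<Longrightarrow> (\<lambda>i. x i - y i) \<in> vsp d"
  and vsp_scale: "x \<in> vsp d \<Longrightarrow> (\<lambda>i. c * x i) \<in> vsp d"
  and vsp_zero: "(\<lambda>_. 0) \<in> vsp d"
  by (auto simp: vsp_def)

lemma vsp_sum: "(\<And>k. k \<in> K \<Longrightarrow> v k \<in> vsp d) \<Longrightarrow> (\<lambda>i. \<Sum>k\<in>K. c k * v k i) \<in> vsp d"
  by (auto simp: vsp_def intro!: sum.neutral)

lemma matvec_vsp [simp]: "matvec d k A x \<in> vsp d"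
  by (simp add: matvec_def vsp_def)

lemma matvec_add: "matvec m d A (\<lambda>i. x i + y i) = (\<lambda>i. matvec m d A x i + matvec m d A y i)"
  by (auto simp: matvec_def fun_eq_iff distrib_left sum.distrib)

lemma matvec_diff: "matvec m d A (\<lambda>i. x i - y i) = (\<lambda>i. matvec m d A x i - matvec m d A y i)"
  by (auto simp: matvec_def fun_eq_iff right_diff_distrib sum_subtractf)

lemma matvec_scale: "matvec m d A (\<lambda>i. c * x i) = (\<lambda>i. c * matvec m d A x i)"
  by (auto simp: matvec_def fun_eq_iff sum_distrib_left mult.left_commute)

lemma matvec_sum: "matvec m d A (\<lambda>i. \<Sum>k\<in>K. c k * v k i) = (\<lambda>i. \<Sum>k\<in>K. c k * matvec m d A (v k) i)"
proof -
  have "(\<Sum>j<d. A i j * (\<Sum>k\<in>K. c k * v k j)) = (\<Sum>k\<in>K. c k * (\<Sum>j<d. A i j * v k j))" for i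
    unfolding sum_distrib_left by (subst sum.swap) (simp add: mult.left_commute)
  then show ?thesis by (auto simp: matvec_def fun_eq_iff)
qed

lemma matvec_zero [simp]: "matvec m d A (\<lambda>_. 0) = (\<lambda>_. 0)"
  by (auto simp: matvec_def)

lemma matvec_mmul: "matvec d d (mmul d A B) x = matvec d d A (matvec d d B x)"
proof
  fix i
  show "matvec d d (mmul d A B) x i = matvec d d A (matvec d d B x) i"
    by (auto simp: matvec_def mmul_def sum_distrib_left sum_distrib_right mult.assoc intro: sum.swap)
qed

lemma psd_sym:
  assumes "psd d A"
  shows "ip d x (matvec d d A y) = ip d (matvec d d A x) y"
proof -
  have "ip d x (matvec d d A y) = (\<Sum>i<d. \<Sum>j<d. A i j * x i * y j)"
    by (simp add: ip_def matvec_def sum_distrib_left mult_ac)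
  also have "\<dots> = (\<Sum>i<d. \<Sum>j<d. A j i * x i * y j)"
    using assms by (intro sum.cong refl) (auto simp: psd_def)
  also have "\<dots> = ip d (matvec d d A x) y"
    by (subst sum.swap) (simp add: ip_def matvec_def sum_distrib_right)
  finally show ?thesis .
qed

lemma psd_nonneg: "psd d A \<Longrightarrow> x \<in> vsp d \<Longrightarrow> 0 \<le> ip d x (matvec d d A x)"
  by (simp add: psd_def)

lemma sq_mat_eqI:
  assumes A: "sq_mat d A" and B: "sq_mat d B" and eq: "\<And>x. x \<in> vsp d \<Longrightarrow> matvec d d A x = matvec d d B x"
  shows "A = B"
proof (intro ext)
  fix i j
  show "A i j = B i j"
  proof (cases "i < d \<and> j < d")
    case True
    let ?e = "\<lambda>k. if k = j then 1 else 0 :: real"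
    have "matvec d d A ?e i = matvec d d B ?e i"
      by (subst eq) (use True in \<open>auto simp: vsp_def\<close>)
    moreover have "(\<Sum>k<d. M i k * ?e k) = M i j" for M :: matr
      using True sum.delta[of "{..<d}" j "M i"] by (simp add: mult_delta_right)
    ultimately show ?thesis
      using True by (simp add: matvec_def)
  next
    case False
    then show ?thesis using A B by (auto simp: sq_mat_def not_less)
  qed
qed

lemma psd_form_zero:
  assumes A: "psd d A" and x: "x \<in> vsp d" and 0: "ip d x (matvec d d A x) = 0"
  shows "matvec d d A x = (\<lambda>_. 0)"
proof -
  let ?y = "matvec d d A x"
  define a b where "a = ip d ?y ?y" and "b = ip d ?y (matvec d d A ?y)"
  have b: "0 \<le> b" unfolding b_def by (rule psd_nonneg[OF A]) simp
  have a: "0 \<le> a" by (simp add: a_def)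
  \<comment> \<open>Moving from \<open>x\<close> by \<open>- t * ?y\<close> gives the form the value
    \<open>t\<^sup>2 * b - 2 * t * a\<close>, which this \<open>t\<close> turns into
    \<open>- t\<^sup>2 * (b + 2)\<close>. The summand 1 covers \<open>b = 0\<close>.\<close>
  define t where "t = a / (b + 1)"
  have "0 \<le> ip d (\<lambda>i. x i - t * ?y i) (matvec d d A (\<lambda>i. x i - t * ?y i))"
    by (rule psd_nonneg[OF A vsp_diff[OF x vsp_scale]]) simp
  also have "\<dots> = t * t * b - 2 * t * a"
    unfolding matvec_diff matvec_scale ip_diff_left ip_diff_right ip_scale_left ip_scale_right 0 psd_sym[OF A, of x ?y]
    by (simp add: a_def b_def algebra_simps)
  finally have "0 \<le> t * t * b - 2 * t * a" .
  moreover have at: "a = t * (b + 1)" using b by (simp add: t_def)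
  ultimately have "t * t * (b + 2) \<le> 0" by (simp add: algebra_simps)
  then have "t = 0" using b by (auto simp: mult_le_0_iff)
  then have "a = 0" using at by simp
  then show ?thesis
    using ip_self_eq_0[OF matvec_vsp, of d d A x] by (simp add: a_def)
qed

section \<open>Compactness and continuity in the product topology\<close>

lemma compact_box: "compact {x :: vect. \<forall>i. x i \<in> (if i < d then {- M..M} else {0})}"
proof -
  have "compactin (product_topology (\<lambda>i. euclidean) UNIV) (Pi\<^sub>E UNIV (\<lambda>i::nat. if i < d then {- M..M} else {0 :: real}))"
    by (subst compactin_PiE) auto
  moreover have "Pi\<^sub>E UNIV (\<lambda>i::nat. if i < d then {- M..M} else {0 :: real}) =
      {x. \<forall>i. x i \<in> (if i < d then {- M..M} else {0})}"
    by (simp add: PiE_UNIV_domain Pi_def)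
  ultimately show ?thesis
    by (simp add: euclidean_product_topology)
qed

lemma continuous_on_coordinate: "continuous_on S (\<lambda>x. x i :: real)"
  by (rule continuous_on_subset[OF continuous_on_product_coordinates]) simp

text \<open>Vectors are functions on all of \<open>nat\<close>, but only the first \<open>d\<close>
  coordinates are free, so a closed set with bounded coordinates sits in a product of compact
  intervals and singletons.\<close>

lemma compact_bounded_closed:
  assumes cl: "closed S" and S: "S \<subseteq> vsp d" and M: "\<And>x i. x \<in> S \<Longrightarrow> \<bar>x i\<bar> \<le> M"
  shows "compact S"
proof -
  have "x i \<in> (if i < d then {- M..M} else {0})" if "x \<in> S" for x i
    using M[OF that, of i] S that by (auto simp: vsp_def abs_le_iff subset_iff)
  then have sub: "S \<subseteq> {x. \<forall>i. x i \<in> (if i < d then {- M..M} else {0})}"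
    by blast
  have "compact (S \<inter> {x. \<forall>i. x i \<in> (if i < d then {- M..M} else {0})})"
    by (rule closed_Int_compact[OF cl compact_box])
  then show ?thesis by (simp only: Int_absorb2[OF sub])
qed

lemma closed_vsp: "closed (vsp d)"
proof -
  have "vsp d = (\<Inter>i\<in>{d..}. {x. x i = 0})" by (auto simp: vsp_def)
  moreover have "closed {x :: vect. x i = 0}" for i
    by (intro closed_Collect_eq continuous_on_coordinate continuous_on_const)
  ultimately show ?thesis by auto
qed

lemma continuous_on_ip [continuous_intros]:
  assumes f: "continuous_on S f" and g: "continuous_on S g"
  shows "continuous_on S (\<lambda>x. ip d (f x) (g x))"
  unfolding ip_def
  using continuous_on_product_then_coordinatewise[OF f] continuous_on_product_then_coordinatewise[OF g]
  by (intro continuous_on_sum continuous_on_mult)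

lemma continuous_on_matvec [continuous_intros]:
  assumes f: "continuous_on S f"
  shows "continuous_on S (\<lambda>x. matvec m d A (f x))"
proof (rule continuous_on_coordinatewise_then_product)
  fix i
  show "continuous_on S (\<lambda>x. matvec m d A (f x) i)"
  proof (cases "i < m")
    case True
    then have "(\<lambda>x. matvec m d A (f x) i) = (\<lambda>x. \<Sum>j<d. A i j * f x j)"
      by (simp add: matvec_def)
    then show ?thesis
      using continuous_on_product_then_coordinatewise[OF f]
      by (simp only:) (intro continuous_on_sum continuous_on_mult continuous_on_const)
  next
    case False
    then have "(\<lambda>x. matvec m d A (f x) i) = (\<lambda>x. 0)"
      by (simp add: matvec_def)
    then show ?thesis by (simp only: continuous_on_const)
  qed
qed

lemma sphere_compact: "compact {x \<in> vsp d. ip d x x = 1}"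
proof (rule compact_bounded_closed)
  show "closed {x \<in> vsp d. ip d x x = 1}"
    unfolding Collect_conj_eq Collect_mem_eq
    by (intro closed_Int closed_vsp closed_Collect_eq continuous_intros continuous_on_id)
next
  fix x i assume x: "x \<in> {x \<in> vsp d. ip d x x = 1}"
  show "\<bar>x i\<bar> \<le> 1"
  proof (cases "i < d")
    case True
    then have "(x i)\<^sup>2 \<le> ip d x x"
      unfolding ip_def by (subst power2_eq_square, intro member_le_sum) auto
    then show ?thesis using x by (simp add: abs_square_le_1)
  qed (use x in \<open>auto simp: vsp_def\<close>)
qed auto

section \<open>Spectral theorem by repeated removal of a top eigenvector\<close>

lemma matvec_minus_rank_one:
  assumes "v \<in> vsp d"
  shows "matvec d d (\<lambda>i j. A i j - \<mu> * v i * v j) x = (\<lambda>i. matvec d d A x i - \<mu> * ip d v x * v i)"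
proof -
  have "(\<Sum>j<d. (A i j - \<mu> * v i * v j) * x j) = (\<Sum>j<d. A i j * x j) - \<mu> * (\<Sum>j<d. v j * x j) * v i" for i
    by (simp add: algebra_simps sum_subtractf sum_distrib_left)
  then show ?thesis using assms by (auto simp: matvec_def fun_eq_iff ip_def vsp_def)
qed

text \<open>A maximiser \<open>v\<close> of the form on the sphere makes \<open>?B\<close>, which is
  \<open>\<mu>\<close> times the identity minus \<open>A\<close>, semidefinite with vanishing form
  at \<open>v\<close>; hence \<open>v\<close> lies in its kernel. The deflated matrix stays
  semidefinite because its form at \<open>x\<close> is the form of \<open>A\<close> at
  \<open>x\<close> with the component along \<open>v\<close> removed.\<close>

lemma top_eigenvector:
  assumes A: "psd d A" and nz: "A \<noteq> (\<lambda>i j. 0)"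
  obtains v \<mu> where "v \<in> vsp d" "ip d v v = 1" "0 < \<mu>" "matvec d d A v = (\<lambda>i. \<mu> * v i)"
    "psd d (\<lambda>i j. A i j - \<mu> * v i * v j)"
proof -
  let ?U = "{x \<in> vsp d. ip d x x = 1}" and ?q = "\<lambda>x. ip d x (matvec d d A x)"
  have sqA: "sq_mat d A" using A by (simp add: psd_def)
  have "\<exists>x\<in>vsp d. matvec d d A x \<noteq> (\<lambda>_. 0)"
  proof (rule ccontr)
    assume "\<not> ?thesis"
    then have "A = (\<lambda>i j. 0)"
      using sqA by (intro sq_mat_eqI[of d]) (auto simp: sq_mat_def matvec_def fun_eq_iff)
    with nz show False by simp
  qed
  then obtain x0 where x0: "x0 \<in> vsp d" "matvec d d A x0 \<noteq> (\<lambda>_. 0)" by auto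
  then have qx0: "0 < ?q x0"
    using psd_form_zero[OF A] psd_nonneg[OF A] by (metis order_le_less)
  have normalize: "(\<lambda>i. (1 / sqrt (ip d x x)) * x i) \<in> ?U" if "x \<in> vsp d" "x \<noteq> (\<lambda>_. 0)" for x
  proof -
    have "0 < ip d x x" using that ip_self_eq_0[of x d] by (metis ip_nonneg order_le_less)
    then show ?thesis using that by (simp only: vsp_scale ip_scale_left ip_scale_right mem_Collect_eq) (simp add: field_simps)
  qed
  have "x0 \<noteq> (\<lambda>_. 0)" using x0 by auto
  then have ne: "?U \<noteq> {}" using normalize x0 by blast
  have "\<exists>v\<in>?U. \<forall>x\<in>?U. ?q x \<le> ?q v"
    by (rule continuous_attains_sup[OF sphere_compact ne]) (intro continuous_intros continuous_on_id)
  then obtain v where v: "v \<in> ?U" and max: "\<And>x. x \<in> ?U \<Longrightarrow> ?q x \<le> ?q v"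
    by blast
  define \<mu> where "\<mu> = ?q v"
  have le: "?q x \<le> \<mu> * ip d x x" if x: "x \<in> vsp d" for x
  proof (cases "x = (\<lambda>_. 0)")
    case True
    then show ?thesis by (simp add: ip_def)
  next
    case False
    then have p: "0 < ip d x x" using x ip_self_eq_0[of x d] by (metis ip_nonneg order_le_less)
    have "?q (\<lambda>i. (1 / sqrt (ip d x x)) * x i) \<le> \<mu>"
      unfolding \<mu>_def by (rule max[OF normalize[OF x False]])
    then show ?thesis
      using p unfolding matvec_scale ip_scale_left ip_scale_right by (simp add: field_simps)
  qed
  have vv: "v \<in> vsp d" "ip d v v = 1" using v by auto
  have \<mu>: "0 < \<mu>"
    using le[OF x0(1)] qx0 ip_nonneg[of d x0] by (smt (verit) mult_nonpos_nonneg)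
  let ?B = "\<lambda>i j. if i < d \<and> j < d then (if i = j then \<mu> else 0) - A i j else 0"
  have Bx: "matvec d d ?B x = (\<lambda>i. \<mu> * x i - matvec d d A x i)" if "x \<in> vsp d" for x
  proof
    fix i
    show "matvec d d ?B x i = \<mu> * x i - matvec d d A x i"
    proof (cases "i < d")
      case True
      have "(\<Sum>j<d. ?B i j * x j) = (\<Sum>j<d. (if j = i then \<mu> * x i else 0) - A i j * x j)"
        using True by (intro sum.cong) (auto simp: algebra_simps)
      also have "\<dots> = \<mu> * x i - (\<Sum>j<d. A i j * x j)"
        using True by (simp add: sum_subtractf)
      finally show ?thesis using True by (simp add: matvec_def)
    qed (use that in \<open>auto simp: matvec_def vsp_def\<close>)
  qed
  have B: "psd d ?B"
    using A le unfolding psd_def by (auto simp: sq_mat_def Bx ip_diff_right ip_scale_right)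
  have "ip d v (matvec d d ?B v) = 0"
    unfolding Bx[OF vv(1)] ip_diff_right ip_scale_right vv(2) by (simp add: \<mu>_def)
  from psd_form_zero[OF B vv(1) this] have Av: "matvec d d A v = (\<lambda>i. \<mu> * v i)"
    unfolding Bx[OF vv(1)] by (auto simp: fun_eq_iff)
  have "psd d (\<lambda>i j. A i j - \<mu> * v i * v j)"
    unfolding psd_def
  proof (intro conjI ballI)
    show "sq_mat d (\<lambda>i j. A i j - \<mu> * v i * v j)"
      using sqA vv by (auto simp: sq_mat_def vsp_def)
    show "\<forall>i<d. \<forall>j<d. A i j - \<mu> * v i * v j = A j i - \<mu> * v j * v i"
      using A by (simp add: psd_def)
    fix x assume x: "x \<in> vsp d"
    let ?z = "\<lambda>i. x i - ip d v x * v i"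
    have "0 \<le> ?q ?z" by (rule psd_nonneg[OF A vsp_diff[OF x vsp_scale[OF vv(1)]]])
    also have "?q ?z = ?q x - \<mu> * (ip d v x)\<^sup>2"
      unfolding matvec_diff matvec_scale Av ip_diff_left ip_diff_right ip_scale_left ip_scale_right vv(2)
        psd_sym[OF A, of v x] by (simp add: Av ip_scale_left ip_commute[of d x v] power2_eq_square algebra_simps)
    also have "\<dots> = ip d x (matvec d d (\<lambda>i j. A i j - \<mu> * v i * v j) x)"
      unfolding matvec_minus_rank_one[OF vv(1)] ip_diff_right ip_scale_right
      by (simp add: ip_commute[of d x v] power2_eq_square mult.assoc)
    finally show "0 \<le> ip d x (matvec d d (\<lambda>i j. A i j - \<mu> * v i * v j) x)" .
  qed
  then show thesis by (rule that[OF vv \<mu> Av])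
qed

definition orthonormal :: "nat \<Rightarrow> nat \<Rightarrow> (nat \<Rightarrow> vect) \<Rightarrow> bool" where
  "orthonormal d m v \<longleftrightarrow> (\<forall>k<m. v k \<in> vsp d) \<and> (\<forall>k<m. \<forall>l<m. ip d (v k) (v l) = (if k = l then 1 else 0))"

lemma orthonormal_ip:
  assumes "orthonormal d m v" "l < m"
  shows "ip d (v l) (\<lambda>i. \<Sum>k<m. c k * v k i) = c l"
proof -
  have "ip d (v l) (\<lambda>i. \<Sum>k<m. c k * v k i) = (\<Sum>k<m. if k = l then c l else 0)"
    unfolding ip_sum_right using assms by (intro sum.cong) (auto simp: orthonormal_def)
  then show ?thesis using assms by simp
qed

text \<open>Bessel's inequality for each standard basis vector, summed over the \<open>d\<close>
  coordinates. This dimension count is what stops the deflation.\<close>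

lemma orthonormal_card:
  assumes v: "orthonormal d m v"
  shows "m \<le> d"
proof -
  have bessel: "(\<Sum>k<m. (v k j)\<^sup>2) \<le> 1" if j: "j < d" for j
  proof -
    let ?e = "\<lambda>i. if i = j then 1 else 0 :: real"
    let ?s = "\<lambda>i. \<Sum>k<m. v k j * v k i"
    have ie: "ip d x ?e = x j" for x
      using j by (simp add: ip_def mult_delta_right)
    have ss: "ip d ?s ?s = (\<Sum>k<m. (v k j)\<^sup>2)"
      unfolding ip_sum_left[where z="?s"]
      by (intro sum.cong refl) (simp add: orthonormal_ip[OF v] power2_eq_square)
    have "0 \<le> ip d (\<lambda>i. ?e i - ?s i) (\<lambda>i. ?e i - ?s i)" by (rule ip_nonneg)
    also have "\<dots> = ip d ?e ?e - 2 * ip d ?s ?e + ip d ?s ?s"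
      unfolding ip_diff_left ip_diff_right by (simp add: ip_commute[of d ?e ?s])
    also have "\<dots> = 1 - (\<Sum>k<m. (v k j)\<^sup>2)"
      unfolding ss ie by (simp add: power2_eq_square)
    finally show ?thesis by simp
  qed
  have "real m = (\<Sum>k<m. ip d (v k) (v k))"
    using v by (simp add: orthonormal_def)
  also have "\<dots> = (\<Sum>j<d. \<Sum>k<m. (v k j)\<^sup>2)"
    unfolding ip_def by (subst sum.swap) (simp add: power2_eq_square)
  also have "\<dots> \<le> (\<Sum>j<d. 1)"
    by (intro sum_mono bessel) simp
  finally show ?thesis by simp
qed

text \<open>If no residual vanished, the construction could be continued to \<open>d + 1\<close>
  orthonormal vectors. The residual annihilates the earlier vectors, so by symmetry an eigenvector
  of it with positive eigenvalue is orthogonal to them.\<close>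

theorem spectral_decomposition:
  assumes A: "psd d A"
  obtains m v \<mu> where "orthonormal d m v" "\<And>k. k < m \<Longrightarrow> 0 < \<mu> k"
    "A = (\<lambda>i j. \<Sum>k<m. \<mu> k * v k i * v k j)"
proof -
  let ?res = "\<lambda>m v \<mu>. (\<lambda>i j. A i j - (\<Sum>k<m. \<mu> k * v k i * v k j))"
  let ?P = "\<lambda>m v \<mu>. orthonormal d m v \<and> (\<forall>k<m. 0 < \<mu> k) \<and> psd d (?res m v \<mu>) \<and>
      (\<forall>k<m. matvec d d (?res m v \<mu>) (v k) = (\<lambda>_. 0))"
  have "\<exists>m v \<mu>. orthonormal d m v \<and> (\<forall>k<m. 0 < \<mu> k) \<and> A = (\<lambda>i j. \<Sum>k<m. \<mu> k * v k i * v k j)"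
  proof (rule ccontr)
    assume no: "\<not> ?thesis"
    have "\<exists>v \<mu>. ?P m v \<mu>" for m
    proof (induction m)
      case 0
      show ?case using A by (simp add: orthonormal_def)
    next
      case (Suc m)
      then obtain v \<mu> where P: "?P m v \<mu>" by blast
      let ?R = "?res m v \<mu>"
      have "?R \<noteq> (\<lambda>i j. 0)"
      proof
        assume "?R = (\<lambda>i j. 0)"
        then have "A = (\<lambda>i j. \<Sum>k<m. \<mu> k * v k i * v k j)" by (simp add: fun_eq_iff)
        with no P show False by blast
      qed
      then have Rne: "?R \<noteq> (\<lambda>i j. 0)" .
      note Pv = P[THEN conjunct1] and P\<mu> = P[THEN conjunct2, THEN conjunct1]
        and psdR = P[THEN conjunct2, THEN conjunct2, THEN conjunct1]
        and Pk = P[THEN conjunct2, THEN conjunct2, THEN conjunct2]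
      obtain w \<nu> where w: "w \<in> vsp d" "ip d w w = 1" "0 < \<nu>" "matvec d d ?R w = (\<lambda>i. \<nu> * w i)"
        "psd d (\<lambda>i j. ?R i j - \<nu> * w i * w j)"
        by (rule top_eigenvector[OF psdR Rne], rule that)
      have ort: "ip d (v k) w = 0" if "k < m" for k
      proof -
        have "\<nu> * ip d (v k) w = ip d (v k) (matvec d d ?R w)"
          unfolding w(4) ip_scale_right ..
        also have "\<dots> = ip d (matvec d d ?R (v k)) w"
          by (rule psd_sym[OF psdR])
        also have "\<dots> = 0" using Pk that by (simp add: ip_def)
        finally show ?thesis using w(3) by simp
      qed
      let ?v = "v(m := w)" and ?\<mu> = "\<mu>(m := \<nu>)"
      have R': "?res (Suc m) ?v ?\<mu> = (\<lambda>i j. ?R i j - \<nu> * w i * w j)"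
        by (simp add: fun_eq_iff)
      have ov: "orthonormal d (Suc m) ?v"
        unfolding orthonormal_def
      proof (intro conjI allI impI)
        fix k l assume kl: "k < Suc m" "l < Suc m"
        show "?v k \<in> vsp d" using kl Pv w(1) by (auto simp: orthonormal_def less_Suc_eq)
        show "ip d (?v k) (?v l) = (if k = l then 1 else 0)"
        proof (cases "k = m"; cases "l = m")
          assume "k = m" "l \<noteq> m"
          then show ?thesis using ort[of l] kl ip_commute[of d w "v l"] by (simp add: less_Suc_eq)
        next
          assume "k \<noteq> m" "l \<noteq> m"
          then show ?thesis using Pv kl by (simp add: orthonormal_def less_Suc_eq)
        qed (use ort[of k] kl w(2) in \<open>simp_all add: less_Suc_eq\<close>)
      qed
      have kill: "matvec d d (\<lambda>i j. ?R i j - \<nu> * w i * w j) (?v k) = (\<lambda>_. 0)" if k: "k < Suc m" for k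
      proof (cases "k = m")
        case True
        then show ?thesis unfolding matvec_minus_rank_one[OF w(1)] using w(2,4) by simp
      next
        case False
        then have "k < m" using k by simp
        then show ?thesis
          unfolding matvec_minus_rank_one[OF w(1)] using Pk ort[of k] ip_commute[of d w "v k"] by simp
      qed
      have "?P (Suc m) ?v ?\<mu>"
        unfolding R'
      proof (intro conjI allI impI)
        show "orthonormal d (Suc m) ?v" by (rule ov)
        show "psd d (\<lambda>i j. ?R i j - \<nu> * w i * w j)" by (rule w(5))
        fix k assume k: "k < Suc m"
        show "0 < ?\<mu> k" using k P\<mu> w(3) by (auto simp: less_Suc_eq)
        show "matvec d d (\<lambda>i j. ?R i j - \<nu> * w i * w j) (?v k) = (\<lambda>_. 0)"
          by (rule kill[OF k])
      qed
      then show ?case by (rule exI[where x="?v", OF exI[where x="?\<mu>"]])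
    qed
    from this[of "Suc d"] obtain v \<mu> where P: "?P (Suc d) v \<mu>" by blast
    show False using orthonormal_card[OF P[THEN conjunct1]] by simp
  qed
  then obtain m v \<mu> where 1: "orthonormal d m v" and 2: "\<forall>k<m. 0 < \<mu> k"
    and 3: "A = (\<lambda>i j. \<Sum>k<m. \<mu> k * v k i * v k j)"
    by blast
  have "0 < \<mu> k" if "k < m" for k using 2 that by blast
  from that[OF 1 this 3] show thesis .
qed

lemma matvec_spectral:
  assumes "\<forall>k<m. v k \<in> vsp d"
  shows "matvec d d (\<lambda>i j. \<Sum>k<m. \<mu> k * v k i * v k j) x = (\<lambda>i. \<Sum>k<m. (\<mu> k * ip d (v k) x) * v k i)"
proof
  fix i
  show "matvec d d (\<lambda>i j. \<Sum>k<m. \<mu> k * v k i * v k j) x i = (\<Sum>k<m. (\<mu> k * ip d (v k) x) * v k i)"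
  proof (cases "i < d")
    case True
    have "(\<Sum>j<d. (\<Sum>k<m. \<mu> k * v k i * v k j) * x j) = (\<Sum>k<m. \<Sum>j<d. \<mu> k * v k i * v k j * x j)"
      unfolding sum_distrib_right by (rule sum.swap)
    then show ?thesis using True by (simp add: matvec_def ip_def sum_distrib_left sum_distrib_right mult_ac)
  next
    case False
    then show ?thesis using assms by (auto simp: matvec_def vsp_def intro!: sum.neutral[symmetric])
  qed
qed

lemma psd_spectral:
  assumes v: "\<forall>k<m. v k \<in> vsp d" and \<mu>: "\<And>k. k < m \<Longrightarrow> 0 \<le> \<mu> k"
  shows "psd d (\<lambda>i j. \<Sum>k<m. \<mu> k * v k i * v k j)"
  unfolding psd_def
proof (intro conjI ballI)
  show "sq_mat d (\<lambda>i j. \<Sum>k<m. \<mu> k * v k i * v k j)"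
    using v by (auto simp: sq_mat_def vsp_def intro!: sum.neutral)
  show "\<forall>i<d. \<forall>j<d. (\<Sum>k<m. \<mu> k * v k i * v k j) = (\<Sum>k<m. \<mu> k * v k j * v k i)"
    by (simp add: mult_ac)
  fix x
  show "0 \<le> ip d x (matvec d d (\<lambda>i j. \<Sum>k<m. \<mu> k * v k i * v k j) x)"
    unfolding matvec_spectral[OF v] ip_sum_right
    using \<mu> by (intro sum_nonneg) (simp add: ip_commute[of d x] mult.assoc)
qed

lemma psd_square_root_exists:
  assumes "psd d A"
  shows "\<exists>R. psd d R \<and> mmul d R R = A"
proof -
  obtain m v \<mu> where ov: "orthonormal d m v" and \<mu>: "\<And>k. k < m \<Longrightarrow> 0 < \<mu> k"
    and A: "A = (\<lambda>i j. \<Sum>k<m. \<mu> k * v k i * v k j)"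
    by (rule spectral_decomposition[OF assms], rule that)
  have v: "\<forall>k<m. v k \<in> vsp d" using ov by (simp add: orthonormal_def)
  let ?R = "\<lambda>i j. \<Sum>k<m. sqrt (\<mu> k) * v k i * v k j"
  have "psd d ?R" by (rule psd_spectral) (use v \<mu> less_imp_le in auto)
  moreover have "mmul d ?R ?R = A"
  proof (rule sq_mat_eqI[of d])
    show "sq_mat d (mmul d ?R ?R)" by (simp add: sq_mat_def mmul_def)
    show "sq_mat d A" using assms by (simp add: psd_def)
    fix x
    show "matvec d d (mmul d ?R ?R) x = matvec d d A x"
      unfolding matvec_mmul A matvec_spectral[OF v]
    proof (intro ext sum.cong refl)
      fix i k assume "k \<in> {..<m}"
      then show "sqrt (\<mu> k) * ip d (v k) (\<lambda>i. \<Sum>k<m. sqrt (\<mu> k) * ip d (v k) x * v k i) * v k i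
          = \<mu> k * ip d (v k) x * v k i"
        using \<mu>[of k] by (simp add: orthonormal_ip[OF ov])
    qed
  qed
  ultimately show ?thesis by blast
qed

text \<open>Needed because \<open>msqrt\<close> is a definite description. On an eigenvector
  \<open>v k\<close> of \<open>S\<close> the defect \<open>?y\<close> satisfies
  \<open>R ?y = - \<nu> k ?y\<close>, which forces it to vanish for semidefinite \<open>R\<close>.
  On the orthogonal complement \<open>S\<close> is 0, and so is \<open>R\<close>, because
  \<open>\<langle>R x, R x\<rangle> = \<langle>x, S (S x)\<rangle>\<close>.\<close>

lemma psd_square_root_unique:
  assumes S: "psd d S" and R: "psd d R" and eq: "mmul d S S = mmul d R R"
  shows "S = R"
proof -
  obtain m v \<nu> where ov: "orthonormal d m v" and \<nu>: "\<And>k. k < m \<Longrightarrow> 0 < \<nu> k"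
    and S_eq: "S = (\<lambda>i j. \<Sum>k<m. \<nu> k * v k i * v k j)"
    by (rule spectral_decomposition[OF S], rule that)
  have v: "\<forall>k<m. v k \<in> vsp d" using ov by (simp add: orthonormal_def)
  have Sx: "matvec d d S x = (\<lambda>i. \<Sum>k<m. (\<nu> k * ip d (v k) x) * v k i)" for x
    unfolding S_eq by (rule matvec_spectral[OF v])
  have SR: "matvec d d S (matvec d d S x) = matvec d d R (matvec d d R x)" for x
    by (simp only: matvec_mmul[symmetric] eq)
  have Sv: "matvec d d S (v k) = (\<lambda>i. \<nu> k * v k i)" if "k < m" for k
  proof -
    have "(\<Sum>l<m. \<nu> l * ip d (v l) (v k) * v l i) = (\<Sum>l<m. if l = k then \<nu> k * v k i else 0)" for i
      using ov that by (intro sum.cong) (auto simp: orthonormal_def)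
    then show ?thesis unfolding Sx using that by simp
  qed
  have Rv: "matvec d d R (v k) = (\<lambda>i. \<nu> k * v k i)" if k: "k < m" for k
  proof -
    let ?y = "\<lambda>i. matvec d d R (v k) i - \<nu> k * v k i"
    have y: "?y \<in> vsp d" using v k by (intro vsp_diff vsp_scale matvec_vsp) auto
    have "matvec d d R ?y = (\<lambda>i. - \<nu> k * ?y i)"
      unfolding matvec_diff matvec_scale SR[symmetric] Sv[OF k] by (simp add: fun_eq_iff algebra_simps)
    then have "0 \<le> ip d ?y (\<lambda>i. - \<nu> k * ?y i)"
      using psd_nonneg[OF R y] by simp
    then have "0 \<le> - \<nu> k * ip d ?y ?y" by (simp only: ip_scale_right)
    then have "ip d ?y ?y = 0"
      using \<nu>[OF k] ip_nonneg[of d ?y] by (simp add: zero_le_mult_iff mult_le_0_iff)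
    then show ?thesis using ip_self_eq_0[OF y] by (auto simp: fun_eq_iff)
  qed
  show ?thesis
  proof (rule sq_mat_eqI[of d])
    fix x assume x: "x \<in> vsp d"
    let ?p = "\<lambda>i. \<Sum>k<m. ip d (v k) x * v k i"
    let ?x' = "\<lambda>i. x i - ?p i"
    have x': "?x' \<in> vsp d" using v by (intro vsp_diff x vsp_sum) auto
    have "ip d (v k) ?x' = 0" if "k < m" for k
      unfolding ip_diff_right orthonormal_ip[OF ov that] by simp
    then have Sx': "matvec d d S ?x' = (\<lambda>_. 0)"
      unfolding Sx[of ?x'] by (simp add: fun_eq_iff)
    have "ip d (matvec d d R ?x') (matvec d d R ?x') = ip d ?x' (matvec d d R (matvec d d R ?x'))"
      by (rule psd_sym[OF R, symmetric])
    also have "\<dots> = 0" unfolding SR[symmetric] Sx' by simp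
    finally have Rx': "matvec d d R ?x' = (\<lambda>_. 0)"
      using ip_self_eq_0[OF matvec_vsp] by blast
    have "matvec d d R ?p = matvec d d S ?p"
      unfolding matvec_sum using Rv Sv by (auto intro!: sum.cong)
    then show "matvec d d S x = matvec d d R x"
      using Sx' Rx' unfolding matvec_diff by (simp add: fun_eq_iff)
  next
    show "sq_mat d S" using S unfolding psd_def by (rule conjunct1)
    show "sq_mat d R" using R unfolding psd_def by (rule conjunct1)
  qed
qed

section \<open>Square roots of a matrix and of an orthogonal sum\<close>

lemma msqrt_eqI:
  assumes R: "psd d R" "mmul d R R = A"
  shows "msqrt d A = R"
  unfolding msqrt_def
proof (rule the_equality)
  show "psd d R \<and> mmul d R R = A" using R by simp
  fix S assume S: "psd d S \<and> mmul d S S = A"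
  show "S = R"
  proof (rule psd_square_root_unique)
    show "psd d S" by (rule conjunct1[OF S])
    show "psd d R" by (rule R)
    show "mmul d S S = mmul d R R" unfolding R(2) by (rule conjunct2[OF S])
  qed
qed

lemma msqrt:
  assumes "psd d A"
  shows psd_msqrt: "psd d (msqrt d A)" and mmul_msqrt: "mmul d (msqrt d A) (msqrt d A) = A"
proof -
  obtain R where R: "psd d R" "mmul d R R = A"
    using psd_square_root_exists[OF assms] by blast
  show "psd d (msqrt d A)"
    unfolding msqrt_eqI[OF R] by (rule R(1))
  show "mmul d (msqrt d A) (msqrt d A) = A"
    unfolding msqrt_eqI[OF R] by (rule R(2))
qed

lemma msqrt_ip:
  assumes "psd d A"
  shows "ip d (matvec d d (msqrt d A) x) (matvec d d (msqrt d A) y) = ip d x (matvec d d A y)"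
  unfolding psd_sym[OF psd_msqrt[OF assms], symmetric] matvec_mmul[symmetric] mmul_msqrt[OF assms] ..

lemma anorm_eq: "psd d A \<Longrightarrow> anorm d A x = sqrt (ip d (matvec d d (msqrt d A) x) (matvec d d (msqrt d A) x))"
  by (simp add: anorm_def msqrt_ip)

lemma msqrt_kernel:
  assumes "psd d A" "matvec d d A x = (\<lambda>_. 0)"
  shows "matvec d d (msqrt d A) x = (\<lambda>_. 0)"
proof -
  have "ip d (matvec d d (msqrt d A) x) (matvec d d (msqrt d A) x) = 0"
    unfolding msqrt_ip[OF assms(1)] assms(2) by (rule ip_zero_right)
  then show ?thesis unfolding ip_self_eq_0[OF matvec_vsp] .
qed

text \<open>The roots of \<open>S1\<close> and \<open>S2\<close> annihilate each other, so their sum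
  squares to \<open>S\<close> and is its root; on the column space of \<open>S2\<close> the root of
  \<open>S1\<close> vanishes. This is why the design with covariance \<open>S\<close> acts on the
  trial points like one with covariance \<open>S2\<close>.\<close>

lemma msqrt_cov_split:
  assumes split: "cov_split d S S1 S2" and w: "w \<in> colsp d S2"
  shows "matvec d d (msqrt d S) w = matvec d d (msqrt d S2) w"
proof -
  let ?R1 = "msqrt d S1" and ?R2 = "msqrt d S2"
  have S: "S = (\<lambda>i j. S1 i j + S2 i j)" and 1: "psd d S1" and 2: "psd d S2"
    and orth: "\<And>x y. x \<in> vsp d \<Longrightarrow> y \<in> vsp d \<Longrightarrow> ip d (matvec d d S1 x) (matvec d d S2 y) = 0"
    using split by (auto simp: cov_split_def colsp_def)
  have S12: "matvec d d S1 (matvec d d S2 y) = (\<lambda>_. 0)" if "y \<in> vsp d" for y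
  proof -
    let ?z = "matvec d d S1 (matvec d d S2 y)"
    have "ip d ?z ?z = ip d (matvec d d S1 ?z) (matvec d d S2 y)"
      by (rule psd_sym[OF 1])
    then show ?thesis
      using orth[of ?z y] that ip_self_eq_0[OF matvec_vsp] by simp
  qed
  have R1S2: "matvec d d ?R1 (matvec d d S2 y) = (\<lambda>_. 0)" if "y \<in> vsp d" for y
    by (rule msqrt_kernel[OF 1 S12[OF that]])
  have ipR: "ip d (matvec d d ?R1 x) (matvec d d ?R2 y) = 0" if x: "x \<in> vsp d" and y: "y \<in> vsp d" for x y
  proof -
    let ?z = "matvec d d ?R2 (matvec d d ?R1 x)"
    have "ip d ?z ?z = ip d (matvec d d ?R1 x) (matvec d d S2 (matvec d d ?R1 x))"
      by (rule msqrt_ip[OF 2])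
    also have "\<dots> = ip d x (matvec d d ?R1 (matvec d d S2 (matvec d d ?R1 x)))"
      by (rule psd_sym[OF psd_msqrt[OF 1], symmetric])
    also have "\<dots> = 0" by (simp add: R1S2)
    finally have "?z = (\<lambda>_. 0)" using ip_self_eq_0[OF matvec_vsp] by blast
    then show ?thesis
      unfolding psd_sym[OF psd_msqrt[OF 2]] by (simp add: ip_def)
  qed
  let ?R = "\<lambda>i j. ?R1 i j + ?R2 i j"
  have Rx: "matvec d d ?R x = (\<lambda>i. matvec d d ?R1 x i + matvec d d ?R2 x i)" for x
    by (auto simp: matvec_def fun_eq_iff distrib_right sum.distrib)
  have Sx: "matvec d d S x = (\<lambda>i. matvec d d S1 x i + matvec d d S2 x i)" for x
    unfolding S by (auto simp: matvec_def fun_eq_iff distrib_right sum.distrib)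
  have psdR: "psd d ?R"
    unfolding psd_def
  proof (intro conjI ballI)
    show "sq_mat d ?R"
      using psd_msqrt[OF 1] psd_msqrt[OF 2] by (simp add: psd_def sq_mat_def)
    show "\<forall>i<d. \<forall>j<d. ?R i j = ?R j i"
      using psd_msqrt[OF 1] psd_msqrt[OF 2] by (simp add: psd_def)
    fix x assume "x \<in> vsp d"
    then show "0 \<le> ip d x (matvec d d ?R x)"
      unfolding Rx ip_add_right using psd_msqrt[OF 1] psd_msqrt[OF 2] by (intro add_nonneg_nonneg psd_nonneg)
  qed
  have R12: "matvec d d ?R1 (matvec d d ?R2 x) = (\<lambda>_. 0)" if "x \<in> vsp d" for x
  proof -
    let ?z = "matvec d d ?R1 (matvec d d ?R2 x)"
    have "ip d ?z ?z = ip d (matvec d d ?R1 ?z) (matvec d d ?R2 x)"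
      by (rule psd_sym[OF psd_msqrt[OF 1]])
    then show ?thesis using ipR[of ?z x] that ip_self_eq_0[OF matvec_vsp] by simp
  qed
  have R21: "matvec d d ?R2 (matvec d d ?R1 x) = (\<lambda>_. 0)" if "x \<in> vsp d" for x
  proof -
    let ?z = "matvec d d ?R2 (matvec d d ?R1 x)"
    have "ip d ?z ?z = ip d (matvec d d ?R1 x) (matvec d d ?R2 ?z)"
      by (subst psd_sym[OF psd_msqrt[OF 2]]) (rule ip_commute)
    then show ?thesis using ipR[of x ?z] that ip_self_eq_0[OF matvec_vsp] by simp
  qed
  have "mmul d ?R ?R = S"
  proof (rule sq_mat_eqI[of d])
    show "sq_mat d (mmul d ?R ?R)" by (simp add: sq_mat_def mmul_def)
    show "sq_mat d S" using 1 2 by (simp add: S psd_def sq_mat_def)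
    fix x assume x: "x \<in> vsp d"
    have "matvec d d ?R1 (matvec d d ?R1 x) = matvec d d S1 x" "matvec d d ?R2 (matvec d d ?R2 x) = matvec d d S2 x"
      by (simp_all only: matvec_mmul[symmetric] mmul_msqrt[OF 1] mmul_msqrt[OF 2])
    then show "matvec d d (mmul d ?R ?R) x = matvec d d S x"
      unfolding matvec_mmul Rx Sx matvec_add by (simp add: R12[OF x] R21[OF x])
  qed
  then have "msqrt d S = ?R" by (rule msqrt_eqI[OF psdR])
  moreover obtain y where "y \<in> vsp d" "w = matvec d d S2 y" using w by (auto simp: colsp_def)
  ultimately show ?thesis by (simp add: Rx R1S2)
qed

text \<open>The projection is written in eigenvectors, and dividing by the eigenvalues exhibits a
  preimage under \<open>A\<close>. The removed part lies in the kernel of the root, so projecting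
  \<open>x\<close> changes neither its \<open>A\<close>-norm nor its pairing with vectors in the
  range of the root, while \<open>N\<close> may change.\<close>

lemma proj_colsp:
  assumes A: "psd d A" and x: "x \<in> vsp d"
  shows proj_in_colsp: "proj d (colsp d A) x \<in> colsp d A"
    and msqrt_proj: "matvec d d (msqrt d A) (proj d (colsp d A) x) = matvec d d (msqrt d A) x"
proof -
  obtain m v \<mu> where ov: "orthonormal d m v" and \<mu>: "\<And>k. k < m \<Longrightarrow> 0 < \<mu> k"
    and A_eq: "A = (\<lambda>i j. \<Sum>k<m. \<mu> k * v k i * v k j)"
    by (rule spectral_decomposition[OF A], rule that)
  have v: "\<forall>k<m. v k \<in> vsp d" using ov by (simp add: orthonormal_def)
  have Az: "matvec d d A z = (\<lambda>i. \<Sum>k<m. (\<mu> k * ip d (v k) z) * v k i)" for z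
    unfolding A_eq by (rule matvec_spectral[OF v])
  let ?P = "\<lambda>y. y \<in> colsp d A \<and> (\<forall>z\<in>colsp d A. ip d (\<lambda>i. x i - y i) z = 0)"
  let ?y = "\<lambda>i. \<Sum>k<m. ip d (v k) x * v k i"
  have "?y = matvec d d A (\<lambda>i. \<Sum>k<m. (ip d (v k) x / \<mu> k) * v k i)"
    unfolding Az
  proof (intro ext sum.cong refl)
    fix i k assume "k \<in> {..<m}"
    then have k: "k < m" by simp
    show "ip d (v k) x * v k i = \<mu> k * ip d (v k) (\<lambda>i. \<Sum>k<m. (ip d (v k) x / \<mu> k) * v k i) * v k i"
      unfolding orthonormal_ip[OF ov k] using \<mu>[OF k] by simp
  qed
  then have "?y \<in> colsp d A"
    unfolding colsp_def by (rule image_eqI[where f="matvec d d A"]) (rule vsp_sum, use v in auto)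
  moreover have "ip d (\<lambda>i. x i - ?y i) (matvec d d A z) = 0" for z
    unfolding Az ip_sum_right
  proof (rule sum.neutral, rule ballI)
    fix k assume "k \<in> {..<m}"
    then have "ip d (v k) (\<lambda>i. x i - ?y i) = 0"
      unfolding ip_diff_right by (simp add: orthonormal_ip[OF ov])
    then show "\<mu> k * ip d (v k) z * ip d (\<lambda>i. x i - ?y i) (v k) = 0"
      by (simp add: ip_commute[of d _ "v k"])
  qed
  ultimately have Py: "?P ?y" by (auto simp: colsp_def)
  have uniq: "y = y'" if y: "?P y" and y': "?P y'" for y y'
  proof -
    obtain a b where ab: "a \<in> vsp d" "b \<in> vsp d" "y = matvec d d A a" "y' = matvec d d A b"
      using y y' by (auto simp: colsp_def)
    let ?z = "\<lambda>i. y i - y' i"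
    have "?z = matvec d d A (\<lambda>i. a i - b i)" by (simp add: ab matvec_diff)
    then have z: "?z \<in> colsp d A" "?z \<in> vsp d" using ab vsp_diff by (auto simp: colsp_def)
    have "ip d ?z ?z = ip d (\<lambda>i. x i - y' i) ?z - ip d (\<lambda>i. x i - y i) ?z"
      by (simp add: ip_diff_left)
    also have "\<dots> = 0" using y y' z by simp
    finally show ?thesis using ip_self_eq_0[OF z(2)] by (auto simp: fun_eq_iff)
  qed
  have proj: "?P (proj d (colsp d A) x)"
    unfolding proj_def by (rule theI[of ?P, OF Py]) (use uniq Py in blast)
  then show "proj d (colsp d A) x \<in> colsp d A" by blast
  let ?r = "\<lambda>i. x i - proj d (colsp d A) x i"
  have "ip d (matvec d d A ?r) (matvec d d A ?r) = ip d ?r (matvec d d A (matvec d d A ?r))"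
    by (rule psd_sym[OF A, symmetric])
  also have "\<dots> = 0" using proj by (auto simp: colsp_def)
  finally have "matvec d d A ?r = (\<lambda>_. 0)" using ip_self_eq_0[OF matvec_vsp] by blast
  from msqrt_kernel[OF A this]
  show "matvec d d (msqrt d A) (proj d (colsp d A) x) = matvec d d (msqrt d A) x"
    unfolding matvec_diff by (simp add: fun_eq_iff)
qed

section \<open>Functions with gradient in the Lorentz cone\<close>

text \<open>The last index \<open>d\<close> is the time coordinate. The vectors
  \<open>(R p, |R p|)\<close> lie on the boundary of this cone.\<close>

definition lorentz :: "nat \<Rightarrow> vect \<Rightarrow> bool" where
  "lorentz d p \<longleftrightarrow> 0 \<le> p d \<and> (\<Sum>j<d. (p j)\<^sup>2) \<le> (p d)\<^sup>2"

lemma sum_mult_le_cone: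
  fixes x y :: "nat \<Rightarrow> real"
  assumes "0 \<le> a" "(\<Sum>j<d. (x j)\<^sup>2) \<le> a\<^sup>2" "0 \<le> b" "(\<Sum>j<d. (y j)\<^sup>2) \<le> b\<^sup>2"
  shows "(\<Sum>j<d. x j * y j) \<le> a * b"
proof -
  have "(\<Sum>j<d. x j * y j)\<^sup>2 \<le> (\<Sum>j<d. (x j)\<^sup>2) * (\<Sum>j<d. (y j)\<^sup>2)"
    by (rule Cauchy_Schwarz_ineq_sum)
  also have "\<dots> \<le> a\<^sup>2 * b\<^sup>2"
    using assms by (intro mult_mono) (auto intro: sum_nonneg)
  also have "\<dots> = (a * b)\<^sup>2" by (rule power_mult_distrib[symmetric])
  finally have "\<bar>\<Sum>j<d. x j * y j\<bar> \<le> \<bar>a * b\<bar>" by (simp only: abs_le_square_iff)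
  then show ?thesis using assms by simp
qed

lemma lorentz_ip_le: "lorentz d p \<Longrightarrow> lorentz d q \<Longrightarrow> (\<Sum>j<d. p j * q j) \<le> p d * q d"
  unfolding lorentz_def by (intro sum_mult_le_cone) auto

lemma lorentz_combination:
  assumes p: "lorentz d p" and q: "lorentz d q" and a: "0 \<le> a" and b: "0 \<le> b"
  shows "lorentz d (\<lambda>j. a * p j + b * q j)"
proof -
  have "(\<Sum>j<d. (a * p j + b * q j)\<^sup>2)
      = a\<^sup>2 * (\<Sum>j<d. (p j)\<^sup>2) + 2 * a * b * (\<Sum>j<d. p j * q j) + b\<^sup>2 * (\<Sum>j<d. (q j)\<^sup>2)"
    by (simp add: power2_sum power_mult_distrib sum.distrib sum_distrib_left mult_ac)
  also have "\<dots> \<le> a\<^sup>2 * (p d)\<^sup>2 + 2 * a * b * (p d * q d) + b\<^sup>2 * (q d)\<^sup>2"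
    using p q a b lorentz_ip_le[OF p q]
    by (intro add_mono mult_left_mono) (auto simp: lorentz_def)
  also have "\<dots> = (a * p d + b * q d)\<^sup>2"
    by (simp add: power2_sum power_mult_distrib mult_ac)
  finally show ?thesis
    using p q a b by (simp add: lorentz_def)
qed

lemma lorentz_abs_le:
  assumes "lorentz d p" "j \<le> d"
  shows "\<bar>p j\<bar> \<le> p d"
proof (cases "j = d")
  case False
  have "(p j)\<^sup>2 \<le> (\<Sum>j<d. (p j)\<^sup>2)"
    using assms False by (intro member_le_sum) auto
  then have "(p j)\<^sup>2 \<le> (p d)\<^sup>2" using assms by (simp add: lorentz_def)
  then show ?thesis using assms by (simp add: lorentz_def abs_le_square_iff[symmetric])
qed (use assms in \<open>simp add: lorentz_def\<close>)

abbreviation l1 :: "nat \<Rightarrow> vect \<Rightarrow> real" where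
  "l1 d y \<equiv> \<Sum>j\<le>d. \<bar>y j\<bar>"

lemma lorentz_linear_le:
  assumes "lorentz d p"
  shows "\<bar>\<Sum>j\<le>d. p j * y j\<bar> \<le> p d * l1 d y"
proof -
  have "\<bar>\<Sum>j\<le>d. p j * y j\<bar> \<le> (\<Sum>j\<le>d. \<bar>p j * y j\<bar>)" by (rule sum_abs)
  also have "\<dots> \<le> (\<Sum>j\<le>d. p d * \<bar>y j\<bar>)"
    using lorentz_abs_le[OF assms] by (intro sum_mono) (simp add: abs_mult mult_right_mono)
  finally show ?thesis by (simp only: sum_distrib_left)
qed

text \<open>Here \<open>\<sigma> * p x\<close> plays the role of the gradient of \<open>f\<close> at \<open>x\<close>. That gradients stay in the
  Lorentz cone is what gives the second order terms of the comparison below a sign.\<close>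

definition taylor :: "nat \<Rightarrow> real \<Rightarrow> (vect \<Rightarrow> real) \<Rightarrow> real \<Rightarrow> (vect \<Rightarrow> vect) \<Rightarrow> bool" where
  "taylor d \<sigma> f C p \<longleftrightarrow> (\<forall>x. 0 \<le> f x \<and> f x \<le> 1 \<and> lorentz d (p x) \<and> p x d \<le> C \<and>
     (\<forall>y. \<bar>f (\<lambda>j. x j + y j) - f x - \<sigma> * (\<Sum>j\<le>d. p x j * y j)\<bar> \<le> C * (l1 d y)\<^sup>2))"

definition cone_smooth :: "nat \<Rightarrow> real \<Rightarrow> (vect \<Rightarrow> real) \<Rightarrow> bool" where
  "cone_smooth d \<sigma> f \<longleftrightarrow> f \<in> borel_measurable gaussfield \<and> (\<exists>C\<ge>1. \<exists>p. taylor d \<sigma> f C p)"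

text \<open>For \<open>l1 d y \<le> 1\<close> the quadratic remainder is below a linear one; for
  larger \<open>y\<close> the range \<open>[0, 1]\<close> of \<open>f\<close> already bounds the
  increment.\<close>

lemma taylor_lipschitz:
  assumes T: "taylor d \<sigma> f C p" and C: "1 \<le> C" and \<sigma>: "\<bar>\<sigma>\<bar> = 1"
  shows "\<bar>f (\<lambda>j. x j + y j) - f x\<bar> \<le> 2 * C * l1 d y"
proof (cases "l1 d y \<le> 1")
  case True
  have l: "0 \<le> l1 d y" by (simp add: sum_nonneg)
  have "\<bar>\<sigma> * (\<Sum>j\<le>d. p x j * y j)\<bar> \<le> p x d * l1 d y"
    using T lorentz_linear_le[of d "p x" y] by (simp add: taylor_def abs_mult \<sigma>)
  also have "\<dots> \<le> C * l1 d y"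
    using T l by (intro mult_right_mono) (auto simp: taylor_def)
  finally have 1: "\<bar>\<sigma> * (\<Sum>j\<le>d. p x j * y j)\<bar> \<le> C * l1 d y" .
  have "C * (l1 d y)\<^sup>2 \<le> C * l1 d y"
    using True l C by (intro mult_left_mono) (auto simp: power2_eq_square mult_left_le)
  moreover have "\<bar>f (\<lambda>j. x j + y j) - f x - \<sigma> * (\<Sum>j\<le>d. p x j * y j)\<bar> \<le> C * (l1 d y)\<^sup>2"
    using T by (simp add: taylor_def)
  ultimately show ?thesis using 1 by linarith
next
  case False
  have "0 \<le> f x" "f x \<le> 1" "0 \<le> f (\<lambda>j. x j + y j)" "f (\<lambda>j. x j + y j) \<le> 1"
    using T by (auto simp: taylor_def)
  then have "\<bar>f (\<lambda>j. x j + y j) - f x\<bar> \<le> 1" by linarith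
  also have "1 \<le> C * l1 d y"
    using mult_mono[of 1 C 1 "l1 d y"] False C by simp
  finally show ?thesis using False C by simp
qed

text \<open>Both factors are nonnegative, so the product rule combines the two gradients with
  nonnegative weights and stays in the cone. In the constant \<open>?E\<close>, the part
  \<open>4 * C * D\<close> pays for the product of the two increments.\<close>

lemma cone_smooth_mult:
  assumes f: "cone_smooth d \<sigma> f" and g: "cone_smooth d \<sigma> g" and \<sigma>: "\<bar>\<sigma>\<bar> = 1"
  shows "cone_smooth d \<sigma> (\<lambda>x. f x * g x)"
proof -
  obtain C p where C: "1 \<le> C" and T: "taylor d \<sigma> f C p" using f by (auto simp: cone_smooth_def)
  obtain D q where D: "1 \<le> D" and U: "taylor d \<sigma> g D q" using g by (auto simp: cone_smooth_def)
  let ?r = "\<lambda>x j. f x * q x j + g x * p x j" and ?E = "C + D + 4 * C * D"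
  have "0 \<le> 4 * C * D" using C D by simp
  then have E: "C + D \<le> ?E" "1 \<le> ?E" using C D by linarith+
  have "taylor d \<sigma> (\<lambda>x. f x * g x) ?E ?r"
    unfolding taylor_def
  proof (intro allI conjI)
    fix x
    have fx: "0 \<le> f x" "f x \<le> 1" "0 \<le> g x" "g x \<le> 1" and pq: "lorentz d (p x)" "lorentz d (q x)" "p x d \<le> C" "q x d \<le> D"
      using T U by (simp_all add: taylor_def)
    show "0 \<le> f x * g x" using fx by simp
    show "f x * g x \<le> 1" using fx by (simp add: mult_le_one)
    show "lorentz d (?r x)" using pq fx by (intro lorentz_combination)
    have pd: "0 \<le> p x d" "0 \<le> q x d" using pq by (simp_all add: lorentz_def)
    have "f x * q x d \<le> 1 * D" by (rule mult_mono) (use fx pq pd in simp_all)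
    moreover have "g x * p x d \<le> 1 * C" by (rule mult_mono) (use fx pq pd in simp_all)
    ultimately show "?r x d \<le> ?E" using E by simp
    fix y
    let ?x' = "\<lambda>j. x j + y j" and ?l = "l1 d y"
    define a b where "a = f ?x' - f x - \<sigma> * (\<Sum>j\<le>d. p x j * y j)"
      and "b = g ?x' - g x - \<sigma> * (\<Sum>j\<le>d. q x j * y j)"
    have l: "0 \<le> ?l" by (simp add: sum_nonneg)
    have a: "\<bar>a\<bar> \<le> C * ?l\<^sup>2" using T by (simp add: taylor_def a_def)
    have b: "\<bar>b\<bar> \<le> D * ?l\<^sup>2" using U by (simp add: taylor_def b_def)
    have "\<bar>(f ?x' - f x) * (g ?x' - g x)\<bar> \<le> (2 * C * ?l) * (2 * D * ?l)"
      unfolding abs_mult using C l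
      by (intro mult_mono taylor_lipschitz[OF T C \<sigma>] taylor_lipschitz[OF U D \<sigma>]) auto
    moreover have "\<bar>f x * b\<bar> \<le> 1 * (D * ?l\<^sup>2)"
      unfolding abs_mult using fx b by (intro mult_mono) auto
    moreover have "\<bar>g x * a\<bar> \<le> 1 * (C * ?l\<^sup>2)"
      unfolding abs_mult using fx a by (intro mult_mono) auto
    moreover have "f ?x' * g ?x' - f x * g x - \<sigma> * (\<Sum>j\<le>d. ?r x j * y j)
        = (f ?x' - f x) * (g ?x' - g x) + f x * b + g x * a"
    proof -
      have "(\<Sum>j\<le>d. ?r x j * y j) = f x * (\<Sum>j\<le>d. q x j * y j) + g x * (\<Sum>j\<le>d. p x j * y j)"
        by (simp add: distrib_right sum.distrib sum_distrib_left mult.assoc)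
      then show ?thesis unfolding a_def b_def by (simp add: algebra_simps)
    qed
    ultimately have "\<bar>f ?x' * g ?x' - f x * g x - \<sigma> * (\<Sum>j\<le>d. ?r x j * y j)\<bar>
        \<le> (2 * C * ?l) * (2 * D * ?l) + 1 * (D * ?l\<^sup>2) + 1 * (C * ?l\<^sup>2)"
      by linarith
    also have "\<dots> = ?E * ?l\<^sup>2" by (simp add: power2_eq_square algebra_simps)
    finally show "\<bar>f ?x' * g ?x' - f x * g x - \<sigma> * (\<Sum>j\<le>d. ?r x j * y j)\<bar> \<le> ?E * ?l\<^sup>2" .
  qed
  moreover have "(\<lambda>x. f x * g x) \<in> borel_measurable gaussfield"
    using f g by (intro borel_measurable_times) (simp_all add: cone_smooth_def)
  ultimately show ?thesis unfolding cone_smooth_def using E by blast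
qed

lemma cone_smooth_one: "cone_smooth d \<sigma> (\<lambda>x. 1)"
proof -
  have "taylor d \<sigma> (\<lambda>x. 1) 1 (\<lambda>x j. 0)"
    by (simp add: taylor_def lorentz_def)
  then show ?thesis unfolding cone_smooth_def by (metis borel_measurable_const order_refl)
qed

lemma cone_smooth_prod:
  assumes "\<And>v. v < N \<Longrightarrow> cone_smooth d \<sigma> (f v)" and \<sigma>: "\<bar>\<sigma>\<bar> = 1"
  shows "cone_smooth d \<sigma> (\<lambda>x. \<Prod>v<(N::nat). f v x)"
  using assms(1)
proof (induction N)
  case 0
  show ?case using cone_smooth_one by simp
next
  case (Suc N)
  have "cone_smooth d \<sigma> (\<lambda>x. (\<Prod>v<N. f v x) * f N x)"
    by (rule cone_smooth_mult[OF Suc.IH _ \<sigma>]) (use Suc.prems in auto)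
  then show ?case by simp
qed

lemma cone_smooth_complement:
  assumes "cone_smooth d \<sigma> f"
  shows "cone_smooth d (- \<sigma>) (\<lambda>x. 1 - f x)"
proof -
  obtain C p where C: "1 \<le> C" and T: "taylor d \<sigma> f C p" using assms by (auto simp: cone_smooth_def)
  have "taylor d (- \<sigma>) (\<lambda>x. 1 - f x) C p"
    unfolding taylor_def
  proof (intro allI conjI)
    fix x y
    show "0 \<le> 1 - f x" "1 - f x \<le> 1" "lorentz d (p x)" "p x d \<le> C" using T by (simp_all add: taylor_def)
    have "\<bar>f (\<lambda>j. x j + y j) - f x - \<sigma> * (\<Sum>j\<le>d. p x j * y j)\<bar> \<le> C * (l1 d y)\<^sup>2"
      using T by (simp add: taylor_def)
    then show "\<bar>1 - f (\<lambda>j. x j + y j) - (1 - f x) - - \<sigma> * (\<Sum>j\<le>d. p x j * y j)\<bar> \<le> C * (l1 d y)\<^sup>2"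
      by (simp add: abs_if split: if_splits)
  qed
  then show ?thesis using C assms unfolding cone_smooth_def by auto
qed

text \<open>The arctangent gives a cut-off whose derivative is explicit, positive and globally
  Lipschitz, hence a second-order Taylor bound that is uniform in the point.\<close>

definition ramp :: "real \<Rightarrow> real" where
  "ramp z = 1 / 2 + arctan z / pi"

lemma ramp_bounds: "0 \<le> ramp z" "ramp z \<le> 1"
proof -
  have "- (1 / 2) \<le> arctan z / pi" "arctan z / pi \<le> 1 / 2"
    using arctan_bounded[of z] pi_gt_zero by (auto simp: field_simps)
  then show "0 \<le> ramp z" "ramp z \<le> 1" unfolding ramp_def by linarith+
qed

lemma inverse_quadratic_lipschitz: "\<bar>inverse (1 + a\<^sup>2) - inverse (1 + b\<^sup>2)\<bar> \<le> 2 * \<bar>a - (b::real)\<bar>"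
proof -
  have p: "0 < 1 + a\<^sup>2" "0 < 1 + b\<^sup>2" by (auto intro: add_pos_nonneg)
  have ab: "\<bar>a + b\<bar> \<le> 2 * ((1 + a\<^sup>2) * (1 + b\<^sup>2))"
  proof -
    have x: "\<bar>x\<bar> \<le> 1 + x\<^sup>2" for x :: real
      using sum_squares_ge_zero[of "\<bar>x\<bar> - 1" 0] by (simp add: power2_eq_square algebra_simps abs_if split: if_splits) 
    have "\<bar>a + b\<bar> \<le> (1 + a\<^sup>2) + (1 + b\<^sup>2)" using x[of a] x[of b] by linarith
    also have "\<dots> \<le> 2 * ((1 + a\<^sup>2) * (1 + b\<^sup>2))"
      by (simp add: algebra_simps)
    finally show ?thesis .
  qed
  have "inverse (1 + a\<^sup>2) - inverse (1 + b\<^sup>2) = (b - a) * (a + b) / ((1 + a\<^sup>2) * (1 + b\<^sup>2))"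
    using p by (simp add: field_simps power2_eq_square)
  then have "\<bar>inverse (1 + a\<^sup>2) - inverse (1 + b\<^sup>2)\<bar> = \<bar>a - b\<bar> * \<bar>a + b\<bar> / ((1 + a\<^sup>2) * (1 + b\<^sup>2))"
    using p by (simp add: abs_mult abs_minus_commute)
  also have "\<dots> \<le> \<bar>a - b\<bar> * (2 * ((1 + a\<^sup>2) * (1 + b\<^sup>2))) / ((1 + a\<^sup>2) * (1 + b\<^sup>2))"
    using p ab by (intro divide_right_mono mult_left_mono) auto
  also have "\<dots> = 2 * \<bar>a - b\<bar>"
  proof -
    have "x * (2 * q) / q = 2 * x" if "0 < q" for x q :: real using that by simp
    then show ?thesis using mult_pos_pos[OF p] by blast
  qed
  finally show ?thesis .
qed

lemma ramp_taylor: "\<bar>ramp (z + t) - ramp z - inverse (1 + z\<^sup>2) / pi * t\<bar> \<le> t\<^sup>2"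
proof -
  have "\<exists>\<xi>. \<bar>\<xi> - z\<bar> \<le> \<bar>t\<bar> \<and> arctan (z + t) - arctan z = inverse (1 + \<xi>\<^sup>2) * t"
  proof -
    consider "t = 0" | "0 < t" | "t < 0" by linarith
    then show ?thesis
    proof cases
      case 2
      obtain \<xi> where "z < \<xi>" "\<xi> < z + t" "arctan (z + t) - arctan z = (z + t - z) * inverse (1 + \<xi>\<^sup>2)"
        using MVT2[of z "z + t" arctan "\<lambda>x. inverse (1 + x\<^sup>2)"] DERIV_arctan 2 by auto
      then show ?thesis by (intro exI[of _ \<xi>]) auto
    next
      case 3
      obtain \<xi> where "z + t < \<xi>" "\<xi> < z" "arctan z - arctan (z + t) = (z - (z + t)) * inverse (1 + \<xi>\<^sup>2)"
        using MVT2[of "z + t" z arctan "\<lambda>x. inverse (1 + x\<^sup>2)"] DERIV_arctan 3 by auto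
      then show ?thesis by (intro exI[of _ \<xi>]) (auto simp: algebra_simps)
    qed auto
  qed
  then obtain \<xi> where \<xi>: "\<bar>\<xi> - z\<bar> \<le> \<bar>t\<bar>" "arctan (z + t) - arctan z = inverse (1 + \<xi>\<^sup>2) * t" by blast
  have "ramp (z + t) - ramp z - inverse (1 + z\<^sup>2) / pi * t
      = (arctan (z + t) - arctan z) / pi - inverse (1 + z\<^sup>2) / pi * t"
    by (simp add: ramp_def diff_divide_distrib)
  also have "\<dots> = (inverse (1 + \<xi>\<^sup>2) - inverse (1 + z\<^sup>2)) * t / pi"
    unfolding \<xi>(2) by (simp add: left_diff_distrib diff_divide_distrib)
  finally have "\<bar>ramp (z + t) - ramp z - inverse (1 + z\<^sup>2) / pi * t\<bar>
      = \<bar>inverse (1 + \<xi>\<^sup>2) - inverse (1 + z\<^sup>2)\<bar> * \<bar>t\<bar> / pi"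
    by (simp add: abs_mult)
  also have "\<dots> \<le> (2 * \<bar>\<xi> - z\<bar>) * \<bar>t\<bar> / pi"
    by (intro divide_right_mono mult_right_mono inverse_quadratic_lipschitz) auto
  also have "\<dots> \<le> (2 * \<bar>t\<bar>) * \<bar>t\<bar> / pi"
    using \<xi>(1) by (intro divide_right_mono mult_right_mono) auto
  also have "\<dots> = (2 / pi) * t\<^sup>2" by (simp add: power2_eq_square)
  also have "\<dots> \<le> 1 * t\<^sup>2"
    using pi_gt3 by (intro mult_right_mono) auto
  finally show ?thesis by simp
qed

lemma cone_smooth_ramp:
  assumes u: "lorentz d u" and a: "0 \<le> a"
  shows "cone_smooth d (- 1) (\<lambda>x. ramp (a * (c - (\<Sum>j\<le>d. u j * x j)) + e))"
proof -
  let ?z = "\<lambda>x. a * (c - (\<Sum>j\<le>d. u j * x j)) + e"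
  let ?w = "\<lambda>x. inverse (1 + (?z x)\<^sup>2) / pi * a"
  \<comment> \<open>The summand with weight 0 brings a multiple of \<open>u\<close> into the
    two-term form of \<open>lorentz_combination\<close>.\<close>
  let ?p = "\<lambda>x j. ?w x * u j + 0 * u j"
  let ?C = "1 + a * u d + (a * u d)\<^sup>2"
  have ud: "0 \<le> a * u d" using u a by (simp add: lorentz_def)
  have i1: "inverse (1 + z\<^sup>2) / pi \<le> 1" "0 \<le> inverse (1 + z\<^sup>2) / pi" for z :: real
  proof -
    have "inverse (1 + z\<^sup>2) \<le> 1" by (rule inverse_le_1_iff[THEN iffD2]) simp
    then have "inverse (1 + z\<^sup>2) / pi \<le> 1 / 1" using pi_gt3 by (intro frac_le) auto
    then show "inverse (1 + z\<^sup>2) / pi \<le> 1" by simp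
  qed simp
  have "taylor d (- 1) (\<lambda>x. ramp (?z x)) ?C ?p"
    unfolding taylor_def
  proof (intro allI conjI)
    fix x y :: vect
    show "0 \<le> ramp (?z x)" "ramp (?z x) \<le> 1" by (rule ramp_bounds)+
    show "lorentz d (?p x)"
      using a i1 by (intro lorentz_combination u mult_nonneg_nonneg) auto
    have "?p x d = inverse (1 + (?z x)\<^sup>2) / pi * (a * u d)" by simp
    also have "\<dots> \<le> 1 * (a * u d)" by (rule mult_right_mono[OF i1(1) ud])
    also have "\<dots> \<le> ?C" by simp
    finally show "?p x d \<le> ?C" .
    let ?t = "- (a * (\<Sum>j\<le>d. u j * y j))"
    have z: "?z (\<lambda>j. x j + y j) = ?z x + ?t"
      by (simp add: distrib_left sum.distrib algebra_simps)
    have "\<bar>?t\<bar> \<le> a * (u d * l1 d y)"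
      using lorentz_linear_le[OF u, of y] a by (simp add: abs_mult mult_left_mono)
    then have t: "\<bar>?t\<bar> \<le> \<bar>a * u d * l1 d y\<bar>" by (simp add: mult.assoc)
    have pt: "- 1 * (\<Sum>j\<le>d. ?p x j * y j) = inverse (1 + (?z x)\<^sup>2) / pi * ?t"
    proof -
      have "(\<Sum>j\<le>d. ?p x j * y j) = ?w x * (\<Sum>j\<le>d. u j * y j)"
        unfolding sum_distrib_left by (intro sum.cong) simp_all
      then show ?thesis by simp
    qed
    have "\<bar>ramp (?z (\<lambda>j. x j + y j)) - ramp (?z x) - - 1 * (\<Sum>j\<le>d. ?p x j * y j)\<bar> \<le> ?t\<^sup>2"
      unfolding z pt by (rule ramp_taylor)
    also have "\<dots> \<le> (a * u d * l1 d y)\<^sup>2"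
      using t by (simp only: abs_le_square_iff)
    also have "\<dots> = (a * u d)\<^sup>2 * (l1 d y)\<^sup>2" by (rule power_mult_distrib)
    also have "\<dots> \<le> ?C * (l1 d y)\<^sup>2" using ud by (intro mult_right_mono) auto
    finally show "\<bar>ramp (?z (\<lambda>j. x j + y j)) - ramp (?z x) - - 1 * (\<Sum>j\<le>d. ?p x j * y j)\<bar> \<le> ?C * (l1 d y)\<^sup>2" .
  qed
  moreover have "(\<lambda>x. ramp (?z x)) \<in> borel_measurable gaussfield"
    unfolding ramp_def by measurable
  moreover have "1 \<le> ?C" using ud by simp
  ultimately show ?thesis unfolding cone_smooth_def by blast
qed

section \<open>Second moments of the Gaussian field\<close>

lemma gaussfield_second_moments:
  shows "integrable gaussfield (\<lambda>\<omega>. \<omega> i * \<omega> k)"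
    and "(\<integral>\<omega>. \<omega> i * \<omega> k \<partial>gaussfield) = (if i = k then 1 else 0)"
proof -
  have 1: "integrable gauss1 (\<lambda>x. x)" "(\<integral>x. x \<partial>gauss1) = 0"
  proof -
    show "integrable gauss1 (\<lambda>x. x)"
      using integrable_std_normal_moment[of 1] by (subst integrable_density) auto
    have "(\<integral>x. x \<partial>gauss1) = (\<integral>x. std_normal_density x * x ^ (2 * 0 + 1) \<partial>lborel)"
      by (subst integral_density) auto
    also have "\<dots> = 0" by (rule integral_std_normal_moment_odd)
    finally show "(\<integral>x. x \<partial>gauss1) = 0" .
  qed
  have 2: "integrable gauss1 (\<lambda>x. x\<^sup>2)" "(\<integral>x. x\<^sup>2 \<partial>gauss1) = 1"
  proof -
    show "integrable gauss1 (\<lambda>x. x\<^sup>2)"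
      using integrable_std_normal_moment[of 2] by (subst integrable_density) auto
    have "(\<integral>x. x\<^sup>2 \<partial>gauss1) = (\<integral>x. std_normal_density x * x ^ (2 * 1) \<partial>lborel)"
      by (subst integral_density) auto
    also have "\<dots> = fact (2 * 1) / (2 ^ 1 * fact 1)" by (rule integral_std_normal_moment_even)
    finally show "(\<integral>x. x\<^sup>2 \<partial>gauss1) = 1" by simp
  qed
  note I = gaussfield_integrable_component[OF 1(1), unfolded 1(2)]
  note J = gaussfield_integrable_component[OF 2(1), unfolded 2(2)]
  have "integrable gaussfield (\<lambda>\<omega>. \<omega> i * \<omega> k) \<and> (\<integral>\<omega>. \<omega> i * \<omega> k \<partial>gaussfield) = (if i = k then 1 else 0)"
  proof (cases "i = k")
    case True
    then show ?thesis using J[of k] by (simp add: power2_eq_square)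
  next
    case False
    have fin: "finite {i, k}" by simp
    have ind: "gaussfield.indep_vars (\<lambda>_. borel) (\<lambda>i \<omega>. \<omega> i) {i, k}"
      by (rule gaussfield.indep_vars_subset[OF indep_vars_gaussfield]) simp
    have eq: "(\<lambda>\<omega>. \<omega> i * \<omega> k) = (\<lambda>\<omega>. \<Prod>j\<in>{i, k}. \<omega> j :: real)"
      using False by simp
    show ?thesis
      unfolding eq using gaussfield.indep_vars_integrable[OF fin ind I(1)]
        gaussfield.indep_vars_lebesgue_integral[OF fin ind I(1)] False by (simp add: I(2))
  qed
  then show "integrable gaussfield (\<lambda>\<omega>. \<omega> i * \<omega> k)"
    "(\<integral>\<omega>. \<omega> i * \<omega> k \<partial>gaussfield) = (if i = k then 1 else 0)" by auto
qed

lemma gaussfield_covariance: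
  assumes J: "finite J"
  shows "integrable gaussfield (\<lambda>\<omega>. (\<Sum>i\<in>J. u i * \<omega> i) * (\<Sum>i\<in>J. v i * \<omega> i))"
    and "(\<integral>\<omega>. (\<Sum>i\<in>J. u i * \<omega> i) * (\<Sum>i\<in>J. v i * \<omega> i) \<partial>gaussfield) = (\<Sum>i\<in>J. u i * v i)"
proof -
  have eq: "(\<Sum>i\<in>J. u i * \<omega> i) * (\<Sum>i\<in>J. v i * \<omega> i) = (\<Sum>i\<in>J. \<Sum>k\<in>J. (u i * v k) * (\<omega> i * \<omega> k))" for \<omega>
    by (simp add: sum_product mult_ac)
  show "integrable gaussfield (\<lambda>\<omega>. (\<Sum>i\<in>J. u i * \<omega> i) * (\<Sum>i\<in>J. v i * \<omega> i))"
    unfolding eq by (intro Bochner_Integration.integrable_sum integrable_mult_right gaussfield_second_moments)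
  have "(\<integral>\<omega>. (\<Sum>i\<in>J. u i * \<omega> i) * (\<Sum>i\<in>J. v i * \<omega> i) \<partial>gaussfield)
      = (\<Sum>i\<in>J. \<Sum>k\<in>J. (u i * v k) * (\<integral>\<omega>. \<omega> i * \<omega> k \<partial>gaussfield))"
    unfolding eq
    by (simp add: Bochner_Integration.integral_sum gaussfield_second_moments(1))
  also have "\<dots> = (\<Sum>i\<in>J. u i * v i)"
    unfolding gaussfield_second_moments(2) using J by (simp add: mult_delta_right)
  finally show "(\<integral>\<omega>. (\<Sum>i\<in>J. u i * \<omega> i) * (\<Sum>i\<in>J. v i * \<omega> i) \<partial>gaussfield) = (\<Sum>i\<in>J. u i * v i)" .
qed

section \<open>One step of the Gaussian comparison\<close>

text \<open>The coordinates of \<open>blk n c i W\<close> use disjoint columns of \<open>W\<close>, so with unit coefficient vectors they are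
  again independent standard Gaussian variables.\<close>

definition blk :: "nat \<Rightarrow> (nat \<Rightarrow> nat \<Rightarrow> nat \<Rightarrow> real) \<Rightarrow> nat \<Rightarrow> (nat \<times> nat \<Rightarrow> real) \<Rightarrow> vect" where
  "blk n c i W = (\<lambda>j. \<Sum>r<n. c i j r * W (r, j))"

lemma measurable_blk [measurable]: "(\<lambda>W. blk n c i W j) \<in> borel_measurable gaussfield"
  unfolding blk_def by measurable

lemma measurable_blk_field: "blk n c i \<in> measurable gaussfield gaussfield"
  by (rule measurable_into_gaussfield) (rule measurable_blk)

lemma distr_blk:
  assumes "\<And>j. (\<Sum>r<n. (c i j r)\<^sup>2) = 1"
  shows "distr gaussfield gaussfield (blk n c i) = gaussfield"
proof -
  let ?S = "\<lambda>j. (\<lambda>r. (r, j)) ` {..<n}"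
  have inj: "inj_on (\<lambda>r. (r, j)) {..<n}" for j :: nat by (auto simp: inj_on_def)
  have "disjoint_family ?S" by (auto simp: disjoint_family_on_def)
  moreover have "(\<Sum>z\<in>?S j. (c i j (fst z))\<^sup>2) = 1" for j
    using assms by (simp add: sum.reindex[OF inj])
  ultimately have "distr gaussfield gaussfield (\<lambda>\<omega> j. \<Sum>z\<in>?S j. c i j (fst z) * \<omega> z) = gaussfield"
    by (intro distr_gaussfield_blocks) auto
  also have "(\<lambda>\<omega> j. \<Sum>z\<in>?S j. c i j (fst z) * \<omega> z) = blk n c i"
    by (intro ext) (simp add: blk_def sum.reindex[OF inj])
  finally show ?thesis .
qed

lemma blk_combination:
  "blk n c i (\<lambda>z. p * fst w z + q * snd w z) j = p * blk n c i (fst w) j + q * blk n c i (snd w) j"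
  by (simp add: blk_def sum.distrib sum_distrib_left algebra_simps)

definition grid :: "nat \<Rightarrow> nat \<Rightarrow> (nat \<times> nat) set" where
  "grid n d = {..<n} \<times> {..d}"

lemma finite_grid [simp]: "finite (grid n d)"
  by (simp add: grid_def)

lemma blk_linear: "(\<Sum>j\<le>d. p j * blk n c i W j) = (\<Sum>z\<in>grid n d. (p (snd z) * c i (snd z) (fst z)) * W z)"
proof -
  have "(\<Sum>j\<le>d. p j * blk n c i W j) = (\<Sum>j\<le>d. \<Sum>r<n. p j * c i j r * W (r, j))"
    by (simp add: blk_def sum_distrib_left mult.assoc)
  also have "\<dots> = (\<Sum>r<n. \<Sum>j\<le>d. p j * c i j r * W (r, j))" by (rule sum.swap)
  also have "\<dots> = (\<Sum>z\<in>grid n d. (p (snd z) * c i (snd z) (fst z)) * W z)"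
    unfolding grid_def sum.cartesian_product by (intro sum.cong) auto
  finally show ?thesis .
qed

definition gridnorm :: "nat \<Rightarrow> nat \<Rightarrow> (nat \<times> nat \<Rightarrow> real) \<Rightarrow> real" where
  "gridnorm n d W = (\<Sum>z\<in>grid n d. \<bar>W z\<bar>)"

lemma gridnorm_nonneg: "0 \<le> gridnorm n d W"
  by (simp add: gridnorm_def sum_nonneg)

lemma l1_blk_le:
  assumes unit: "\<And>j. (\<Sum>r<n. (c i j r)\<^sup>2) = 1"
  shows "l1 d (blk n c i W) \<le> gridnorm n d W"
proof -
  have c: "\<bar>c i j r\<bar> \<le> 1" if "r < n" for j r
  proof -
    have "(c i j r)\<^sup>2 \<le> (\<Sum>r<n. (c i j r)\<^sup>2)" using that by (intro member_le_sum) auto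
    then show ?thesis using unit[of j] by (simp add: abs_square_le_1)
  qed
  have "l1 d (blk n c i W) \<le> (\<Sum>j\<le>d. \<Sum>r<n. \<bar>c i j r * W (r, j)\<bar>)"
    unfolding blk_def by (intro sum_mono sum_abs)
  also have "\<dots> \<le> (\<Sum>j\<le>d. \<Sum>r<n. \<bar>W (r, j)\<bar>)"
    using c by (intro sum_mono) (simp add: abs_mult mult_left_le_one_le)
  also have "\<dots> = (\<Sum>r<n. \<Sum>j\<le>d. \<bar>W (r, j)\<bar>)" by (rule sum.swap)
  also have "\<dots> = gridnorm n d W"
    unfolding gridnorm_def grid_def sum.cartesian_product by (intro sum.cong) auto
  finally show ?thesis .
qed

text \<open>Replaces third absolute moments by exponential moments, whose integrability is already
  available.\<close>

lemma cube_le_exp: "0 \<le> q \<Longrightarrow> q ^ 3 \<le> exp (3 * (q::real))"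
proof -
  assume q: "0 \<le> q"
  have "q \<le> exp q" using exp_ge_add_one_self[of q] by linarith
  then have "q ^ 3 \<le> exp q ^ 3" using q by (rule power_mono)
  also have "\<dots> = exp (3 * q)" by (simp add: exp_of_nat_mult[symmetric])
  finally show ?thesis .
qed

definition grid_exp :: "nat \<Rightarrow> nat \<Rightarrow> real" where
  "grid_exp n d = (\<integral>W. exp (3 * gridnorm n d W) \<partial>gaussfield)"

lemma integrable_grid_exp: "integrable gaussfield (\<lambda>W. exp (3 * gridnorm n d W))"
  unfolding gridnorm_def by (rule integrable_exp_abs_sum) simp

lemma abs_integral_le_grid_exp:
  assumes "f \<in> borel_measurable gaussfield" and "0 \<le> A"
    and le: "\<And>W. \<bar>f W\<bar> \<le> A * (gridnorm n d W) ^ 3"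
  shows "integrable gaussfield f" and "\<bar>\<integral>W. f W \<partial>gaussfield\<bar> \<le> A * grid_exp n d"
proof -
  have le': "\<bar>f W\<bar> \<le> A * exp (3 * gridnorm n d W)" for W
    using le[of W] mult_left_mono[OF cube_le_exp[OF gridnorm_nonneg] assms(2), of n d W] by linarith
  have int: "integrable gaussfield (\<lambda>W. A * exp (3 * gridnorm n d W))"
    by (intro integrable_mult_right integrable_grid_exp)
  show f: "integrable gaussfield f"
    by (rule Bochner_Integration.integrable_bound[OF int assms(1)], rule AE_I2)
       (use order_trans[OF le' abs_ge_self] in simp)
  have "\<bar>\<integral>W. f W \<partial>gaussfield\<bar> \<le> (\<integral>W. \<bar>f W\<bar> \<partial>gaussfield)"
    by (rule integral_abs_bound)
  also have "\<dots> \<le> (\<integral>W. A * exp (3 * gridnorm n d W) \<partial>gaussfield)"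
    by (intro integral_mono integrable_abs f int le')
  also have "\<dots> = A * grid_exp n d" by (simp add: grid_exp_def)
  finally show "\<bar>\<integral>W. f W \<partial>gaussfield\<bar> \<le> A * grid_exp n d" .
qed

lemma integrable_bounded_gaussfield:
  assumes "f \<in> borel_measurable gaussfield" "\<And>W. \<bar>f W\<bar> \<le> (B::real)"
  shows "integrable gaussfield f"
  by (rule gaussfield.integrable_const_bound[of _ B]) (use assms in auto)

lemma taylorD:
  "taylor d \<sigma> f C p \<Longrightarrow> \<bar>f (\<lambda>j. x j + y j) - f x - \<sigma> * (\<Sum>j\<le>d. p x j * y j)\<bar> \<le> C * (l1 d y)\<^sup>2"
  by (simp add: taylor_def)

lemma taylor_mono:
  assumes T: "taylor d \<sigma> f C p" and le: "C \<le> C'"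
  shows "taylor d \<sigma> f C' p"
  unfolding taylor_def
proof (intro allI conjI)
  fix x y
  show "0 \<le> f x" "f x \<le> 1" "lorentz d (p x)" using T by (simp_all add: taylor_def)
  have "p x d \<le> C" using T by (simp add: taylor_def)
  then show "p x d \<le> C'" using le by simp
  have "C * (l1 d y)\<^sup>2 \<le> C' * (l1 d y)\<^sup>2" using le by (rule mult_right_mono) simp
  with taylorD[OF T, of x y]
  show "\<bar>f (\<lambda>j. x j + y j) - f x - \<sigma> * (\<Sum>j\<le>d. p x j * y j)\<bar> \<le> C' * (l1 d y)\<^sup>2"
    by (rule order_trans)
qed

text \<open>For each single \<open>i\<close> both coefficient families produce a standard Gaussian
  vector; they differ only in the correlation between different \<open>i\<close>.
  \<open>cross\<close> orders these correlations after contraction with two cone vectors, which will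
  be the gradients of two factors of the product.\<close>

locale lindeberg =
  fixes n d k :: nat and a b :: "nat \<Rightarrow> nat \<Rightarrow> nat \<Rightarrow> real" and g :: "nat \<Rightarrow> vect \<Rightarrow> real"
  assumes unit_a: "\<And>i j. (\<Sum>r<n. (a i j r)\<^sup>2) = 1" and unit_b: "\<And>i j. (\<Sum>r<n. (b i j r)\<^sup>2) = 1"
    and cross: "\<And>i i' p q. i < k \<Longrightarrow> i' < k \<Longrightarrow> i \<noteq> i' \<Longrightarrow> lorentz d p \<Longrightarrow> lorentz d q \<Longrightarrow>
      (\<Sum>j\<le>d. p j * q j * (\<Sum>r<n. b i j r * b i' j r)) \<le> (\<Sum>j\<le>d. p j * q j * (\<Sum>r<n. a i j r * a i' j r))"
    and smooth: "\<And>i. i < k \<Longrightarrow> cone_smooth d 1 (g i)"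
begin

lemma uniform_taylor: "\<exists>C\<ge>1. \<exists>p. \<forall>i<k. taylor d 1 (g i) C (p i)"
proof -
  define Q where "Q i Cp \<longleftrightarrow> 1 \<le> fst Cp \<and> taylor d 1 (g i) (fst Cp) (snd Cp)" for i Cp
  have "\<forall>i\<in>{..<k}. \<exists>Cp. Q i Cp"
  proof
    fix i assume "i \<in> {..<k}"
    then obtain C p where "1 \<le> C" "taylor d 1 (g i) C p"
      using smooth[of i] by (auto simp: cone_smooth_def)
    then have "Q i (C, p)" by (simp add: Q_def)
    then show "\<exists>Cp. Q i Cp" ..
  qed
  from bchoice[OF this] obtain Cp where Cp: "\<forall>i\<in>{..<k}. Q i (Cp i)" ..
  let ?C = "1 + (\<Sum>i<k. fst (Cp i))"
  have pos: "0 \<le> fst (Cp i)" if "i < k" for i 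
  proof -
    have "Q i (Cp i)" using Cp that by simp
    then show ?thesis by (simp add: Q_def)
  qed
  have "taylor d 1 (g i) ?C (snd (Cp i))" if i: "i < k" for i
  proof (rule taylor_mono)
    show "taylor d 1 (g i) (fst (Cp i)) (snd (Cp i))" using Cp i by (simp add: Q_def)
    have "fst (Cp i) \<le> (\<Sum>i<k. fst (Cp i))"
      using i pos by (intro member_le_sum) auto
    then show "fst (Cp i) \<le> ?C" by simp
  qed
  moreover have "1 \<le> ?C" using pos by (auto intro: sum_nonneg)
  ultimately show ?thesis
    by (intro exI[of _ ?C] conjI exI[of _ "\<lambda>i. snd (Cp i)"] allI impI)
qed

definition G :: "(nat \<Rightarrow> vect) \<Rightarrow> real" where
  "G s = (\<Prod>i<k. g i (s i))"

lemma g_bounds: "i < k \<Longrightarrow> 0 \<le> g i x" "i < k \<Longrightarrow> g i x \<le> 1"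
  using smooth[of i] by (auto simp: cone_smooth_def taylor_def)

lemma G_bounds: "0 \<le> G s" "G s \<le> 1"
  unfolding G_def using g_bounds by (auto intro!: prod_nonneg prod_le_1)

lemma measurable_g_comp:
  assumes "i < k" "\<And>j. (\<lambda>x. S x j) \<in> borel_measurable M"
  shows "(\<lambda>x. g i (S x)) \<in> borel_measurable M"
  by (rule measurable_compose[OF measurable_into_gaussfield[OF assms(2)]])
     (use smooth[OF assms(1)] in \<open>simp add: cone_smooth_def\<close>)

lemma measurable_G_comp:
  assumes "\<And>i j. (\<lambda>x. S x i j) \<in> borel_measurable M"
  shows "(\<lambda>x. G (S x)) \<in> borel_measurable M"
  unfolding G_def by (intro borel_measurable_prod measurable_g_comp assms) auto

definition R :: "(nat \<Rightarrow> nat \<Rightarrow> nat \<Rightarrow> real) \<Rightarrow> (nat \<Rightarrow> vect) \<Rightarrow> real \<Rightarrow> nat \<Rightarrow> (nat \<times> nat \<Rightarrow> real) \<Rightarrow> real" where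
  "R c s t i W = g i (\<lambda>j. s i j + t * blk n c i W j) - g i (s i)"

lemma measurable_R: "i < k \<Longrightarrow> R c s t i \<in> borel_measurable gaussfield"
  unfolding R_def[abs_def]
  by (intro borel_measurable_diff measurable_g_comp borel_measurable_const) measurable

lemma R_le_1: "i < k \<Longrightarrow> \<bar>R c s t i W\<bar> \<le> 1"
  using g_bounds[of i "s i"] g_bounds[of i "\<lambda>j. s i j + t * blk n c i W j"] unfolding R_def by linarith

lemma l1_scaled_blk:
  assumes "\<And>i j. (\<Sum>r<n. (c i j r)\<^sup>2) = 1" "0 \<le> t"
  shows "l1 d (\<lambda>j. t * blk n c i W j) \<le> t * gridnorm n d W"
proof -
  have "l1 d (\<lambda>j. t * blk n c i W j) = t * l1 d (blk n c i W)"
    using assms(2) by (simp add: abs_mult sum_distrib_left)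
  also have "\<dots> \<le> t * gridnorm n d W"
    using assms by (intro mult_left_mono l1_blk_le) auto
  finally show ?thesis .
qed

lemma R_lipschitz:
  assumes T: "taylor d 1 (g i) C p" and C: "1 \<le> C" and c: "\<And>i j. (\<Sum>r<n. (c i j r)\<^sup>2) = 1" and t: "0 \<le> t"
  shows "\<bar>R c s t i W\<bar> \<le> 2 * C * (t * gridnorm n d W)"
proof -
  have "\<bar>R c s t i W\<bar> \<le> 2 * C * l1 d (\<lambda>j. t * blk n c i W j)"
    unfolding R_def by (rule taylor_lipschitz[OF T C]) simp
  also have "\<dots> \<le> 2 * C * (t * gridnorm n d W)"
    using C l1_scaled_blk[OF c t] by (intro mult_left_mono) auto
  finally show ?thesis .
qed

lemma R_linear:
  assumes T: "taylor d 1 (g i) C p" and C: "1 \<le> C" and c: "\<And>i j. (\<Sum>r<n. (c i j r)\<^sup>2) = 1" and t: "0 \<le> t"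
  shows "\<bar>R c s t i W - t * (\<Sum>j\<le>d. p (s i) j * blk n c i W j)\<bar> \<le> C * (t * gridnorm n d W)\<^sup>2"
proof -
  have "(\<Sum>j\<le>d. p (s i) j * (t * blk n c i W j)) = t * (\<Sum>j\<le>d. p (s i) j * blk n c i W j)"
    by (simp add: sum_distrib_left mult_ac)
  moreover have "\<bar>g i (\<lambda>j. s i j + t * blk n c i W j) - g i (s i) - 1 * (\<Sum>j\<le>d. p (s i) j * (t * blk n c i W j))\<bar>
      \<le> C * (l1 d (\<lambda>j. t * blk n c i W j))\<^sup>2"
    by (rule taylorD[OF T])
  ultimately have "\<bar>R c s t i W - t * (\<Sum>j\<le>d. p (s i) j * blk n c i W j)\<bar> \<le> C * (l1 d (\<lambda>j. t * blk n c i W j))\<^sup>2"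
    unfolding R_def by simp
  also have "\<dots> \<le> C * (t * gridnorm n d W)\<^sup>2"
    using C l1_scaled_blk[OF c t] by (intro mult_left_mono power_mono) (auto intro: sum_nonneg)
  finally show ?thesis .
qed

text \<open>One block is a standard Gaussian vector whatever the unit coefficients are, so the
  right-hand side no longer mentions \<open>c\<close>.\<close>

lemma expectation_R_single:
  assumes i: "i < k" and c: "\<And>i j. (\<Sum>r<n. (c i j r)\<^sup>2) = 1"
  shows "(\<integral>W. R c s t i W \<partial>gaussfield) = (\<integral>x. g i (\<lambda>j. s i j + t * x j) - g i (s i) \<partial>gaussfield)"
proof -
  have m: "(\<lambda>x. g i (\<lambda>j. s i j + t * x j) - g i (s i)) \<in> borel_measurable gaussfield"
    by (intro borel_measurable_diff measurable_g_comp[OF i] borel_measurable_const) measurable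
  have "(\<integral>x. g i (\<lambda>j. s i j + t * x j) - g i (s i) \<partial>gaussfield)
      = (\<integral>x. g i (\<lambda>j. s i j + t * x j) - g i (s i) \<partial>distr gaussfield gaussfield (blk n c i))"
    unfolding distr_blk[OF c] ..
  also have "\<dots> = (\<integral>W. R c s t i W \<partial>gaussfield)"
    unfolding R_def by (rule integral_distr[OF measurable_blk_field m])
  finally show ?thesis ..
qed

text \<open>Both increments are replaced by their linear parts, whose covariance is explicit. The
  error is a linearisation error times a Lipschitz bound, \<open>C\<close> times
  \<open>2 * C\<close>, plus a linear part times a linearisation error, \<open>C\<close> times
  \<open>C\<close>; hence \<open>3 * C\<^sup>2\<close>.\<close>

lemma expectation_R_pair:
  assumes T: "taylor d 1 (g i) C p" and T': "taylor d 1 (g i') C p'" and C: "1 \<le> C"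
    and i: "i < k" "i' < k" and c: "\<And>i j. (\<Sum>r<n. (c i j r)\<^sup>2) = 1" and t: "0 \<le> t"
  shows "\<bar>(\<integral>W. R c s t i W * R c s t i' W \<partial>gaussfield)
      - t\<^sup>2 * (\<Sum>j\<le>d. p (s i) j * p' (s i') j * (\<Sum>r<n. c i j r * c i' j r))\<bar> \<le> 3 * C\<^sup>2 * t ^ 3 * grid_exp n d"
proof -
  let ?l = "\<lambda>W. \<Sum>j\<le>d. p (s i) j * blk n c i W j" and ?l' = "\<lambda>W. \<Sum>j\<le>d. p' (s i') j * blk n c i' W j"
  let ?Q = "gridnorm n d" and ?R = "R c s t i" and ?R' = "R c s t i'"
  define D where "D W = ?R W * ?R' W - t\<^sup>2 * (?l W * ?l' W)" for W
  have l: "\<bar>?l W\<bar> \<le> C * ?Q W" for W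
  proof -
    have "\<bar>?l W\<bar> \<le> p (s i) d * l1 d (blk n c i W)"
      by (rule lorentz_linear_le) (use T in \<open>simp add: taylor_def\<close>)
    also have "\<dots> \<le> C * ?Q W"
      using T C by (intro mult_mono l1_blk_le c) (auto simp: taylor_def intro: sum_nonneg)
    finally show ?thesis .
  qed
  have D: "\<bar>D W\<bar> \<le> 3 * C\<^sup>2 * t ^ 3 * (?Q W) ^ 3" for W
  proof -
    have Q: "0 \<le> ?Q W" by (rule gridnorm_nonneg)
    have split: "\<bar>x * y - t\<^sup>2 * (z * w)\<bar> \<le> \<bar>x - t * z\<bar> * \<bar>y\<bar> + \<bar>t * z\<bar> * \<bar>y - t * w\<bar>" for x y z w
    proof -
      have "x * y - t\<^sup>2 * (z * w) = (x - t * z) * y + t * z * (y - t * w)"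
        by (simp add: algebra_simps power2_eq_square)
      then show ?thesis
        unfolding abs_mult[symmetric] by (simp only: abs_triangle_ineq)
    qed
    have "\<bar>D W\<bar> \<le> \<bar>?R W - t * ?l W\<bar> * \<bar>?R' W\<bar> + \<bar>t * ?l W\<bar> * \<bar>?R' W - t * ?l' W\<bar>"
      unfolding D_def by (rule split)
    also have "\<dots> \<le> (C * (t * ?Q W)\<^sup>2) * (2 * C * (t * ?Q W)) + (t * (C * ?Q W)) * (C * (t * ?Q W)\<^sup>2)"
    proof (intro add_mono mult_mono)
      show "\<bar>?R W - t * ?l W\<bar> \<le> C * (t * ?Q W)\<^sup>2" by (rule R_linear[OF T C c t])
      show "\<bar>?R' W\<bar> \<le> 2 * C * (t * ?Q W)" by (rule R_lipschitz[OF T' C c t])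
      show "\<bar>t * ?l W\<bar> \<le> t * (C * ?Q W)" unfolding abs_mult using t l by (simp add: mult_left_mono)
      show "\<bar>?R' W - t * ?l' W\<bar> \<le> C * (t * ?Q W)\<^sup>2" by (rule R_linear[OF T' C c t])
    qed (use C Q t in auto)
    also have "\<dots> = 3 * C\<^sup>2 * t ^ 3 * (?Q W) ^ 3"
      by (simp add: power2_eq_square power3_eq_cube algebra_simps)
    finally show ?thesis .
  qed
  have mD: "D \<in> borel_measurable gaussfield"
    unfolding D_def[abs_def] using measurable_R[OF i(1)] measurable_R[OF i(2)] by measurable
  have nn: "0 \<le> 3 * C\<^sup>2 * t ^ 3" using t by simp
  note cov = gaussfield_covariance[OF finite_grid[of n d]]
  have intll: "integrable gaussfield (\<lambda>W. ?l W * ?l' W)"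
    unfolding blk_linear by (rule cov(1))
  have "(\<integral>W. ?l W * ?l' W \<partial>gaussfield) = (\<Sum>z\<in>grid n d. (p (s i) (snd z) * c i (snd z) (fst z)) * (p' (s i') (snd z) * c i' (snd z) (fst z)))"
    unfolding blk_linear by (rule cov(2))
  also have "\<dots> = (\<Sum>r<n. \<Sum>j\<le>d. (p (s i) j * c i j r) * (p' (s i') j * c i' j r))"
    unfolding grid_def sum.cartesian_product by (intro sum.cong) auto
  also have "\<dots> = (\<Sum>j\<le>d. \<Sum>r<n. (p (s i) j * c i j r) * (p' (s i') j * c i' j r))"
    by (rule sum.swap)
  also have "\<dots> = (\<Sum>j\<le>d. p (s i) j * p' (s i') j * (\<Sum>r<n. c i j r * c i' j r))"
    by (simp add: sum_distrib_left mult_ac)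
  finally have ll: "(\<integral>W. ?l W * ?l' W \<partial>gaussfield) = (\<Sum>j\<le>d. p (s i) j * p' (s i') j * (\<Sum>r<n. c i j r * c i' j r))" .
  have "(\<integral>W. ?R W * ?R' W \<partial>gaussfield) = (\<integral>W. D W + t\<^sup>2 * (?l W * ?l' W) \<partial>gaussfield)"
    by (simp add: D_def)
  also have "\<dots> = (\<integral>W. D W \<partial>gaussfield) + t\<^sup>2 * (\<integral>W. ?l W * ?l' W \<partial>gaussfield)"
    using abs_integral_le_grid_exp(1)[OF mD nn D] intll by simp
  finally show ?thesis
    unfolding ll using abs_integral_le_grid_exp(2)[OF mD nn D] by simp
qed

text \<open>Three increments already give \<open>t ^ 3\<close>; the others are bounded by 1, so the
  estimate does not deteriorate with the number of factors.\<close>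

lemma expectation_R_triple:
  assumes T: "\<And>i. i < k \<Longrightarrow> taylor d 1 (g i) C (p i)" and C: "1 \<le> C"
    and B: "B \<subseteq> {..<k}" "3 \<le> card B" and c: "\<And>i j. (\<Sum>r<n. (c i j r)\<^sup>2) = 1" and t: "0 \<le> t"
  shows "\<bar>\<integral>W. (\<Prod>i\<in>B. R c s t i W) \<partial>gaussfield\<bar> \<le> 8 * C ^ 3 * t ^ 3 * grid_exp n d"
proof (rule abs_integral_le_grid_exp(2))
  have fin: "finite B" using B(1) finite_subset by blast
  show "(\<lambda>W. \<Prod>i\<in>B. R c s t i W) \<in> borel_measurable gaussfield"
    using B by (intro borel_measurable_prod measurable_R) auto
  show "0 \<le> 8 * C ^ 3 * t ^ 3" using C t by simp
  obtain B' where B': "B' \<subseteq> B" "card B' = 3" "finite B'"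
    using obtain_subset_with_card_n[OF B(2)] by blast
  fix W
  have "\<bar>\<Prod>i\<in>B. R c s t i W\<bar> = (\<Prod>i\<in>B. \<bar>R c s t i W\<bar>)" by (rule abs_prod)
  also have "\<dots> = (\<Prod>i\<in>B'. \<bar>R c s t i W\<bar>) * (\<Prod>i\<in>B - B'. \<bar>R c s t i W\<bar>)"
    using prod.subset_diff[OF B'(1) fin] by (simp add: mult.commute)
  also have "\<dots> \<le> (\<Prod>i\<in>B'. \<bar>R c s t i W\<bar>) * 1"
    using B by (intro mult_left_mono prod_le_1 prod_nonneg) (auto intro: R_le_1)
  also have "\<dots> \<le> (\<Prod>i\<in>B'. 2 * C * (t * gridnorm n d W)) * 1"
    using B B' by (intro mult_right_mono prod_mono conjI R_lipschitz[OF T C c t]) auto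
  also have "\<dots> = 8 * C ^ 3 * t ^ 3 * gridnorm n d W ^ 3"
    by (simp add: B'(2) power_mult_distrib)
  finally show "\<bar>\<Prod>i\<in>B. R c s t i W\<bar> \<le> 8 * C ^ 3 * t ^ 3 * gridnorm n d W ^ 3" .
qed

text \<open>A single increment has the same law on both sides, three or more increments are negligible, and
  for a pair the covariance condition on the Lorentz cone decides.\<close>

lemma expectation_R_compare:
  assumes T: "\<And>i. i < k \<Longrightarrow> taylor d 1 (g i) C (p i)" and C: "1 \<le> C"
    and B: "B \<subseteq> {..<k}" and t: "0 \<le> t"
  shows "(\<integral>W. (\<Prod>i\<in>B. R b s t i W) \<partial>gaussfield) - 16 * C ^ 3 * grid_exp n d * t ^ 3
    \<le> (\<integral>W. (\<Prod>i\<in>B. R a s t i W) \<partial>gaussfield)"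
proof -
  have M: "0 \<le> grid_exp n d" unfolding grid_exp_def by (rule integral_nonneg_AE) simp
  \<comment> \<open>The coefficient \<open>16 * C ^ 3\<close> is twice the bound for triples; as
    \<open>1 \<le> C\<close>, it also covers twice the bound \<open>3 * C\<^sup>2\<close> for
    pairs.\<close>
  have e: "0 \<le> 16 * C ^ 3 * grid_exp n d * t ^ 3" using C t M by simp
  have fin: "finite B" using B finite_subset by blast
  consider "card B = 0" | "card B = 1" | "card B = 2" | "3 \<le> card B" by linarith
  then show ?thesis
  proof cases
    case 1
    then have "B = {}" using fin by simp
    then show ?thesis using e by simp
  next
    case 2
    then obtain i where Bi: "B = {i}" by (rule card_1_singletonE)
    then have i: "i < k" using B by simp
    show ?thesis
      using e by (simp add: Bi expectation_R_single[OF i unit_a] expectation_R_single[OF i unit_b])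
  next
    case 3
    then obtain i i' where Bi: "B = {i, i'}" "i \<noteq> i'" unfolding card_2_iff by blast
    then have i: "i < k" "i' < k" using B by auto
    let ?S = "\<lambda>c. \<Sum>j\<le>d. p i (s i) j * p i' (s i') j * (\<Sum>r<n. c i j r * c i' j r)"
    let ?E = "\<lambda>c. \<integral>W. R c s t i W * R c s t i' W \<partial>gaussfield"
    have "\<bar>?E a - t\<^sup>2 * ?S a\<bar> \<le> 3 * C\<^sup>2 * t ^ 3 * grid_exp n d"
      by (rule expectation_R_pair[OF T[OF i(1)] T[OF i(2)] C i unit_a t])
    moreover have "\<bar>?E b - t\<^sup>2 * ?S b\<bar> \<le> 3 * C\<^sup>2 * t ^ 3 * grid_exp n d"
      by (rule expectation_R_pair[OF T[OF i(1)] T[OF i(2)] C i unit_b t])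
    moreover have "t\<^sup>2 * ?S b \<le> t\<^sup>2 * ?S a"
      using T[OF i(1)] T[OF i(2)] by (intro mult_left_mono cross i Bi(2)) (auto simp: taylor_def)
    moreover have "6 * C\<^sup>2 * t ^ 3 * grid_exp n d \<le> 16 * C ^ 3 * grid_exp n d * t ^ 3"
    proof -
      have "C\<^sup>2 * 6 \<le> C ^ 3 * 16"
        using C power_increasing[of 2 3 C] by (intro mult_mono) auto
      then have "C\<^sup>2 * 6 * (t ^ 3 * grid_exp n d) \<le> C ^ 3 * 16 * (t ^ 3 * grid_exp n d)"
        using t M by (intro mult_right_mono) auto
      then show ?thesis by (simp add: mult_ac)
    qed
    ultimately have "?E b - 16 * C ^ 3 * grid_exp n d * t ^ 3 \<le> ?E a" by linarith
    then show ?thesis using Bi by simp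
  next
    case 4
    have "\<bar>\<integral>W. (\<Prod>i\<in>B. R a s t i W) \<partial>gaussfield\<bar> \<le> 8 * C ^ 3 * t ^ 3 * grid_exp n d"
      "\<bar>\<integral>W. (\<Prod>i\<in>B. R b s t i W) \<partial>gaussfield\<bar> \<le> 8 * C ^ 3 * t ^ 3 * grid_exp n d"
      by (rule expectation_R_triple[OF T C B 4 _ t], use unit_a unit_b in auto)+
    moreover have "16 * C ^ 3 * grid_exp n d * t ^ 3 = 8 * C ^ 3 * t ^ 3 * grid_exp n d + 8 * C ^ 3 * t ^ 3 * grid_exp n d"
      by simp
    ultimately show ?thesis by linarith
  qed
qed

text \<open>Sorts the moved product by the set \<open>B\<close> of factors that contribute their
  increment; the remaining factors stay at the base point and are not random.\<close>

lemma G_expansion: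
  "G (\<lambda>i j. s i j + t * blk n c i W j) =
    (\<Sum>B\<in>Pow {..<k}. (\<Prod>i\<in>B. R c s t i W) * (\<Prod>i\<in>{..<k} - B. g i (s i)))"
proof -
  have "G (\<lambda>i j. s i j + t * blk n c i W j) = (\<Prod>i<k. R c s t i W + g i (s i))"
    by (simp add: G_def R_def)
  then show ?thesis by (simp only: prod_add[OF finite_lessThan])
qed

lemma expectation_G_expansion:
  "(\<integral>W. G (\<lambda>i j. s i j + t * blk n c i W j) \<partial>gaussfield) =
    (\<Sum>B\<in>Pow {..<k}. (\<integral>W. (\<Prod>i\<in>B. R c s t i W) \<partial>gaussfield) * (\<Prod>i\<in>{..<k} - B. g i (s i)))"
proof -
  have "integrable gaussfield (\<lambda>W. \<Prod>i\<in>B. R c s t i W)" if "B \<subseteq> {..<k}" for B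
  proof (rule integrable_bounded_gaussfield[of _ 1])
    show "(\<lambda>W. \<Prod>i\<in>B. R c s t i W) \<in> borel_measurable gaussfield"
      using that by (intro borel_measurable_prod measurable_R) auto
    show "\<bar>\<Prod>i\<in>B. R c s t i W\<bar> \<le> 1" for W
      unfolding abs_prod using that by (intro prod_le_1) (auto intro: R_le_1)
  qed
  then show ?thesis
    unfolding G_expansion by (subst Bochner_Integration.integral_sum) auto
qed

text \<open>\<open>K\<close> is uniform in \<open>s\<close> and \<open>t\<close>. Uniformity in
  \<open>s\<close> matters because later steps start from random points.\<close>

lemma one_step:
  "\<exists>K\<ge>0. \<forall>s t. 0 \<le> t \<longrightarrow>
    (\<integral>W. G (\<lambda>i j. s i j + t * blk n b i W j) \<partial>gaussfield) - K * t ^ 3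
      \<le> (\<integral>W. G (\<lambda>i j. s i j + t * blk n a i W j) \<partial>gaussfield)"
proof -
  obtain C p where C: "1 \<le> C" and T: "\<And>i. i < k \<Longrightarrow> taylor d 1 (g i) C (p i)"
    using uniform_taylor by blast
  have M: "0 \<le> grid_exp n d" unfolding grid_exp_def by (rule integral_nonneg_AE) simp
  let ?e = "16 * C ^ 3 * grid_exp n d"
  let ?K = "\<Sum>B\<in>Pow {..<k}. ?e"
  have e: "0 \<le> ?e" using C M by simp
  have "(\<integral>W. G (\<lambda>i j. s i j + t * blk n b i W j) \<partial>gaussfield) - ?K * t ^ 3
      \<le> (\<integral>W. G (\<lambda>i j. s i j + t * blk n a i W j) \<partial>gaussfield)" if t: "0 \<le> t" for s t
  proof -
    let ?g = "\<lambda>B. \<Prod>i\<in>{..<k} - B. g i (s i)"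
    let ?E = "\<lambda>c B. \<integral>W. (\<Prod>i\<in>B. R c s t i W) \<partial>gaussfield"
    have "?E b B * ?g B - ?e * t ^ 3 \<le> ?E a B * ?g B" if B: "B \<in> Pow {..<k}" for B
    proof -
      have gB: "0 \<le> ?g B" "?g B \<le> 1"
        using g_bounds by (auto intro!: prod_nonneg prod_le_1)
      have "(?E b B - ?e * t ^ 3) * ?g B \<le> ?E a B * ?g B"
        using expectation_R_compare[OF T C _ t] B gB by (intro mult_right_mono) auto
      moreover have "?e * t ^ 3 * ?g B \<le> ?e * t ^ 3"
        using gB e t by (intro mult_left_le) auto
      ultimately show ?thesis by (simp add: left_diff_distrib)
    qed
    then have "(\<Sum>B\<in>Pow {..<k}. ?E b B * ?g B - ?e * t ^ 3) \<le> (\<Sum>B\<in>Pow {..<k}. ?E a B * ?g B)"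
      by (rule sum_mono)
    then show ?thesis
      unfolding expectation_G_expansion by (simp add: sum_subtractf sum_distrib_right)
  qed
  then show ?thesis using e by (intro exI[of _ ?K]) (simp add: sum_nonneg)
qed

end

section \<open>Gaussian comparison of minima of maxima\<close>

context lindeberg
begin

definition I :: "(nat \<Rightarrow> nat \<Rightarrow> nat \<Rightarrow> real) \<Rightarrow> (nat \<Rightarrow> vect) \<Rightarrow> real \<Rightarrow> real" where
  "I c s t = (\<integral>W. G (\<lambda>i j. s i j + t * blk n c i W j) \<partial>gaussfield)"

lemma measurable_pair_G:
  "(\<lambda>w. G (\<lambda>i j. s i j + t * blk n c i (fst w) j + t' * blk n c' i (snd w) j))
    \<in> borel_measurable (gaussfield \<Otimes>\<^sub>M gaussfield)"
  by (intro measurable_G_comp borel_measurable_add borel_measurable_times borel_measurable_const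
      measurable_compose[OF measurable_fst measurable_blk] measurable_compose[OF measurable_snd measurable_blk])

lemma integrable_pair_G:
  "integrable (gaussfield \<Otimes>\<^sub>M gaussfield)
    (\<lambda>w. G (\<lambda>i j. s i j + t * blk n c i (fst w) j + t' * blk n c' i (snd w) j))"
proof -
  interpret P: pair_prob_space "gaussfield :: (nat \<times> nat \<Rightarrow> real) measure" "gaussfield :: (nat \<times> nat \<Rightarrow> real) measure" ..
  show ?thesis
    by (rule P.integrable_const_bound[of _ 1]) (use G_bounds measurable_pair_G in auto)
qed

lemma I_iterated:
  "(\<integral>x. I c' (\<lambda>i j. s i j + t * blk n c i x j) t' \<partial>gaussfield)
    = (\<integral>w. G (\<lambda>i j. s i j + t * blk n c i (fst w) j + t' * blk n c' i (snd w) j) \<partial>(gaussfield \<Otimes>\<^sub>M gaussfield))"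
proof -
  interpret P: pair_prob_space "gaussfield :: (nat \<times> nat \<Rightarrow> real) measure" "gaussfield :: (nat \<times> nat \<Rightarrow> real) measure" ..
  show ?thesis
    unfolding I_def using P.integral_fst'[OF integrable_pair_G[of s t c t' c']] by simp
qed

lemma integrable_I: "integrable gaussfield (\<lambda>x. I c' (\<lambda>i j. s i j + t * blk n c i x j) t')"
proof -
  interpret P: pair_prob_space "gaussfield :: (nat \<times> nat \<Rightarrow> real) measure" "gaussfield :: (nat \<times> nat \<Rightarrow> real) measure" ..
  show ?thesis
    unfolding I_def using P.integrable_fst'[OF integrable_pair_G[of s t c t' c']] by simp
qed

lemma I_swap:
  "(\<integral>x. I c' (\<lambda>i j. s i j + t * blk n c i x j) t' \<partial>gaussfield)
    = (\<integral>x. I c (\<lambda>i j. s i j + t' * blk n c' i x j) t \<partial>gaussfield)"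
proof -
  interpret P: pair_prob_space "gaussfield :: (nat \<times> nat \<Rightarrow> real) measure" "gaussfield :: (nat \<times> nat \<Rightarrow> real) measure" ..
  have int: "integrable (gaussfield \<Otimes>\<^sub>M gaussfield)
      (case_prod (\<lambda>x y. G (\<lambda>i j. s i j + t * blk n c i x j + t' * blk n c' i y j)))"
    using integrable_pair_G[of s t c t' c'] by (simp add: case_prod_beta')
  have "(\<integral>x. (\<integral>y. G (\<lambda>i j. s i j + t * blk n c i x j + t' * blk n c' i y j) \<partial>gaussfield) \<partial>gaussfield)
      = (\<integral>y. (\<integral>x. G (\<lambda>i j. s i j + t * blk n c i x j + t' * blk n c' i y j) \<partial>gaussfield) \<partial>gaussfield)"
    by (rule P.Fubini_integral[OF int, symmetric])
  also have "\<dots> = (\<integral>y. (\<integral>x. G (\<lambda>i j. s i j + t' * blk n c' i y j + t * blk n c i x j) \<partial>gaussfield) \<partial>gaussfield)"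
    by (simp only: add.assoc add.commute[of "t' * _"])
  finally show ?thesis unfolding I_def .
qed

text \<open>The semigroup property of Gaussian smoothing: the variances of independent increments
  add up.\<close>

lemma I_split:
  assumes \<tau>: "0 < \<tau>" "t\<^sup>2 + t'\<^sup>2 = \<tau>\<^sup>2"
  shows "I c s \<tau> = (\<integral>x. I c (\<lambda>i j. s i j + t * blk n c i x j) t' \<partial>gaussfield)"
proof -
  let ?p = "t / \<tau>" and ?q = "t' / \<tau>"
  let ?F = "\<lambda>W. G (\<lambda>i j. s i j + \<tau> * blk n c i W j)"
  let ?m = "\<lambda>w z. ?p * fst w z + ?q * snd w z"
  have pq: "?p\<^sup>2 + ?q\<^sup>2 = 1"
    using \<tau> by (simp add: power_divide add_divide_distrib[symmetric])
  have mF: "?F \<in> borel_measurable gaussfield"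
    by (intro measurable_G_comp) measurable
  have mm: "?m \<in> measurable (gaussfield \<Otimes>\<^sub>M gaussfield) gaussfield"
    by (intro measurable_into_gaussfield) measurable
  have "I c s \<tau> = (\<integral>W. ?F W \<partial>distr (gaussfield \<Otimes>\<^sub>M gaussfield) gaussfield ?m)"
    unfolding distr_gaussfield_sum[OF pq] I_def ..
  also have "\<dots> = (\<integral>w. ?F (?m w) \<partial>(gaussfield \<Otimes>\<^sub>M gaussfield))"
    by (rule integral_distr[OF mm mF])
  also have "\<dots> = (\<integral>w. G (\<lambda>i j. s i j + t * blk n c i (fst w) j + t' * blk n c i (snd w) j) \<partial>(gaussfield \<Otimes>\<^sub>M gaussfield))"
    unfolding blk_combination using \<tau>(1) by (simp add: distrib_left add.assoc)
  finally show ?thesis unfolding I_iterated .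
qed

text \<open>The intermediate process makes one step with \<open>a\<close> and \<open>m\<close> steps
  with \<open>b\<close>. Up to the errors, pure \<open>a\<close> lies above it by the induction
  hypothesis, taken at random starting points. It lies above pure \<open>b\<close> by
  \<open>K\<close>, once \<open>I_swap\<close> has put the stretch of \<open>b\<close>
  first.\<close>

lemma many_steps:
  assumes K: "\<And>s t. 0 \<le> t \<Longrightarrow> I b s t - K * t ^ 3 \<le> I a s t" and t: "0 < t"
  shows "I b s (t * sqrt (real m)) - real m * (K * t ^ 3) \<le> I a s (t * sqrt (real m))"
proof (induction m arbitrary: s)
  case 0
  show ?case by (simp add: I_def)
next
  case (Suc m)
  let ?u = "t * sqrt (real m)" and ?v = "t * sqrt (real (Suc m))"
  have v: "0 < ?v" using t by simp
  have sq: "t\<^sup>2 + ?u\<^sup>2 = ?v\<^sup>2" "?u\<^sup>2 + t\<^sup>2 = ?v\<^sup>2"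
    by (simp_all add: power_mult_distrib algebra_simps)
  have "(\<integral>x. I b (\<lambda>i j. s i j + t * blk n a i x j) ?u - real m * (K * t ^ 3) \<partial>gaussfield)
      \<le> (\<integral>x. I a (\<lambda>i j. s i j + t * blk n a i x j) ?u \<partial>gaussfield)"
    by (intro integral_mono Bochner_Integration.integrable_diff integrable_I Suc.IH) simp
  also have "\<dots> = I a s ?v" by (rule I_split[OF v sq(1), symmetric])
  also have "(\<integral>x. I b (\<lambda>i j. s i j + t * blk n a i x j) ?u - real m * (K * t ^ 3) \<partial>gaussfield)
      = (\<integral>x. I b (\<lambda>i j. s i j + t * blk n a i x j) ?u \<partial>gaussfield) - real m * (K * t ^ 3)"
    using integrable_I by (simp add: gaussfield.prob_space[simplified])
  also have "(\<integral>x. I b (\<lambda>i j. s i j + t * blk n a i x j) ?u \<partial>gaussfield)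
      = (\<integral>x. I a (\<lambda>i j. s i j + ?u * blk n b i x j) t \<partial>gaussfield)"
    by (rule I_swap)
  finally have 1: "(\<integral>x. I a (\<lambda>i j. s i j + ?u * blk n b i x j) t \<partial>gaussfield) - real m * (K * t ^ 3) \<le> I a s ?v" .
  have "(\<integral>x. I b (\<lambda>i j. s i j + ?u * blk n b i x j) t - K * t ^ 3 \<partial>gaussfield)
      \<le> (\<integral>x. I a (\<lambda>i j. s i j + ?u * blk n b i x j) t \<partial>gaussfield)"
    using t by (intro integral_mono Bochner_Integration.integrable_diff integrable_I K) simp_all
  also have "(\<integral>x. I b (\<lambda>i j. s i j + ?u * blk n b i x j) t - K * t ^ 3 \<partial>gaussfield)
      = (\<integral>x. I b (\<lambda>i j. s i j + ?u * blk n b i x j) t \<partial>gaussfield) - K * t ^ 3"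
    using integrable_I by (simp add: gaussfield.prob_space[simplified])
  also have "(\<integral>x. I b (\<lambda>i j. s i j + ?u * blk n b i x j) t \<partial>gaussfield) = I b s ?v"
    by (rule I_split[OF v sq(2), symmetric])
  finally have 2: "I b s ?v - K * t ^ 3 \<le> (\<integral>x. I a (\<lambda>i j. s i j + ?u * blk n b i x j) t \<partial>gaussfield)" .
  have "real (Suc m) * (K * t ^ 3) = real m * (K * t ^ 3) + K * t ^ 3" by (simp add: algebra_simps)
  with 1 2 show ?case by linarith
qed

text \<open>With \<open>m + 1\<close> steps of size \<open>1 / sqrt (m + 1)\<close> the errors of
  order \<open>t ^ 3\<close> add up to \<open>K / sqrt (m + 1)\<close>, which vanishes in the
  limit.\<close>

lemma smooth_comparison:
  "(\<integral>W. (\<Prod>i<k. g i (blk n b i W)) \<partial>gaussfield) \<le> (\<integral>W. (\<Prod>i<k. g i (blk n a i W)) \<partial>gaussfield)"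
proof -
  obtain K where K: "\<And>s t. 0 \<le> t \<Longrightarrow> I b s t - K * t ^ 3 \<le> I a s t"
    using one_step unfolding I_def by blast
  let ?s = "\<lambda>i j. 0"
  have le: "I b ?s 1 - K * (1 / sqrt (real (Suc m))) \<le> I a ?s 1" for m
  proof -
    let ?t = "1 / sqrt (real (Suc m))"
    have t: "0 < ?t" by simp
    have 1: "?t * sqrt (real (Suc m)) = 1" by simp
    have "real (Suc m) * ?t\<^sup>2 = 1" by (simp add: power_divide)
    then have 2: "real (Suc m) * (K * ?t ^ 3) = K * ?t"
      by (simp add: power2_eq_square power3_eq_cube)
    show ?thesis using many_steps[OF K t, of ?s "Suc m"] unfolding 1 2 .
  qed
  have "filterlim (\<lambda>m. sqrt (real (Suc m))) at_top sequentially"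
    by (rule filterlim_compose[OF sqrt_at_top filterlim_compose[OF filterlim_real_sequentially filterlim_Suc]])
  then have "(\<lambda>m. 1 / sqrt (real (Suc m))) \<longlonglongrightarrow> 0"
    by (rule tendsto_divide_0[OF tendsto_const filterlim_at_top_imp_at_infinity])
  then have "(\<lambda>m. I b ?s 1 - K * (1 / sqrt (real (Suc m)))) \<longlonglongrightarrow> I b ?s 1 - K * 0"
    by (intro tendsto_diff tendsto_mult tendsto_const)
  then have "I b ?s 1 - K * 0 \<le> I a ?s 1"
    by (rule LIMSEQ_le_const2) (use le in blast)
  then show ?thesis by (simp add: I_def G_def)
qed

end

text \<open>The shift by \<open>sqrt m\<close> makes the limit the indicator of a closed half line, including its end point.\<close>

lemma ramp_limit:
  "(\<lambda>m. ramp (real m * e + sqrt (real m))) \<longlonglongrightarrow> (if 0 \<le> e then 1 else 0)"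
proof -
  have sq: "filterlim (\<lambda>m. sqrt (real m)) at_top sequentially"
    by (rule filterlim_compose[OF sqrt_at_top filterlim_real_sequentially])
  show ?thesis
  proof (cases "0 \<le> e")
    case True
    have "filterlim (\<lambda>m. real m * e + sqrt (real m)) at_top sequentially"
      by (rule filterlim_at_top_mono[OF sq]) (use True in auto)
    then have "(\<lambda>m. arctan (real m * e + sqrt (real m))) \<longlonglongrightarrow> pi / 2"
      by (rule filterlim_compose[OF tendsto_arctan_at_top])
    then have "(\<lambda>m. 1 / 2 + arctan (real m * e + sqrt (real m)) / pi) \<longlonglongrightarrow> 1 / 2 + (pi / 2) / pi"
      by (intro tendsto_intros) auto
    then show ?thesis using True by (simp add: ramp_def)
  next
    case False
    then have e: "0 < - e" by simp
    have "filterlim (\<lambda>m. - e * sqrt (real m)) at_top sequentially"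
      by (rule filterlim_tendsto_pos_mult_at_top[OF tendsto_const e sq])
    then have "filterlim (\<lambda>m. - 1 + - e * sqrt (real m)) at_top sequentially"
      by (rule filterlim_tendsto_add_at_top[OF tendsto_const])
    then have "filterlim (\<lambda>m. sqrt (real m) * (- 1 + - e * sqrt (real m))) at_top sequentially"
      by (rule filterlim_at_top_mult_at_top[OF sq])
    moreover have "sqrt (real m) * (- 1 + - e * sqrt (real m)) = - (real m * e + sqrt (real m))" for m
    proof -
      have "sqrt (real m) * sqrt (real m) = real m" by simp
      then show ?thesis by (simp add: algebra_simps)
    qed
    ultimately have "filterlim (\<lambda>m. real m * e + sqrt (real m)) at_bot sequentially"
      by (simp add: filterlim_uminus_at_bot)
    then have "(\<lambda>m. arctan (real m * e + sqrt (real m))) \<longlonglongrightarrow> - (pi / 2)"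
      by (rule filterlim_compose[OF tendsto_arctan_at_bot])
    then have "(\<lambda>m. 1 / 2 + arctan (real m * e + sqrt (real m)) / pi) \<longlonglongrightarrow> 1 / 2 + - (pi / 2) / pi"
      by (intro tendsto_intros) auto
    then show ?thesis using False by (simp add: ramp_def)
  qed
qed

text \<open>The predicates let one statement cover the finite truncations and the full countable
  families.\<close>

lemma halfspaces_measurable:
  fixes P :: "nat \<Rightarrow> bool" and Q :: "nat \<Rightarrow> bool"
  shows "{W. \<exists>i. P i \<and> (\<forall>v. Q v \<longrightarrow> (\<Sum>j\<le>d. u v j * blk n c i W j) \<le> t i)} \<in> sets gaussfield"
proof -
  have "{W \<in> space gaussfield. \<exists>i. P i \<and> (\<forall>v. Q v \<longrightarrow> (\<Sum>j\<le>d. u v j * blk n c i W j) \<le> t i)} \<in> sets gaussfield"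
    by measurable
  then show ?thesis by simp
qed

text \<open>Gordon's inequality in vector form: each \<open>i\<close> carries one standard Gaussian
  vector, tested by the functionals \<open>u v\<close>. Within one \<open>i\<close> the two laws
  agree, so the usual covariance conditions reduce to \<open>cross\<close>, which holds with
  equality for \<open>i = i'\<close>.\<close>

locale gordon =
  fixes n d :: nat and a b :: "nat \<Rightarrow> nat \<Rightarrow> nat \<Rightarrow> real" and u :: "nat \<Rightarrow> vect" and t :: "nat \<Rightarrow> real"
  assumes unit_a: "\<And>i j. (\<Sum>r<n. (a i j r)\<^sup>2) = 1" and unit_b: "\<And>i j. (\<Sum>r<n. (b i j r)\<^sup>2) = 1"
    and cross: "\<And>i i' p q. lorentz d p \<Longrightarrow> lorentz d q \<Longrightarrow>
      (\<Sum>j\<le>d. p j * q j * (\<Sum>r<n. b i j r * b i' j r)) \<le> (\<Sum>j\<le>d. p j * q j * (\<Sum>r<n. a i j r * a i' j r))"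
    and cone: "\<And>v. lorentz d (u v)"
begin

definition event :: "nat \<Rightarrow> nat \<Rightarrow> (nat \<Rightarrow> nat \<Rightarrow> nat \<Rightarrow> real) \<Rightarrow> (nat \<times> nat \<Rightarrow> real) set" where
  "event k N c = {W. \<exists>i. i < k \<and> (\<forall>v. v < N \<longrightarrow> (\<Sum>j\<le>d. u v j * blk n c i W j) \<le> t i)}"

lemma sets_event: "event k N c \<in> sets gaussfield"
  unfolding event_def by (rule halfspaces_measurable)

text \<open>A smooth version of the indicator that \<open>x\<close> violates one of the first
  \<open>N\<close> constraints of \<open>i\<close>. The ramps decrease along the cone and the
  complement reverses this, which gives the sign \<open>1\<close> that \<open>lindeberg\<close> asks
  for.\<close>

definition soft :: "nat \<Rightarrow> nat \<Rightarrow> nat \<Rightarrow> vect \<Rightarrow> real" where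
  "soft N m i x = 1 - (\<Prod>v<N. ramp (real m * (t i - (\<Sum>j\<le>d. u v j * x j)) + sqrt (real m)))"

lemma cone_smooth_soft: "cone_smooth d 1 (soft N m i)"
proof -
  have "cone_smooth d (- 1) (\<lambda>x. \<Prod>v<N. ramp (real m * (t i - (\<Sum>j\<le>d. u v j * x j)) + sqrt (real m)))"
    by (intro cone_smooth_prod cone_smooth_ramp cone) auto
  from cone_smooth_complement[OF this] show ?thesis
    unfolding soft_def[abs_def] by simp
qed

lemma soft_bounds: "0 \<le> soft N m i x" "soft N m i x \<le> 1"
  unfolding soft_def using ramp_bounds by (auto intro!: prod_nonneg prod_le_1)

lemma soft_limit:
  "(\<lambda>m. \<Prod>i<k. soft N m i (blk n c i W)) \<longlonglongrightarrow> 1 - indicator (event k N c) W"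
proof -
  have "(\<lambda>m. \<Prod>i<k. soft N m i (blk n c i W)) \<longlonglongrightarrow>
      (\<Prod>i<k. 1 - (\<Prod>v<N. if 0 \<le> t i - (\<Sum>j\<le>d. u v j * blk n c i W j) then 1 else 0))"
    unfolding soft_def by (intro tendsto_prod tendsto_diff tendsto_const ramp_limit)
  also have "(\<Prod>i<k. 1 - (\<Prod>v<N. if 0 \<le> t i - (\<Sum>j\<le>d. u v j * blk n c i W j) then 1 else 0)) = (1 - indicator (event k N c) W :: real)"
  proof (cases "W \<in> event k N c")
    case True
    then obtain i where i: "i < k" "\<And>v. v < N \<Longrightarrow> (\<Sum>j\<le>d. u v j * blk n c i W j) \<le> t i"
      by (auto simp: event_def)
    then have "(\<Prod>v<N. if 0 \<le> t i - (\<Sum>j\<le>d. u v j * blk n c i W j) then 1 else 0 :: real) = 1"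
      by (intro prod.neutral) auto
    then show ?thesis using True i(1) by (auto intro!: prod_zero)
  next
    case False
    have zero: "(\<Prod>v<N. if 0 \<le> t i - (\<Sum>j\<le>d. u v j * blk n c i W j) then 1 else 0 :: real) = 0" if i: "i < k" for i
    proof -
      obtain v where "v < N" "\<not> (\<Sum>j\<le>d. u v j * blk n c i W j) \<le> t i"
        using False i by (auto simp: event_def)
      then show ?thesis by (intro prod_zero) auto
    qed
    have "(\<Prod>i<k. 1 - (\<Prod>v<N. if 0 \<le> t i - (\<Sum>j\<le>d. u v j * blk n c i W j) then 1 else 0)) = (\<Prod>i<k. 1 - 0 :: real)"
      by (rule prod.cong[OF refl]) (simp only: zero lessThan_iff)
    then show ?thesis using False by simp
  qed
  finally show ?thesis .
qed

lemma soft_expectation_limit: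
  "(\<lambda>m. \<integral>W. (\<Prod>i<k. soft N m i (blk n c i W)) \<partial>gaussfield) \<longlonglongrightarrow> 1 - measure gaussfield (event k N c)"
proof -
  have "(\<lambda>m. \<integral>W. (\<Prod>i<k. soft N m i (blk n c i W)) \<partial>gaussfield)
      \<longlonglongrightarrow> (\<integral>W. 1 - indicator (event k N c) W \<partial>gaussfield)"
  proof (rule integral_dominated_convergence[where w="\<lambda>_. 1"])
    show "(\<lambda>W. \<Prod>i<k. soft N m i (blk n c i W)) \<in> borel_measurable gaussfield" for m
    proof (intro borel_measurable_prod)
      fix i
      show "(\<lambda>W. soft N m i (blk n c i W)) \<in> borel_measurable gaussfield"
        by (rule measurable_compose[OF measurable_blk_field])
           (use cone_smooth_soft in \<open>simp add: cone_smooth_def\<close>)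
    qed
    show "AE W in gaussfield. norm (\<Prod>i<k. soft N m i (blk n c i W)) \<le> 1" for m
      using soft_bounds by (auto simp: abs_prod intro!: prod_le_1)
  qed (use soft_limit sets_event in auto)
  also have "(\<integral>W. 1 - indicator (event k N c) W \<partial>gaussfield) = 1 - measure gaussfield (event k N c)"
    using sets_event by (subst Bochner_Integration.integral_diff)
      (auto simp: gaussfield.prob_space[simplified] gaussfield.emeasure_eq_measure)
  finally show ?thesis .
qed

text \<open>The smoothed products approximate the complements of the events, which reverses the
  direction of \<open>smooth_comparison\<close>.\<close>

lemma finite_comparison: "measure gaussfield (event k N a) \<le> measure gaussfield (event k N b)"
proof -
  have "(\<integral>W. (\<Prod>i<k. soft N m i (blk n b i W)) \<partial>gaussfield) \<le> (\<integral>W. (\<Prod>i<k. soft N m i (blk n a i W)) \<partial>gaussfield)" for m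
  proof -
    interpret lindeberg n d k a b "soft N m"
      by unfold_locales (auto intro: unit_a unit_b cross cone_smooth_soft)
    show ?thesis by (rule smooth_comparison)
  qed
  then have "1 - measure gaussfield (event k N b) \<le> 1 - measure gaussfield (event k N a)"
    by (intro LIMSEQ_le[OF soft_expectation_limit soft_expectation_limit]) blast
  then show ?thesis by simp
qed

text \<open>The vacuous premise matches the shape of \<open>halfspaces_measurable\<close>.\<close>

definition events_lim :: "nat \<Rightarrow> (nat \<Rightarrow> nat \<Rightarrow> nat \<Rightarrow> real) \<Rightarrow> (nat \<times> nat \<Rightarrow> real) set" where
  "events_lim k c = {W. \<exists>i. i < k \<and> (\<forall>v. True \<longrightarrow> (\<Sum>j\<le>d. u v j * blk n c i W j) \<le> t i)}"

text \<open>For finitely many \<open>i\<close> a violated constraint can be picked for each, and any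
  \<open>N\<close> beyond their maximum detects all of them. This exchange of
  \<open>\<exists>i\<close> with the limit in \<open>N\<close> is why \<open>k\<close> stays finite
  until the second limit.\<close>

lemma event_INT: "events_lim k c = (\<Inter>N. event k N c)"
proof
  show "events_lim k c \<subseteq> (\<Inter>N. event k N c)" by (auto simp: events_lim_def event_def)
  show "(\<Inter>N. event k N c) \<subseteq> events_lim k c"
  proof
    fix W assume W: "W \<in> (\<Inter>N. event k N c)"
    show "W \<in> events_lim k c"
    proof (rule ccontr)
      assume "W \<notin> events_lim k c"
      then have "\<forall>i\<in>{..<k}. \<exists>v. \<not> (\<Sum>j\<le>d. u v j * blk n c i W j) \<le> t i"
        by (auto simp: events_lim_def)
      from bchoice[OF this] obtain v where v: "\<forall>i\<in>{..<k}. \<not> (\<Sum>j\<le>d. u (v i) j * blk n c i W j) \<le> t i" ..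
      have "W \<in> event k (Suc (Max (v ` {..<k}))) c" using W by blast
      then obtain i where i: "i < k"
        and le: "\<And>w. w < Suc (Max (v ` {..<k})) \<Longrightarrow> (\<Sum>j\<le>d. u w j * blk n c i W j) \<le> t i"
        by (auto simp: event_def)
      have "v i \<le> Max (v ` {..<k})" using i by (intro Max_ge) auto
      then have "v i < Suc (Max (v ` {..<k}))" by simp
      from le[OF this] v i show False by simp
    qed
  qed
qed

lemma infinite_comparison: "measure gaussfield (events_lim k a) \<le> measure gaussfield (events_lim k b)"
proof -
  have lim: "(\<lambda>N. measure gaussfield (event k N c)) \<longlonglongrightarrow> measure gaussfield (events_lim k c)" for c
    unfolding event_INT
    by (rule gaussfield.finite_Lim_measure_decseq)
       (auto simp: decseq_def event_def intro: sets_event[unfolded event_def])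
  show ?thesis
    by (rule LIMSEQ_le[OF lim lim]) (use finite_comparison in blast)
qed

lemma comparison:
  "measure gaussfield {W. \<exists>i. \<forall>v. (\<Sum>j\<le>d. u v j * blk n a i W j) \<le> t i}
    \<le> measure gaussfield {W. \<exists>i. \<forall>v. (\<Sum>j\<le>d. u v j * blk n b i W j) \<le> t i}"
proof -
  have eq: "{W. \<exists>i. \<forall>v. (\<Sum>j\<le>d. u v j * blk n c i W j) \<le> t i} = (\<Union>k. events_lim k c)" for c
    by (auto simp: events_lim_def)
  have lim: "(\<lambda>k. measure gaussfield (events_lim k c)) \<longlonglongrightarrow> measure gaussfield {W. \<exists>i. \<forall>v. (\<Sum>j\<le>d. u v j * blk n c i W j) \<le> t i}" for c
    unfolding eq
  proof (rule gaussfield.finite_Lim_measure_incseq)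
    show "range (\<lambda>k. events_lim k c) \<subseteq> gaussfield.events"
      unfolding events_lim_def by (rule image_subsetI) (rule halfspaces_measurable)
    show "incseq (\<lambda>k. events_lim k c)" unfolding incseq_def events_lim_def by (blast intro: less_le_trans)
  qed
  show ?thesis
    by (rule LIMSEQ_le[OF lim lim]) (use infinite_comparison in blast)
qed

end

lemma distr_reflection:
  "distr gaussfield gaussfield (\<lambda>\<omega> z. if z = z0 then - \<omega> z else \<omega> z) = gaussfield"
proof -
  have "disjoint_family (\<lambda>z. {z})" by (auto simp: disjoint_family_on_def)
  from distr_gaussfield_blocks[OF this, of "\<lambda>z _. if z = z0 then - 1 else 1"]
  have "distr gaussfield gaussfield (\<lambda>\<omega> z. \<Sum>i\<in>{z}. (if z = z0 then - 1 else 1) * \<omega> i) = gaussfield" by simp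
  moreover have "(\<lambda>\<omega> z. \<Sum>i\<in>{z}. (if z = z0 then - 1 else 1) * \<omega> i) = (\<lambda>\<omega> z. if z = z0 then - \<omega> z else \<omega> z :: real)"
    by (simp add: fun_eq_iff)
  ultimately show ?thesis by simp
qed

text \<open>The comparison needs an additional Gaussian variable \<open>W (0, d)\<close> on the left, with weight \<open>u v d\<close>, to
  match variances. The event on the left is contained in the one with this variable whenever
  \<open>W (0, d) \<le> 0\<close>, and by reflection this costs a factor of two.\<close>

theorem gaussian_minmax:
  fixes lam :: "nat \<Rightarrow> vect" and u :: "nat \<Rightarrow> vect" and t :: "nat \<Rightarrow> real"
  assumes n: "1 \<le> n" and lam: "\<And>i. (\<Sum>r<n. (lam i r)\<^sup>2) = 1" and u: "\<And>v. lorentz d (u v)"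
  shows "measure gaussfield {W. \<exists>i. \<forall>v. (\<Sum>j<d. u v j * (\<Sum>r<n. lam i r * W (r, j))) \<le> t i}
    \<le> 2 * measure gaussfield {W. \<exists>i. \<forall>v. (\<Sum>j<d. u v j * W (0, j)) + u v d * (\<Sum>r<n. lam i r * W (r, d)) \<le> t i}"
proof -
  \<comment> \<open>The unit vector \<open>e\<close> selects row 0, which serves as the Gaussian
    vector shared by all directions; \<open>1 \<le> n\<close> ensures that this row exists.\<close>
  define e where "e r = (if r = 0 then 1 else 0 :: real)" for r :: nat
  have e: "(\<Sum>r<n. e r * x r) = x 0" for x
  proof -
    have "(\<Sum>r<n. e r * x r) = (\<Sum>r<n. if r = 0 then x r else 0)"
      by (intro sum.cong) (auto simp: e_def)
    also have "\<dots> = x 0" using n by (subst sum.delta) auto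
    finally show ?thesis .
  qed
  have ee: "(\<Sum>r<n. (e r)\<^sup>2) = 1" using e[of e] by (simp add: power2_eq_square e_def)
  \<comment> \<open>In \<open>a\<close> the first \<open>d\<close> columns are contracted with the
    direction and the last one is shared; in \<open>b\<close> the roles are exchanged. So
    \<open>a\<close> is the bilinear process with its additional variable, and \<open>b\<close> the
    decoupled one.\<close>
  define a where "a i j = (if j < d then lam i else e)" for i j
  define b where "b i j = (if j = d then lam i else e)" for i j
  interpret gordon n d a b u t
  proof
    fix i j
    show "(\<Sum>r<n. (a i j r)\<^sup>2) = 1" using lam ee by (simp add: a_def)
    show "(\<Sum>r<n. (b i j r)\<^sup>2) = 1" using lam ee by (simp add: b_def)
  next
    fix i i' p q assume p: "lorentz d p" and q: "lorentz d q"
    let ?c = "\<Sum>r<n. lam i r * lam i' r"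
    have split: "(\<Sum>j\<le>d. f j) = (\<Sum>j<d. f j) + f d" for f :: "nat \<Rightarrow> real"
      by (simp add: lessThan_Suc_atMost[symmetric])
    have eq1: "(\<Sum>r<n. e r * e r) = 1" using ee by (simp add: power2_eq_square)
    have B: "(\<Sum>j\<le>d. p j * q j * (\<Sum>r<n. b i j r * b i' j r)) = (\<Sum>j<d. p j * q j) + p d * q d * ?c"
      unfolding split by (simp add: b_def eq1)
    have A: "(\<Sum>j\<le>d. p j * q j * (\<Sum>r<n. a i j r * a i' j r)) = (\<Sum>j<d. p j * q j) * ?c + p d * q d"
      unfolding split by (simp add: a_def eq1 sum_distrib_right)
    \<comment> \<open>The two sides differ by \<open>1 - ?c\<close>, nonnegative by Cauchy-Schwarz,
      times the Lorentz product of \<open>p\<close> and \<open>q\<close>.\<close>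
    have "?c \<le> 1 * 1" by (rule sum_mult_le_cone) (simp_all add: lam)
    then have "0 \<le> (1 - ?c) * (p d * q d - (\<Sum>j<d. p j * q j))"
      using lorentz_ip_le[OF p q] by (intro mult_nonneg_nonneg) auto
    then show "(\<Sum>j\<le>d. p j * q j * (\<Sum>r<n. b i j r * b i' j r)) \<le> (\<Sum>j\<le>d. p j * q j * (\<Sum>r<n. a i j r * a i' j r))"
      unfolding A B by (simp add: algebra_simps)
  qed (rule u)
  have split: "(\<Sum>j\<le>d. f j) = (\<Sum>j<d. f j) + f d" for f :: "nat \<Rightarrow> real"
    by (simp add: lessThan_Suc_atMost[symmetric])
  have blk_a: "(\<Sum>j\<le>d. u v j * blk n a i W j) = (\<Sum>j<d. u v j * (\<Sum>r<n. lam i r * W (r, j))) + u v d * W (0, d)" for v i W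
    unfolding split blk_def by (simp add: a_def e)
  have blk_b: "(\<Sum>j\<le>d. u v j * blk n b i W j) = (\<Sum>j<d. u v j * W (0, j)) + u v d * (\<Sum>r<n. lam i r * W (r, d))" for v i W
    unfolding split blk_def by (simp add: b_def e)
  let ?E = "{W. \<exists>i. \<forall>v. (\<Sum>j<d. u v j * (\<Sum>r<n. lam i r * W (r, j))) \<le> t i}"
  let ?neg = "{W. W (0, d) \<le> (0::real)}" and ?pos = "{W. 0 \<le> (W (0, d) :: real)}"
  let ?T = "\<lambda>W z. if z = (0, d) then - W z else W z :: real"
  have sE: "?E \<in> gaussfield.events"
  proof -
    have "{W \<in> space gaussfield. \<exists>i. \<forall>v. (\<Sum>j<d. u v j * (\<Sum>r<n. lam i r * W (r, j))) \<le> t i} \<in> gaussfield.events"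
      by measurable
    then show ?thesis by simp
  qed
  have s0: "?neg \<in> gaussfield.events" "?pos \<in> gaussfield.events"
  proof -
    have "{W \<in> space gaussfield. W (0, d) \<le> 0} \<in> gaussfield.events" "{W \<in> space gaussfield. 0 \<le> W (0, d)} \<in> gaussfield.events"
      by measurable
    then show "?neg \<in> gaussfield.events" "?pos \<in> gaussfield.events" by simp_all
  qed
  have mT: "?T \<in> measurable gaussfield gaussfield"
    by (intro measurable_into_gaussfield) measurable
  have TE: "?T W \<in> ?E \<longleftrightarrow> W \<in> ?E" for W
  proof -
    have "(\<Sum>j<d. u v j * (\<Sum>r<n. lam i r * ?T W (r, j))) = (\<Sum>j<d. u v j * (\<Sum>r<n. lam i r * W (r, j)))" for i v
      by (intro sum.cong refl) auto
    then show ?thesis by simp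
  qed
  have "measure gaussfield (?E \<inter> ?pos) = measure (distr gaussfield gaussfield ?T) (?E \<inter> ?pos)"
    unfolding distr_reflection ..
  also have "\<dots> = measure gaussfield (?T -` (?E \<inter> ?pos) \<inter> space gaussfield)"
    by (rule measure_distr[OF mT]) (use sE s0 in auto)
  also have "?T -` (?E \<inter> ?pos) \<inter> space gaussfield = ?E \<inter> ?neg"
    using TE by auto
  finally have refl: "measure gaussfield (?E \<inter> ?pos) = measure gaussfield (?E \<inter> ?neg)" .
  have "?E = (?E \<inter> ?neg) \<union> (?E \<inter> ?pos)" by auto
  then have "measure gaussfield ?E \<le> measure gaussfield (?E \<inter> ?neg) + measure gaussfield (?E \<inter> ?pos)"
    using measure_Un_le[of "?E \<inter> ?neg" gaussfield "?E \<inter> ?pos"] sE s0 by auto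
  also have "\<dots> = 2 * measure gaussfield (?E \<inter> ?neg)" unfolding refl by simp
  also have "measure gaussfield (?E \<inter> ?neg) \<le> measure gaussfield {W. \<exists>i. \<forall>v. (\<Sum>j\<le>d. u v j * blk n a i W j) \<le> t i}"
  proof (rule gaussfield.finite_measure_mono)
    show "?E \<inter> ?neg \<subseteq> {W. \<exists>i. \<forall>v. (\<Sum>j\<le>d. u v j * blk n a i W j) \<le> t i}"
    proof
      fix W assume W: "W \<in> ?E \<inter> ?neg"
      then obtain i where i: "\<And>v. (\<Sum>j<d. u v j * (\<Sum>r<n. lam i r * W (r, j))) \<le> t i" by blast
      have "u v d * W (0, d) \<le> 0" for v
        using W u[of v] by (simp add: lorentz_def mult_nonneg_nonpos)
      then have "(\<Sum>j\<le>d. u v j * blk n a i W j) \<le> t i" for v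
        using i[of v] unfolding blk_a by (smt (verit))
      then show "W \<in> {W. \<exists>i. \<forall>v. (\<Sum>j\<le>d. u v j * blk n a i W j) \<le> t i}" by blast
    qed
    show "{W. \<exists>i. \<forall>v. (\<Sum>j\<le>d. u v j * blk n a i W j) \<le> t i} \<in> gaussfield.events"
      using halfspaces_measurable[where P="\<lambda>_. True" and Q="\<lambda>_. True"] by simp
  qed
  also have "\<dots> \<le> measure gaussfield {W. \<exists>i. \<forall>v. (\<Sum>j\<le>d. u v j * blk n b i W j) \<le> t i}"
    by (rule comparison)
  finally show ?thesis unfolding blk_b by simp
qed

section \<open>Norms and dual norms\<close>

text \<open>Serves functions controlled by the first \<open>d\<close> coordinates, namely truncated
  norms and dual norms; for the latter, continuity then yields measurability on the Gaussian
  field.\<close>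

lemma continuous_on_coordinate_lipschitz:
  fixes F :: "vect \<Rightarrow> real"
  assumes "\<And>x y. \<bar>F x - F y\<bar> \<le> (\<Sum>i<d. c i * \<bar>x i - y i\<bar>)"
  shows "continuous_on UNIV F"
  unfolding continuous_on_def
proof (rule ballI)
  fix a :: vect
  have coord: "((\<lambda>x. x i) \<longlongrightarrow> a i) (at a)" for i
    using continuous_on_coordinate[of UNIV i] unfolding continuous_on_def by simp
  have "((\<lambda>x. \<Sum>i<d. c i * \<bar>x i - a i\<bar>) \<longlongrightarrow> (\<Sum>i<d. c i * \<bar>a i - a i\<bar>)) (at a)"
    by (intro tendsto_sum tendsto_mult tendsto_rabs tendsto_diff tendsto_const coord)
  then have lim: "((\<lambda>x. \<Sum>i<d. c i * \<bar>x i - a i\<bar>) \<longlongrightarrow> 0) (at a)" by simp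
  have "((\<lambda>x. F x - F a) \<longlongrightarrow> 0) (at a)"
    by (rule Lim_null_comparison[OF _ lim]) (use assms in simp)
  then show "(F \<longlongrightarrow> F a) (at a within UNIV)"
    using LIM_zero_cancel by blast
qed

lemma measurable_gaussfield_continuous:
  fixes F :: "vect \<Rightarrow> real"
  assumes "continuous_on UNIV F"
  shows "F \<in> borel_measurable gaussfield"
proof -
  have eq: "sets (gaussfield :: vect measure) = sets borel"
    unfolding sets_gaussfield by (rule sets_PiM_equal_borel)
  show ?thesis
    unfolding measurable_cong_sets[OF eq refl] by (rule borel_measurable_continuous_onI[OF assms])
qed

lemma gvec_vsp [simp]: "gvec d x \<in> vsp d"
  by (simp add: gvec_def vsp_def)

lemma gvec_id: "x \<in> vsp d \<Longrightarrow> gvec d x = x"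
  by (auto simp: gvec_def vsp_def fun_eq_iff not_less)

lemma ip_gvec: "ip d x (gvec d y) = (\<Sum>i<d. x i * y i)"
  by (simp add: ip_def gvec_def)

definition unitvec :: "nat \<Rightarrow> vect" where
  "unitvec i = (\<lambda>j. if j = i then 1 else 0)"

lemma unitvec_vsp: "i < d \<Longrightarrow> unitvec i \<in> vsp d"
  by (auto simp: unitvec_def vsp_def)

locale finite_norm =
  fixes d :: nat and N :: "vect \<Rightarrow> real"
  assumes norm: "is_norm d N" and d_pos: "0 < d"
begin

lemma N_nonneg: "x \<in> vsp d \<Longrightarrow> 0 \<le> N x"
  and N_zero_iff: "x \<in> vsp d \<Longrightarrow> N x = 0 \<longleftrightarrow> x = (\<lambda>_. 0)"
  and N_scale: "x \<in> vsp d \<Longrightarrow> N (\<lambda>i. c * x i) = \<bar>c\<bar> * N x"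
  and N_triangle: "x \<in> vsp d \<Longrightarrow> y \<in> vsp d \<Longrightarrow> N (\<lambda>i. x i + y i) \<le> N x + N y"
  using norm by (simp_all add: is_norm_def)

lemma N_le_coordinates: "x \<in> vsp d \<Longrightarrow> N x \<le> (\<Sum>i<d. N (unitvec i) * \<bar>x i\<bar>)"
proof -
  assume x: "x \<in> vsp d"
  have "m \<le> d \<Longrightarrow> N (\<lambda>i. if i < m then x i else 0) \<le> (\<Sum>i<m. N (unitvec i) * \<bar>x i\<bar>)" for m
  proof (induction m)
    case 0
    then show ?case using N_zero_iff[OF vsp_zero] by simp
  next
    case (Suc m)
    let ?y = "\<lambda>i. if i < m then x i else 0" and ?z = "\<lambda>i. x m * unitvec m i"
    have y: "?y \<in> vsp d" using Suc.prems by (auto simp: vsp_def)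
    have z: "?z \<in> vsp d" by (rule vsp_scale[OF unitvec_vsp]) (use Suc.prems in simp)
    have "(\<lambda>i. if i < Suc m then x i else 0) = (\<lambda>i. ?y i + ?z i)"
      by (auto simp: fun_eq_iff unitvec_def less_Suc_eq)
    then have "N (\<lambda>i. if i < Suc m then x i else 0) \<le> N ?y + N ?z"
      using N_triangle[OF y z] by simp
    also have "N ?z = N (unitvec m) * \<bar>x m\<bar>"
      using N_scale[OF unitvec_vsp, of m "x m"] Suc.prems by simp
    also have "N ?y \<le> (\<Sum>i<m. N (unitvec i) * \<bar>x i\<bar>)"
      using Suc by simp
    finally show ?case by simp
  qed
  from this[of d] have "N (gvec d x) \<le> (\<Sum>i<d. N (unitvec i) * \<bar>x i\<bar>)"
    by (simp add: gvec_def)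
  then show ?thesis by (simp only: gvec_id[OF x])
qed

lemma N_diff_le: "\<bar>N (gvec d x) - N (gvec d y)\<bar> \<le> (\<Sum>i<d. N (unitvec i) * \<bar>x i - y i\<bar>)"
proof -
  have 1: "N (gvec d x) - N (gvec d y) \<le> (\<Sum>i<d. N (unitvec i) * \<bar>x i - y i\<bar>)" for x y
  proof -
    let ?z = "\<lambda>i. gvec d x i - gvec d y i"
    have z: "?z \<in> vsp d" by (rule vsp_diff) simp_all
    have "gvec d x = (\<lambda>i. ?z i + gvec d y i)" by simp
    then have "N (gvec d x) \<le> N ?z + N (gvec d y)"
      using N_triangle[OF z gvec_vsp, of y] by simp
    moreover have "N ?z \<le> (\<Sum>i<d. N (unitvec i) * \<bar>x i - y i\<bar>)"
      using N_le_coordinates[OF z] by (simp add: gvec_def)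
    ultimately show ?thesis by simp
  qed
  show ?thesis using 1[of x y] 1[of y x] by (simp add: abs_le_iff abs_minus_commute)
qed

text \<open>\<open>N\<close> is constrained on \<open>vsp d\<close> only. Truncation by
  \<open>gvec\<close> extends it to a function that is continuous on the whole space and agrees with
  \<open>N\<close> there.\<close>

lemma continuous_N: "continuous_on UNIV (\<lambda>x. N (gvec d x))"
  by (rule continuous_on_coordinate_lipschitz) (rule N_diff_le)

text \<open>\<open>N\<close> attains a positive minimum on the compact Euclidean sphere, nonempty
  since \<open>0 < d\<close>, and homogeneity extends the bound to all vectors.\<close>

lemma euclidean_le_N: "\<exists>M>0. \<forall>x\<in>vsp d. sqrt (ip d x x) \<le> M * N x"
proof -
  let ?U = "{x \<in> vsp d. ip d x x = 1}"
  have "unitvec 0 \<in> ?U"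
  proof -
    have "ip d (unitvec 0) (unitvec 0) = (\<Sum>i<d. if i = 0 then 1 else 0)"
      unfolding ip_def by (intro sum.cong) (auto simp: unitvec_def)
    then show ?thesis using d_pos unitvec_vsp by simp
  qed
  then have ne: "?U \<noteq> {}" by blast
  have "continuous_on ?U (\<lambda>x. N (gvec d x))"
    by (rule continuous_on_subset[OF continuous_N]) simp
  from continuous_attains_inf[OF sphere_compact ne this]
  obtain v where v: "v \<in> ?U" and min: "\<forall>x\<in>?U. N (gvec d v) \<le> N (gvec d x)" by blast
  define m where "m = N (gvec d v)"
  have "gvec d v \<noteq> (\<lambda>_. 0)"
    using v gvec_id[of v d] by (auto simp: ip_def)
  then have m: "0 < m"
    unfolding m_def using N_nonneg[OF gvec_vsp, of v] N_zero_iff[OF gvec_vsp, of v] by simp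
  have "sqrt (ip d x x) \<le> 1 / m * N x" if x: "x \<in> vsp d" for x
  proof (cases "x = (\<lambda>_. 0)")
    case True
    then show ?thesis using m N_nonneg[OF x] by (simp add: ip_def)
  next
    case False
    define r where "r = sqrt (ip d x x)"
    have "ip d x x \<noteq> 0" using ip_self_eq_0[OF x] False by blast
    then have r: "0 < r" using ip_nonneg[of d x] unfolding r_def by (simp add: less_le)
    have rr: "r * r = ip d x x" unfolding r_def by simp
    let ?y = "\<lambda>i. (1 / r) * x i"
    have y: "?y \<in> vsp d" by (rule vsp_scale[OF x])
    have "ip d ?y ?y = 1"
      unfolding ip_scale_left ip_scale_right rr[symmetric] using r by simp
    then have "m \<le> N ?y" using min y gvec_id[OF y] unfolding m_def by auto
    also have "N ?y = N x / r" using r by (simp only: N_scale[OF x]) simp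
    finally have "m * r \<le> N x" using r by (simp add: pos_le_divide_eq)
    then show ?thesis unfolding r_def[symmetric] using m by (simp add: field_simps)
  qed
  then show ?thesis using m by (intro exI[of _ "1 / m"]) simp
qed

lemma coordinate_le_N: "\<exists>M>0. \<forall>x\<in>vsp d. \<forall>i. \<bar>x i\<bar> \<le> M * N x"
proof -
  obtain M where M: "0 < M" "\<And>x. x \<in> vsp d \<Longrightarrow> sqrt (ip d x x) \<le> M * N x"
    using euclidean_le_N by blast
  have "\<bar>x i\<bar> \<le> M * N x" if x: "x \<in> vsp d" for x i
  proof (cases "i < d")
    case True
    have "(x i)\<^sup>2 \<le> ip d x x"
      unfolding ip_def power2_eq_square using True by (intro member_le_sum) auto
    then have "sqrt ((x i)\<^sup>2) \<le> sqrt (ip d x x)" by (rule real_sqrt_le_mono)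
    then show ?thesis using M(2)[OF x] by simp
  next
    case False
    then show ?thesis using x M(1) N_nonneg[OF x] by (auto simp: vsp_def)
  qed
  then show ?thesis using M(1) by blast
qed

text \<open>Stated for a closed subset so as to serve both the unit ball of the whole space and the
  trial points in a column space.\<close>

lemma compact_subball:
  assumes V: "closed V" "V \<subseteq> vsp d"
  shows "compact {x \<in> V. N x \<le> \<rho>}"
proof -
  obtain M where M: "0 < M" "\<And>x i. x \<in> vsp d \<Longrightarrow> \<bar>x i\<bar> \<le> M * N x"
    using coordinate_le_N by blast
  have eq: "{x \<in> V. N x \<le> \<rho>} = V \<inter> {x. N (gvec d x) \<le> \<rho>}"
    using V(2) gvec_id by auto
  show ?thesis
  proof (rule compact_bounded_closed)
    show "closed {x \<in> V. N x \<le> \<rho>}"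
      unfolding eq by (intro closed_Int V closed_Collect_le continuous_N continuous_on_const)
    show "{x \<in> V. N x \<le> \<rho>} \<subseteq> vsp d" using V(2) by blast
    fix x i assume x: "x \<in> {x \<in> V. N x \<le> \<rho>}"
    then have "\<bar>x i\<bar> \<le> M * N x" using M V(2) by blast
    also have "\<dots> \<le> M * \<rho>" using x M(1) by (intro mult_left_mono) auto
    finally show "\<bar>x i\<bar> \<le> M * \<rho>" .
  qed
qed

lemma dnorm_upper:
  assumes "v \<in> vsp d" "N v = 1"
  shows "ip d v u \<le> dnorm d N u"
  unfolding dnorm_def
proof (rule cSup_upper)
  show "ip d v u \<in> {ip d v u |v. v \<in> vsp d \<and> N v = 1}" using assms by blast
  have "compact {x \<in> vsp d. N x \<le> 1}" by (rule compact_subball[OF closed_vsp]) simp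
  moreover have "continuous_on {x \<in> vsp d. N x \<le> 1} (\<lambda>v. ip d v u)"
    by (intro continuous_on_ip continuous_on_id continuous_on_const)
  ultimately have "compact ((\<lambda>v. ip d v u) ` {x \<in> vsp d. N x \<le> 1})"
    by (rule compact_continuous_image[rotated])
  then have "bdd_above ((\<lambda>v. ip d v u) ` {x \<in> vsp d. N x \<le> 1})"
    by (intro bounded_imp_bdd_above compact_imp_bounded)
  then show "bdd_above {ip d v u |v. v \<in> vsp d \<and> N v = 1}"
    by (rule bdd_above_mono) auto
qed

end

text \<open>Through \<open>v\<close> the selection \<open>vs\<close> of minimisers provides a
  supporting functional of the dual norm at each Gaussian point; measurability of the dual norm is
  derived from continuity.\<close>

locale dual_norm_field = finite_norm +
  fixes A :: matr and vs :: "vect \<Rightarrow> vect"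
  assumes A: "psd d A" and A_nonzero: "A \<noteq> (\<lambda>i j. 0)"
    and vs: "\<And>h. h \<in> vsp d \<Longrightarrow> is_vstar d N A h (vs h)"
begin

definition f :: "vect \<Rightarrow> real" where
  "f x = dnorm d N (matvec d d (msqrt d A) (gvec d x))"

definition L :: real where
  "L = Sup {anorm d A w | w. w \<in> vsp d \<and> N w \<le> 1}"

definition v :: "vect \<Rightarrow> vect" where
  "v x = vs (gvec d x)"

lemma Edual_eq: "Edual d N A = (\<integral>x. f x \<partial>gaussfield)"
  by (simp add: Edual_def f_def)

lemma v_props: "v x \<in> vsp d" "N (v x) = 1" "ip d (v x) (matvec d d (msqrt d A) (gvec d x)) = f x"
  using vs[OF gvec_vsp] by (auto simp: v_def f_def is_vstar_def subdual_def)

lemma anorm_le_L: assumes "w \<in> vsp d" "N w \<le> 1" shows "anorm d A w \<le> L"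
  unfolding L_def
proof (rule cSup_upper)
  show "anorm d A w \<in> {anorm d A w |w. w \<in> vsp d \<and> N w \<le> 1}" using assms by blast
  have "compact {x \<in> vsp d. N x \<le> 1}" by (rule compact_subball[OF closed_vsp]) simp
  moreover have "continuous_on {x \<in> vsp d. N x \<le> 1} (anorm d A)"
    unfolding anorm_def[abs_def]
    by (intro continuous_on_real_sqrt continuous_on_ip continuous_on_matvec continuous_on_id)
  ultimately have "compact (anorm d A ` {x \<in> vsp d. N x \<le> 1})"
    by (rule compact_continuous_image[rotated])
  then have "bdd_above (anorm d A ` {x \<in> vsp d. N x \<le> 1})"
    by (intro bounded_imp_bdd_above compact_imp_bounded)
  then show "bdd_above {anorm d A w |w. w \<in> vsp d \<and> N w \<le> 1}"
    by (rule bdd_above_mono) auto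
qed

lemma exists_direction: "\<exists>w\<in>vsp d. N w = 1 \<and> 0 < anorm d A w"
proof -
  have "\<exists>x\<in>vsp d. matvec d d A x \<noteq> (\<lambda>_. 0)"
  proof (rule ccontr)
    assume no: "\<not> ?thesis"
    have "A = (\<lambda>i j. 0)"
    proof (rule sq_mat_eqI[of d])
      show "sq_mat d A" using A by (simp add: psd_def)
      show "sq_mat d (\<lambda>i j. 0)" by (simp add: sq_mat_def)
      fix x assume "x \<in> vsp d"
      with no have "matvec d d A x = (\<lambda>_. 0)" by blast
      also have "\<dots> = matvec d d (\<lambda>i j. 0) x" by (auto simp: matvec_def fun_eq_iff)
      finally show "matvec d d A x = matvec d d (\<lambda>i j. 0) x" .
    qed
    with A_nonzero show False by blast
  qed
  then obtain x where x: "x \<in> vsp d" "matvec d d A x \<noteq> (\<lambda>_. 0)" by blast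
  then have "ip d x (matvec d d A x) \<noteq> 0" using psd_form_zero[OF A x(1)] by blast
  then have q: "0 < ip d x (matvec d d A x)" using psd_nonneg[OF A x(1)] by simp
  have "x \<noteq> (\<lambda>_. 0)" using x(2) by auto
  then have Nx: "0 < N x" using N_nonneg[OF x(1)] N_zero_iff[OF x(1)] by simp
  let ?w = "\<lambda>i. (1 / N x) * x i"
  have "N ?w = 1" using Nx by (simp only: N_scale[OF x(1)]) simp
  moreover have "0 < anorm d A ?w"
    unfolding anorm_def matvec_scale ip_scale_left ip_scale_right using q Nx by simp
  ultimately show ?thesis using vsp_scale[OF x(1)] by blast
qed

lemma L_pos: "0 < L"
proof -
  obtain w where "w \<in> vsp d" "N w = 1" "0 < anorm d A w" using exists_direction by blast
  then show ?thesis using anorm_le_L[of w] by simp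
qed

lemma form_msqrt_gvec: "ip d w (matvec d d (msqrt d A) (gvec d x)) = (\<Sum>i<d. matvec d d (msqrt d A) w i * x i)"
  unfolding psd_sym[OF psd_msqrt[OF A]] by (rule ip_gvec)

lemma linear_le_f:
  assumes "w \<in> vsp d" "N w = 1"
  shows "(\<Sum>i<d. matvec d d (msqrt d A) w i * x i) \<le> f x"
  using dnorm_upper[OF assms] by (simp add: f_def form_msqrt_gvec[symmetric])

lemma f_eq: "f x = (\<Sum>i<d. matvec d d (msqrt d A) (v x) i * x i)"
  unfolding form_msqrt_gvec[symmetric] by (rule v_props(3)[symmetric])

lemma sum_squares_anorm: "(\<Sum>i<d. (matvec d d (msqrt d A) w i)\<^sup>2) = (anorm d A w)\<^sup>2"
  using ip_nonneg[of d "matvec d d (msqrt d A) w"] by (simp add: anorm_eq[OF A] ip_def power2_eq_square)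

lemma anorm_nonneg: "0 \<le> anorm d A w"
  unfolding anorm_eq[OF A] by simp

lemma sum_squares_le_L:
  assumes "w \<in> vsp d" "N w = 1"
  shows "(\<Sum>i<d. (matvec d d (msqrt d A) w i)\<^sup>2) \<le> L\<^sup>2"
  unfolding sum_squares_anorm using anorm_le_L[of w] anorm_nonneg assms by (intro power_mono) auto

lemma coordinate_le_L:
  assumes "w \<in> vsp d" "N w = 1" "i < d"
  shows "\<bar>matvec d d (msqrt d A) w i\<bar> \<le> L"
proof -
  have "(matvec d d (msqrt d A) w i)\<^sup>2 \<le> (\<Sum>i<d. (matvec d d (msqrt d A) w i)\<^sup>2)"
    using assms(3) by (intro member_le_sum) auto
  also have "\<dots> \<le> L\<^sup>2" by (rule sum_squares_le_L[OF assms(1,2)])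
  finally show ?thesis using L_pos abs_le_square_iff[of "matvec d d (msqrt d A) w i" L] by simp
qed

lemma continuous_f: "continuous_on UNIV f"
proof (rule continuous_on_coordinate_lipschitz)
  have 1: "f x - f y \<le> (\<Sum>i<d. L * \<bar>x i - y i\<bar>)" for x y
  proof -
    let ?u = "matvec d d (msqrt d A) (v x)"
    have "f x - f y \<le> (\<Sum>i<d. ?u i * x i) - (\<Sum>i<d. ?u i * y i)"
      using linear_le_f[OF v_props(1,2)] by (simp add: f_eq[of x])
    also have "\<dots> = (\<Sum>i<d. ?u i * (x i - y i))"
      by (simp add: right_diff_distrib sum_subtractf)
    also have "\<dots> \<le> (\<Sum>i<d. L * \<bar>x i - y i\<bar>)"
    proof (rule sum_mono)
      fix i assume "i \<in> {..<d}"
      then have "\<bar>?u i\<bar> \<le> L" using coordinate_le_L[OF v_props(1,2)] by simp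
      then have "\<bar>?u i * (x i - y i)\<bar> \<le> L * \<bar>x i - y i\<bar>"
        unfolding abs_mult by (rule mult_right_mono) simp
      then show "?u i * (x i - y i) \<le> L * \<bar>x i - y i\<bar>" by linarith
    qed
    finally show ?thesis .
  qed
  show "\<bar>f x - f y\<bar> \<le> (\<Sum>i<d. L * \<bar>x i - y i\<bar>)" for x y
    using 1[of x y] 1[of y x] by (simp add: abs_le_iff abs_minus_commute)
qed

text \<open>The supporting functional at \<open>x\<close> is the root of \<open>A\<close> applied to
  \<open>v x\<close>, and its Euclidean length is the \<open>A\<close>-norm of a vector in the unit
  ball of \<open>N\<close>. The deviation scale \<open>L\<close> is thus the denominator in
  \<open>rk_small\<close>.\<close>

sublocale sublinear_functional "{..<d}" L f
proof
  show "finite {..<d}" by simp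
  show "0 \<le> L" using L_pos by simp
  show "f \<in> borel_measurable gaussfield" by (rule measurable_gaussfield_continuous[OF continuous_f])
  fix x
  show "\<exists>u. (\<Sum>i<d. (u i)\<^sup>2) \<le> L\<^sup>2 \<and> f x = (\<Sum>i<d. u i * x i) \<and> (\<forall>y. (\<Sum>i<d. u i * y i) \<le> f y)"
    by (rule exI[of _ "matvec d d (msqrt d A) (v x)"])
       (intro conjI allI sum_squares_le_L v_props f_eq linear_le_f)
qed

text \<open>By symmetry of \<open>N\<close>, \<open>f\<close> dominates the absolute value of the
  linear form of a unit vector \<open>w\<close>. If the mean of that absolute value were 0, so would
  be the variance \<open>(anorm d A w)\<^sup>2\<close>, against the choice of
  \<open>w\<close>.\<close>

lemma Edual_pos: "0 < Edual d N A"
proof -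
  obtain w where w: "w \<in> vsp d" "N w = 1" "0 < anorm d A w" using exists_direction by blast
  let ?u = "matvec d d (msqrt d A) w"
  let ?l = "\<lambda>x. \<Sum>i<d. ?u i * x i"
  have w': "(\<lambda>i. - 1 * w i) \<in> vsp d" by (rule vsp_scale[OF w(1)])
  have w'': "N (\<lambda>i. - 1 * w i) = 1" by (simp add: N_scale[OF w(1), of "- 1", simplified] w(2))
  have abs: "\<bar>?l x\<bar> \<le> f x" for x
  proof -
    have "(\<Sum>i<d. matvec d d (msqrt d A) (\<lambda>i. - 1 * w i) i * x i) = - ?l x"
      unfolding matvec_scale by (simp add: sum_negf)
    then have "- ?l x \<le> f x" using linear_le_f[OF w' w'', of x] by simp
    then show ?thesis using linear_le_f[OF w(1,2), of x] by simp
  qed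
  have int: "integrable gaussfield (\<lambda>x. \<bar>?l x\<bar>)"
  proof (rule Bochner_Integration.integrable_bound[OF integrable_f])
    show "(\<lambda>x. \<bar>?l x\<bar>) \<in> borel_measurable gaussfield" by measurable
    show "AE x in gaussfield. norm \<bar>?l x\<bar> \<le> norm (f x)"
      by (rule AE_I2) (use order_trans[OF abs abs_ge_self] in simp)
  qed
  have "(\<integral>x. \<bar>?l x\<bar> \<partial>gaussfield) \<noteq> 0"
  proof
    assume "(\<integral>x. \<bar>?l x\<bar> \<partial>gaussfield) = 0"
    then have ae: "AE x in gaussfield. \<bar>?l x\<bar> = 0"
      using integral_nonneg_eq_0_iff_AE[OF int] by simp
    have "(\<integral>x. ?l x * ?l x \<partial>gaussfield) = 0"
    proof (rule integral_eq_zero_AE)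
      show "AE x in gaussfield. ?l x * ?l x = 0" using ae by eventually_elim simp
    qed
    moreover have "(\<integral>x. ?l x * ?l x \<partial>gaussfield) = (\<Sum>i<d. ?u i * ?u i)"
      by (rule gaussfield_covariance(2)) simp
    moreover have "(\<Sum>i<d. ?u i * ?u i) = (anorm d A w)\<^sup>2"
      unfolding sum_squares_anorm[symmetric] by (simp add: power2_eq_square)
    ultimately show False using w(3) by simp
  qed
  moreover have "0 \<le> (\<integral>x. \<bar>?l x\<bar> \<partial>gaussfield)" by (rule integral_nonneg_AE) simp
  moreover have "(\<integral>x. \<bar>?l x\<bar> \<partial>gaussfield) \<le> (\<integral>x. f x \<partial>gaussfield)"
    by (rule integral_mono[OF int integrable_f abs])
  ultimately show ?thesis unfolding Edual_eq by linarith
qed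

end

section \<open>Concentration of the Euclidean norm of a Gaussian vector\<close>

definition enorm :: "nat \<Rightarrow> vect \<Rightarrow> real" where
  "enorm n x = sqrt (\<Sum>i<n. (x i)\<^sup>2)"

lemma enorm_nonneg [simp]: "0 \<le> enorm n x"
  by (simp add: enorm_def sum_nonneg)

lemma sum_mult_le_enorm: "(\<Sum>i<n. x i * y i) \<le> enorm n x * enorm n y"
  by (rule sum_mult_le_cone) (simp_all add: enorm_def sum_nonneg)

lemma enorm_scale: "enorm n (\<lambda>i. c * x i) = \<bar>c\<bar> * enorm n x"
  by (simp add: enorm_def power_mult_distrib sum_distrib_left[symmetric] real_sqrt_mult)

lemma sublinear_enorm: "sublinear_functional {..<n} 1 (enorm n)"
proof
  show "enorm n \<in> borel_measurable gaussfield"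
    unfolding enorm_def[abs_def] by measurable
  fix x
  show "\<exists>u. (\<Sum>i<n. (u i)\<^sup>2) \<le> 1\<^sup>2 \<and> enorm n x = (\<Sum>i<n. u i * x i) \<and> (\<forall>y. (\<Sum>i<n. u i * y i) \<le> enorm n y)"
  proof (cases "enorm n x = 0")
    case True
    then show ?thesis by (intro exI[of _ "\<lambda>_. 0"]) simp
  next
    case False
    define r where "r = enorm n x"
    have r: "r \<noteq> 0" "0 \<le> r" using False by (simp_all add: r_def)
    have rr: "(\<Sum>i<n. (x i)\<^sup>2) = r * r" by (simp add: r_def enorm_def sum_nonneg)
    let ?u = "\<lambda>i. x i / r"
    have u2: "(\<Sum>i<n. (?u i)\<^sup>2) = 1"
      unfolding power_divide sum_divide_distrib[symmetric] rr using r by (simp add: power2_eq_square)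
    have "(\<Sum>i<n. ?u i * x i) = (\<Sum>i<n. (x i)\<^sup>2) / r"
      by (simp add: sum_divide_distrib power2_eq_square)
    also have "\<dots> = r" unfolding rr using r by simp
    finally have "enorm n x = (\<Sum>i<n. ?u i * x i)" by (simp add: r_def)
    moreover have "(\<Sum>i<n. ?u i * y i) \<le> enorm n y" for y
      using sum_mult_le_enorm[where n=n and x="?u" and y=y] u2 by (simp add: enorm_def)
    ultimately show ?thesis using u2 by (intro exI[of _ ?u]) simp
  qed
qed auto

text \<open>Integrates \<open>2 * r * s \<le> r\<^sup>2 + s\<^sup>2\<close> with
  \<open>s = sqrt (real n)\<close>, where the second moment of \<open>r\<close> is known
  exactly.\<close>

lemma expectation_enorm_le:
  assumes n: "0 < n"
  shows "(\<integral>x. enorm n x \<partial>gaussfield) \<le> sqrt (real n)"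
proof -
  interpret E: sublinear_functional "{..<n}" 1 "enorm n" by (rule sublinear_enorm)
  let ?s = "sqrt (real n)"
  have s: "0 < ?s" using n by simp
  have sq: "integrable gaussfield (\<lambda>x. (\<Sum>i<n. (x i)\<^sup>2))"
    by (intro Bochner_Integration.integrable_sum)
       (use gaussfield_second_moments(1) in \<open>simp add: power2_eq_square\<close>)
  have "(\<integral>x. enorm n x \<partial>gaussfield) \<le> (\<integral>x. (\<Sum>i<n. (x i)\<^sup>2) / (2 * ?s) + ?s / 2 \<partial>gaussfield)"
  proof (rule integral_mono[OF E.integrable_f])
    show "integrable gaussfield (\<lambda>x. (\<Sum>i<n. (x i)\<^sup>2) / (2 * ?s) + ?s / 2)"
      using sq by simp
    fix x :: vect
    let ?r = "enorm n x"
    have rr: "(\<Sum>i<n. (x i)\<^sup>2) = ?r\<^sup>2" by (simp add: enorm_def sum_nonneg)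
    have "0 \<le> (?r - ?s)\<^sup>2" by simp
    then have "2 * ?r * ?s \<le> ?r\<^sup>2 + ?s\<^sup>2" by (simp add: power2_diff)
    then show "?r \<le> (\<Sum>i<n. (x i)\<^sup>2) / (2 * ?s) + ?s / 2"
      unfolding rr using s by (simp add: field_simps power2_eq_square)
  qed
  also have "\<dots> = (\<integral>x. (\<Sum>i<n. (x i)\<^sup>2) \<partial>gaussfield) / (2 * ?s) + ?s / 2"
    using sq by (simp add: gaussfield.prob_space[simplified])
  also have "(\<integral>x. (\<Sum>i<n. (x i)\<^sup>2) \<partial>gaussfield) = real n"
    unfolding power2_eq_square
    by (subst Bochner_Integration.integral_sum) (simp_all add: gaussfield_second_moments)
  also have "real n / (2 * ?s) + ?s / 2 = ?s" using s by (simp add: real_div_sqrt field_simps)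
  finally show ?thesis .
qed

lemma enorm_upper_tail:
  assumes n: "0 < n" and l: "0 \<le> l"
  shows "measure gaussfield {x. sqrt (real n) + 4 * sqrt l \<le> enorm n x} \<le> exp (- (3 * l))"
proof -
  interpret E: sublinear_functional "{..<n}" 1 "enorm n" by (rule sublinear_enorm)
  have "measure gaussfield {x. sqrt (real n) + 4 * sqrt l \<le> enorm n x}
      \<le> measure gaussfield {x. (\<integral>x. enorm n x \<partial>gaussfield) + 4 * sqrt l * 1 \<le> enorm n x}"
  proof (rule gaussfield.finite_measure_mono)
    show "{x. sqrt (real n) + 4 * sqrt l \<le> enorm n x} \<subseteq> {x. (\<integral>x. enorm n x \<partial>gaussfield) + 4 * sqrt l * 1 \<le> enorm n x}"
      using expectation_enorm_le[OF n] by auto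
    show "{x. (\<integral>x. enorm n x \<partial>gaussfield) + 4 * sqrt l * 1 \<le> enorm n x} \<in> gaussfield.events"
      using E.sets_f_ge[of _ 1] by simp
  qed
  also have "\<dots> \<le> exp (- (3 * l))" by (rule E.upper_tail) (use l in simp_all)
  finally show ?thesis .
qed

text \<open>The column space is the set of fixed points of the orthogonal projection written in
  eigenvectors, hence cut out by continuous equations.\<close>

lemma closed_colsp:
  assumes "psd d A"
  shows "closed (colsp d A)" and "colsp d A \<subseteq> vsp d"
proof -
  obtain m v \<mu> where ov: "orthonormal d m v" and \<mu>: "\<And>k. k < m \<Longrightarrow> 0 < \<mu> k"
    and A_eq: "A = (\<lambda>i j. \<Sum>k<m. \<mu> k * v k i * v k j)"
    by (rule spectral_decomposition[OF assms], rule that)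
  have v: "\<forall>k<m. v k \<in> vsp d" using ov by (simp add: orthonormal_def)
  have Az: "matvec d d A z = (\<lambda>i. \<Sum>k<m. (\<mu> k * ip d (v k) z) * v k i)" for z
    unfolding A_eq by (rule matvec_spectral[OF v])
  let ?P = "\<lambda>x i. \<Sum>k<m. ip d (v k) x * v k i"
  have P: "?P (matvec d d A z) = matvec d d A z" for z
    unfolding Az by (intro ext sum.cong refl) (simp add: orthonormal_ip[OF ov])
  have "colsp d A = vsp d \<inter> (\<Inter>i. {x. x i = ?P x i})"
  proof (intro equalityI subsetI)
    fix x assume "x \<in> colsp d A"
    then obtain z where z: "x = matvec d d A z" by (auto simp: colsp_def)
    show "x \<in> vsp d \<inter> (\<Inter>i. {x. x i = ?P x i})"
      unfolding z using P[of z] by (simp add: fun_eq_iff)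
  next
    fix x assume x: "x \<in> vsp d \<inter> (\<Inter>i. {x. x i = ?P x i})"
    let ?z = "\<lambda>i. \<Sum>k<m. (ip d (v k) x / \<mu> k) * v k i"
    have "matvec d d A ?z = ?P x"
      unfolding Az
    proof (intro ext sum.cong refl)
      fix i k assume "k \<in> {..<m}"
      then have k: "k < m" by simp
      show "\<mu> k * ip d (v k) ?z * v k i = ip d (v k) x * v k i"
        unfolding orthonormal_ip[OF ov k] using \<mu>[OF k] by simp
    qed
    also have "?P x = x" using x by (simp add: fun_eq_iff)
    finally have "x = matvec d d A ?z" ..
    moreover have "?z \<in> vsp d" by (rule vsp_sum) (use v in auto)
    ultimately show "x \<in> colsp d A" unfolding colsp_def by (rule image_eqI[where f="matvec d d A"])
  qed
  moreover have "closed {x. x i = ?P x i}" for i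
    by (intro closed_Collect_eq continuous_on_coordinate continuous_on_sum continuous_on_mult continuous_on_const
        continuous_on_ip continuous_on_id)
  ultimately show "closed (colsp d A)"
    by (simp only:) (intro closed_Int closed_vsp closed_INT, blast)
  show "colsp d A \<subseteq> vsp d" by (auto simp: colsp_def)
qed

text \<open>Supplies the countable families for the comparison; the constraints are continuous in
  the point and in the direction, so a dense sequence of either is enough.\<close>

lemma dense_sequence:
  fixes S :: "vect set"
  assumes "S \<noteq> {}"
  obtains q :: "nat \<Rightarrow> vect" where "\<And>i. q i \<in> S" "S \<subseteq> closure (range q)"
proof -
  obtain T where T: "countable T" "T \<subseteq> S" "S \<subseteq> closure T" using separable by blast
  have ne: "T \<noteq> {}" using T(3) assms by auto
  have range: "range (from_nat_into T) = T" by (rule range_from_nat_into[OF ne T(1)])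
  show thesis
  proof (rule that)
    show "from_nat_into T i \<in> S" for i using T(2) from_nat_into[OF ne] by blast
    show "S \<subseteq> closure (range (from_nat_into T))" unfolding range by (rule T(3))
  qed
qed

section \<open>Interpolation\<close>

lemma colsp_combination:
  assumes "x \<in> colsp d A" "y \<in> colsp d A"
  shows "(\<lambda>i. a * x i + b * y i) \<in> colsp d A"
proof -
  obtain p q where pq: "p \<in> vsp d" "x = matvec d d A p" "q \<in> vsp d" "y = matvec d d A q"
    using assms by (auto simp: colsp_def)
  have "(\<lambda>i. a * x i + b * y i) = matvec d d A (\<lambda>i. a * p i + b * q i)"
    unfolding pq matvec_add matvec_scale ..
  then show ?thesis
    unfolding colsp_def by (rule image_eqI[where f="matvec d d A"]) (intro vsp_add vsp_scale pq)
qed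

text \<open>The first-order condition at a minimum over a segment. For \<open>0 < c\<close> the
  chosen \<open>s\<close> satisfies \<open>s * B \<le> c\<close>, so the linear term would outweigh
  the quadratic one.\<close>

lemma quadratic_nonneg_imp:
  fixes c B :: real
  assumes B: "0 \<le> B" and nn: "\<And>s. 0 \<le> s \<Longrightarrow> s \<le> 1 \<Longrightarrow> 0 \<le> s\<^sup>2 * B - 2 * s * c"
  shows "c \<le> 0"
proof (rule ccontr)
  assume "\<not> c \<le> 0"
  then have c: "0 < c" by simp
  define s where "s = c / (B + c)"
  have s: "0 < s" "s \<le> 1" using c B by (simp_all add: s_def)
  have sB: "s * (B + c) = c" using c B by (simp add: s_def)
  have sc: "0 < s * c" using s c by simp
  then have "s * B \<le> c" using sB by (simp add: distrib_left)
  then have "s * (s * B) \<le> s * c" using s by (intro mult_left_mono) auto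
  moreover have "0 \<le> s\<^sup>2 * B - 2 * s * c" using s by (intro nn) auto
  ultimately show False using sc by (simp add: power2_eq_square)
qed

context finite_norm
begin

lemma ball_convex:
  assumes A: "psd d A" and x: "x \<in> colsp d A" "N x \<le> \<rho>" and y: "y \<in> colsp d A" "N y \<le> \<rho>" and s: "0 \<le> s" "s \<le> 1"
  shows "(\<lambda>i. (1 - s) * x i + s * y i) \<in> colsp d A" and "N (\<lambda>i. (1 - s) * x i + s * y i) \<le> \<rho>"
proof -
  have xy: "x \<in> vsp d" "y \<in> vsp d" using x y closed_colsp(2)[OF A] by auto
  show "(\<lambda>i. (1 - s) * x i + s * y i) \<in> colsp d A" by (rule colsp_combination[OF x(1) y(1)])
  have "N (\<lambda>i. (1 - s) * x i + s * y i) \<le> N (\<lambda>i. (1 - s) * x i) + N (\<lambda>i. s * y i)"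
    by (rule N_triangle[OF vsp_scale[OF xy(1)] vsp_scale[OF xy(2)]])
  also have "\<dots> = (1 - s) * N x + s * N y"
    unfolding N_scale[OF xy(1)] N_scale[OF xy(2)] using s by simp
  also have "\<dots> \<le> (1 - s) * \<rho> + s * \<rho>"
    using x y s by (intro add_mono mult_left_mono) auto
  also have "\<dots> = \<rho>" by (simp add: algebra_simps)
  finally show "N (\<lambda>i. (1 - s) * x i + s * y i) \<le> \<rho>" .
qed

text \<open>If no point of the compact convex set is mapped to the target, the point of the image nearest to
  the target gives a separating direction, which may be perturbed into a dense sequence of directions.\<close>

lemma interpolating_point:
  fixes Z R :: matr and y :: vect and lam q :: "nat \<Rightarrow> vect"
  assumes A: "psd d A" and \<rho>: "0 \<le> \<rho>"
    and dense: "{x \<in> vsp n. ip n x x = 1} \<subseteq> closure (range lam)"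
    and q: "\<And>v. q v \<in> colsp d A" "\<And>v. N (q v) \<le> \<rho>"
    and sep: "\<And>i. \<exists>v. ip n (lam i) y < ip n (lam i) (matvec n d Z (matvec d d R (q v)))"
  shows "\<exists>p\<in>colsp d A. N p \<le> \<rho> \<and> (\<forall>r<n. matvec n d Z (matvec d d R p) r = y r)"
proof -
  let ?K = "{p \<in> colsp d A. N p \<le> \<rho>}"
  let ?\<Phi> = "\<lambda>p. matvec n d Z (matvec d d R p)"
  let ?a = "\<lambda>p r. y r - ?\<Phi> p r"
  let ?D = "\<lambda>p. ip n (?a p) (?a p)"
  have comp: "compact ?K" by (rule compact_subball[OF closed_colsp[OF A]])
  have "q 0 \<in> ?K" using q by simp
  then have ne: "?K \<noteq> {}" by blast
  have "continuous_on ?K ?\<Phi>"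
    by (intro continuous_on_matvec continuous_on_id)
  then have "continuous_on ?K (\<lambda>p. ?\<Phi> p r)" for r
    by (rule continuous_on_product_then_coordinatewise)
  then have "continuous_on ?K ?a"
    by (intro continuous_on_coordinatewise_then_product continuous_on_diff continuous_on_const)
  then have cont: "continuous_on ?K ?D" by (intro continuous_on_ip)
  from continuous_attains_inf[OF comp ne cont]
  obtain p0 where p0: "p0 \<in> ?K" and min: "\<And>p. p \<in> ?K \<Longrightarrow> ?D p0 \<le> ?D p" by blast
  from continuous_attains_sup[OF comp ne cont]
  obtain p1 where max: "\<And>p. p \<in> ?K \<Longrightarrow> ?D p \<le> ?D p1" by blast
  define a where "a = ?a p0"
  \<comment> \<open>At the nearest point the residual \<open>a\<close> makes a nonacute angle with
    every displacement inside the image; the segment from \<open>p0\<close> to \<open>p\<close> is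
    admissible by convexity.\<close>
  have variation: "ip n a (\<lambda>r. ?\<Phi> p r - ?\<Phi> p0 r) \<le> 0" if p: "p \<in> ?K" for p
  proof (rule quadratic_nonneg_imp)
    let ?b = "\<lambda>r. ?\<Phi> p r - ?\<Phi> p0 r"
    show "0 \<le> ip n ?b ?b" by (rule ip_nonneg)
    fix s :: real assume s: "0 \<le> s" "s \<le> 1"
    let ?p = "\<lambda>i. (1 - s) * p0 i + s * p i"
    have "?p \<in> ?K" using ball_convex[OF A, of p0 \<rho> p s] p0 p s by simp
    then have "?D p0 \<le> ?D ?p" by (rule min)
    also have "?a ?p = (\<lambda>r. a r - s * ?b r)"
      unfolding matvec_add matvec_scale a_def by (simp add: fun_eq_iff algebra_simps)
    also have "ip n (\<lambda>r. a r - s * ?b r) (\<lambda>r. a r - s * ?b r) = ip n a a - 2 * s * ip n a ?b + s\<^sup>2 * ip n ?b ?b"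
      unfolding ip_diff_left[of n a] ip_diff_right[of n _ a] ip_scale_left ip_scale_right ip_commute[of n ?b a]
      by (simp add: power2_eq_square algebra_simps)
    finally show "0 \<le> s\<^sup>2 * ip n ?b ?b - 2 * s * ip n a ?b" by (simp add: a_def)
  qed
  have "ip n a a = 0"
  proof (rule ccontr)
    assume "ip n a a \<noteq> 0"
    then have aa: "0 < ip n a a" by (simp add: less_le)
    define r0 where "r0 = sqrt (ip n a a)"
    have r0: "0 < r0" "r0 * r0 = ip n a a" using aa by (simp_all add: r0_def)
    define l where "l = (\<lambda>r. if r < n then 1 / r0 * a r else 0)"
    have ip_l: "ip n l x = 1 / r0 * ip n a x" for x
      unfolding ip_scale_left[symmetric] by (simp add: ip_def l_def)
    have "ip n l l = 1"
      unfolding ip_l ip_commute[of n a l] unfolding ip_l r0(2)[symmetric] using r0(1) by simp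
    then have l: "l \<in> {x \<in> vsp n. ip n x x = 1}" by (auto simp: l_def vsp_def)
    \<comment> \<open>The separation holds with margin \<open>r0\<close>, the distance from the
      target to the image, which leaves room for perturbing \<open>l\<close>.\<close>
    have gap: "r0 \<le> ip n l (?a p)" if p: "p \<in> ?K" for p
    proof -
      have "?a p = (\<lambda>r. a r - (?\<Phi> p r - ?\<Phi> p0 r))" by (simp add: a_def)
      then have "ip n a (?a p) = ip n a a - ip n a (\<lambda>r. ?\<Phi> p r - ?\<Phi> p0 r)"
        by (simp only: ip_diff_right[of n a a])
      then have "ip n a a \<le> ip n a (?a p)" using variation[OF p] by simp
      then have "1 / r0 * (r0 * r0) \<le> 1 / r0 * ip n a (?a p)"
        unfolding r0(2) using r0(1) by (intro mult_left_mono) auto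
      then show ?thesis unfolding ip_l using r0(1) by simp
    qed
    \<comment> \<open>Bounds the residual coordinates over the whole compact set, so that the
      neighbourhood \<open>?O\<close> of \<open>l\<close> can be fixed before the point
      \<open>q v\<close> is known.\<close>
    define M where "M = 1 + ?D p1"
    have bound: "\<bar>?a p r\<bar> \<le> M" if p: "p \<in> ?K" and r: "r < n" for p r
    proof -
      have "(?a p r)\<^sup>2 \<le> ?D p"
        unfolding ip_def power2_eq_square using r by (intro member_le_sum) auto
      also have "\<dots> \<le> ?D p1" by (rule max[OF p])
      finally have sq: "(?a p r)\<^sup>2 \<le> ?D p1" .
      have ab: "\<bar>x\<bar> \<le> 1 + x\<^sup>2" for x :: real
      proof -
        have "0 \<le> (\<bar>x\<bar> - 1)\<^sup>2" "0 \<le> \<bar>x\<bar>" by simp_all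
        then show ?thesis by (simp add: power2_diff)
      qed
      show ?thesis unfolding M_def using sq ab[of "?a p r"] by linarith
    qed
    let ?O = "{x. (\<Sum>r<n. \<bar>l r - x r\<bar> * M) < r0}"
    have "open ?O"
      by (intro open_Collect_less continuous_on_sum continuous_on_mult continuous_on_rabs continuous_on_diff
          continuous_on_const continuous_on_coordinate)
    moreover have "l \<in> ?O" using r0(1) by simp
    moreover have "l \<in> closure (range lam)" using l dense by blast
    ultimately have "?O \<inter> range lam \<noteq> {}"
      using open_Int_closure_eq_empty[of ?O "range lam"] by blast
    then obtain i where i: "(\<Sum>r<n. \<bar>l r - lam i r\<bar> * M) < r0" by blast
    obtain v where v: "ip n (lam i) y < ip n (lam i) (?\<Phi> (q v))" using sep by blast
    have qv: "q v \<in> ?K" using q by simp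
    have "ip n (\<lambda>r. l r - lam i r) (?a (q v)) \<le> (\<Sum>r<n. \<bar>l r - lam i r\<bar> * M)"
      unfolding ip_def
    proof (rule sum_mono)
      fix r assume "r \<in> {..<n}"
      then have "\<bar>?a (q v) r\<bar> \<le> M" using bound[OF qv] by simp
      then have "\<bar>(l r - lam i r) * ?a (q v) r\<bar> \<le> \<bar>l r - lam i r\<bar> * M"
        unfolding abs_mult by (rule mult_left_mono) simp
      then show "(l r - lam i r) * ?a (q v) r \<le> \<bar>l r - lam i r\<bar> * M" by linarith
    qed
    then have "ip n l (?a (q v)) - ip n (lam i) (?a (q v)) < r0"
      using i unfolding ip_diff_left[of n l] by linarith
    then have "0 < ip n (lam i) (?a (q v))" using gap[OF qv] by linarith
    then show False using v unfolding ip_diff_right[of n _ y] by linarith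
  qed
  then have "(\<Sum>r<n. (a r)\<^sup>2) = 0" by (simp add: ip_def power2_eq_square)
  then have "\<forall>r<n. a r = 0" by (subst (asm) sum_nonneg_eq_0_iff) auto
  then show ?thesis using p0 unfolding a_def by (intro bexI[of _ p0]) auto
qed

end

section \<open>The design matrix acting on trial points\<close>

lemma cov_split_psd:
  assumes "cov_split d S S1 S2"
  shows "psd d S"
proof -
  have S: "S = (\<lambda>i j. S1 i j + S2 i j)" and 1: "psd d S1" and 2: "psd d S2"
    using assms by (simp_all add: cov_split_def)
  have Sx: "matvec d d S x = (\<lambda>i. matvec d d S1 x i + matvec d d S2 x i)" for x
    unfolding S by (auto simp: matvec_def fun_eq_iff distrib_right sum.distrib)
  show ?thesis
    unfolding psd_def
  proof (intro conjI ballI)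
    show "sq_mat d S" using 1 2 by (simp add: S psd_def sq_mat_def)
    show "\<forall>i<d. \<forall>j<d. S i j = S j i" using 1 2 by (simp add: S psd_def)
    fix x assume "x \<in> vsp d"
    then show "0 \<le> ip d x (matvec d d S x)"
      unfolding Sx ip_add_right using 1 2 by (intro add_nonneg_nonneg psd_nonneg)
  qed
qed

lemma dataX_apply:
  assumes S: "psd d S" and i: "i < n"
  shows "matvec n d (dataX n d S \<omega>) w i = (\<Sum>k<d. \<omega> (Inl (i, k)) * matvec d d (msqrt d S) w k)"
proof -
  let ?R = "msqrt d S"
  have sym: "?R j k = ?R k j" if "j < d" "k < d" for j k
    using psd_msqrt[OF S] that by (simp add: psd_def)
  have "matvec n d (dataX n d S \<omega>) w i = (\<Sum>j<d. \<Sum>k<d. ?R j k * \<omega> (Inl (i, k)) * w j)"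
    using i by (simp add: matvec_def dataX_def sum_distrib_right)
  also have "\<dots> = (\<Sum>k<d. \<Sum>j<d. ?R j k * \<omega> (Inl (i, k)) * w j)" by (rule sum.swap)
  also have "\<dots> = (\<Sum>k<d. \<Sum>j<d. \<omega> (Inl (i, k)) * (?R k j * w j))"
    by (intro sum.cong refl) (simp add: sym)
  also have "\<dots> = (\<Sum>k<d. \<omega> (Inl (i, k)) * matvec d d ?R w k)"
    by (simp add: matvec_def sum_distrib_left)
  finally show ?thesis .
qed

context finite_norm
begin

lemma min_interp_bound:
  assumes split: "cov_split d S S1 S2" and w0: "wstar \<in> vsp d" and \<sigma>: "0 \<le> \<sigma>" and \<kappa>: "0 < \<kappa>"
    and q: "q \<in> colsp d S2" "N q \<le> \<rho>"
    and eq: "\<And>r. r < n \<Longrightarrow> (\<Sum>j<d. \<omega> (Inl (r, j)) * matvec d d (msqrt d S2) q j) = \<kappa> * \<omega> (Inr r)"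
    and w: "w \<in> min_interp n d N (dataX n d S \<omega>) (dataY n d S wstar \<sigma> \<omega>)"
  shows "N w \<le> N wstar + \<sigma> / \<kappa> * \<rho>"
proof -
  have S: "psd d S" by (rule cov_split_psd[OF split])
  have qv: "q \<in> vsp d" using q(1) by (auto simp: colsp_def)
  let ?w = "\<lambda>i. wstar i + \<sigma> / \<kappa> * q i"
  have wv: "?w \<in> vsp d" by (rule vsp_add[OF w0 vsp_scale[OF qv]])
  have "matvec n d (dataX n d S \<omega>) ?w = dataY n d S wstar \<sigma> \<omega>"
  proof
    fix i
    show "matvec n d (dataX n d S \<omega>) ?w i = dataY n d S wstar \<sigma> \<omega> i"
    proof (cases "i < n")
      case True
      have "matvec n d (dataX n d S \<omega>) q i = \<kappa> * \<omega> (Inr i)"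
        unfolding dataX_apply[OF S True] msqrt_cov_split[OF split q(1)] by (rule eq[OF True])
      then have "matvec n d (dataX n d S \<omega>) ?w i = matvec n d (dataX n d S \<omega>) wstar i + \<sigma> / \<kappa> * (\<kappa> * \<omega> (Inr i))"
        unfolding matvec_add matvec_scale by simp
      then show ?thesis using True \<kappa> by (simp add: dataY_def)
    qed (simp add: matvec_def dataY_def)
  qed
  then have "N w \<le> N ?w" using w wv by (simp add: min_interp_def)
  also have "\<dots> \<le> N wstar + N (\<lambda>i. \<sigma> / \<kappa> * q i)" by (rule N_triangle[OF w0 vsp_scale[OF qv]])
  also have "N (\<lambda>i. \<sigma> / \<kappa> * q i) = \<sigma> / \<kappa> * N q" unfolding N_scale[OF qv] using \<sigma> \<kappa> by simp
  also have "\<dots> \<le> \<sigma> / \<kappa> * \<rho>" using q(2) \<sigma> \<kappa> by (intro mult_left_mono) auto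
  finally show ?thesis by simp
qed

end

text \<open>The thresholds of the comparison contain the noise. It is frozen as the second block
  \<open>g\<close>, which turns them into constants, and Fubini integrates the resulting
  bound.\<close>

lemma conditional_comparison:
  fixes S T :: "('i + 'j \<Rightarrow> real) set"
  assumes S: "S \<in> sets gaussfield" and T: "T \<in> sets gaussfield"
    and le: "\<And>g. measure gaussfield {z. case_sum z g \<in> S} \<le> 2 * measure gaussfield {z. case_sum z g \<in> T}"
  shows "measure gaussfield S \<le> 2 * measure gaussfield T"
proof -
  let ?P = "gaussfield \<Otimes>\<^sub>M gaussfield :: (('i \<Rightarrow> real) \<times> ('j \<Rightarrow> real)) measure"
  interpret P: pair_prob_space "gaussfield :: ('i \<Rightarrow> real) measure" "gaussfield :: ('j \<Rightarrow> real) measure" ..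
  have disint: "emeasure gaussfield U = (\<integral>\<^sup>+g. emeasure gaussfield {z. case_sum z g \<in> U} \<partial>gaussfield)"
    "(\<lambda>g. emeasure gaussfield {z. case_sum z g \<in> U}) \<in> borel_measurable gaussfield"
    if U: "U \<in> sets gaussfield" for U :: "('i + 'j \<Rightarrow> real) set"
  proof -
    let ?V = "(\<lambda>p. case_sum (fst p) (snd p)) -` U \<inter> space ?P"
    have V: "?V \<in> sets ?P" by (rule measurable_sets[OF measurable_case_sum U])
    have sec: "(\<lambda>z. (z, g)) -` ?V = {z. case_sum z g \<in> U}" for g
      by (auto simp: space_pair_measure)
    have "emeasure gaussfield U = emeasure (distr ?P gaussfield (\<lambda>p. case_sum (fst p) (snd p))) U"
      unfolding distr_case_sum ..
    also have "\<dots> = emeasure ?P ?V" by (rule emeasure_distr[OF measurable_case_sum U])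
    also have "\<dots> = (\<integral>\<^sup>+g. emeasure gaussfield ((\<lambda>z. (z, g)) -` ?V) \<partial>gaussfield)"
      by (rule P.emeasure_pair_measure_alt2[OF V])
    finally show "emeasure gaussfield U = (\<integral>\<^sup>+g. emeasure gaussfield {z. case_sum z g \<in> U} \<partial>gaussfield)"
      unfolding sec .
    show "(\<lambda>g. emeasure gaussfield {z. case_sum z g \<in> U}) \<in> borel_measurable gaussfield"
      using P.measurable_emeasure_Pair2[OF V] unfolding sec .
  qed
  have "emeasure gaussfield S \<le> (\<integral>\<^sup>+g. 2 * emeasure gaussfield {z. case_sum z g \<in> T} \<partial>gaussfield)"
    unfolding disint(1)[OF S]
  proof (rule nn_integral_mono)
    fix g
    show "emeasure gaussfield {z. case_sum z g \<in> S} \<le> 2 * emeasure gaussfield {z. case_sum z g \<in> T}"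
      using ennreal_leI[OF le[of g]] by (simp add: gaussfield.emeasure_eq_measure ennreal_mult)
  qed
  also have "\<dots> = 2 * emeasure gaussfield T"
    unfolding disint(1)[OF T] by (rule nn_integral_cmult[OF disint(2)[OF T]])
  finally have "ennreal (measure gaussfield S) \<le> ennreal (2 * measure gaussfield T)"
    by (simp add: gaussfield.emeasure_eq_measure ennreal_mult)
  then show ?thesis by (simp add: ennreal_le_iff)
qed

lemma measure_preimage:
  assumes m: "h \<in> measurable gaussfield gaussfield" and d: "distr gaussfield gaussfield h = gaussfield"
    and X: "X \<in> sets gaussfield"
  shows "h -` X \<in> sets gaussfield" "measure gaussfield (h -` X) = measure gaussfield X"
proof -
  show "h -` X \<in> sets gaussfield" using measurable_sets[OF m X] by simp
  have "measure gaussfield X = measure (distr gaussfield gaussfield h) X" unfolding d ..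
  also have "\<dots> = measure gaussfield (h -` X)" using measure_distr[OF m X] by simp
  finally show "measure gaussfield (h -` X) = measure gaussfield X" ..
qed

text \<open>The origin of 64. With \<open>s = x + y + z + e\<close>, the condition
  \<open>64 * s \<le> 1\<close> gives \<open>1 / (1 + 64 * s) \<le> 1 - 32 * s\<close>. One of the
  32 multiples of \<open>s\<close> absorbs \<open>z\<close> and \<open>e\<close>; the other 31 cover
  \<open>9 * y\<close>, from the square of \<open>1 + 4 * y\<close>, and the loss
  \<open>8 * x\<close> on the right.\<close>

lemma rate_inequality:
  fixes x y z e :: real
  assumes nn: "0 \<le> x" "0 \<le> y" "0 \<le> z" "0 \<le> e" and le: "64 * (x + y + z + e) \<le> 1"
  shows "(z + (1 + e) / (1 + 64 * (x + y + z + e))) * (1 + 4 * y)\<^sup>2 \<le> (1 - 4 * x)\<^sup>2"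
proof -
  define s where "s = x + y + z + e"
  have s: "0 \<le> s" "64 * s \<le> 1" using nn le by (simp_all add: s_def)
  have ss: "s * s \<le> s / 64" using mult_left_mono[OF s(2) s(1)] by simp
  have "1 \<le> (1 - 32 * s) * (1 + 64 * s)" using ss by (simp add: algebra_simps)
  then have inv: "1 / (1 + 64 * s) \<le> 1 - 32 * s" using s by (simp add: pos_divide_le_eq)
  have "(1 + e) / (1 + 64 * s) = (1 + e) * (1 / (1 + 64 * s))" by simp
  also have "\<dots> \<le> (1 + e) * (1 - 32 * s)" using nn inv by (intro mult_left_mono) auto
  also have "\<dots> \<le> 1 - 32 * s + e" using mult_nonneg_nonneg[OF nn(4) s(1)] by (simp add: algebra_simps)
  finally have A: "z + (1 + e) / (1 + 64 * s) \<le> 1 - 31 * s" using nn by (simp add: s_def)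
  have ys: "y \<le> s" using nn by (simp add: s_def)
  then have "64 * y \<le> 1" using s by simp
  from mult_left_mono[OF this nn(2)] have yy: "y * y \<le> y / 64" by simp
  have "(1 + 4 * y)\<^sup>2 = 1 + 8 * y + 16 * (y * y)" by (simp add: power2_eq_square algebra_simps)
  then have B: "(1 + 4 * y)\<^sup>2 \<le> 1 + 9 * y" using yy nn by linarith
  have "(z + (1 + e) / (1 + 64 * s)) * (1 + 4 * y)\<^sup>2 \<le> (1 - 31 * s) * (1 + 9 * y)"
    using A B nn s by (intro mult_mono) auto
  also have "\<dots> \<le> 1 - 31 * s + 9 * y" using mult_nonneg_nonneg[OF s(1) nn(2)] by (simp add: algebra_simps)
  also have "\<dots> \<le> 1 - 8 * x" using nn by (simp add: s_def)
  also have "\<dots> \<le> (1 - 4 * x)\<^sup>2" by (simp add: power2_eq_square algebra_simps)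
  finally show ?thesis by (simp add: s_def)
qed

section \<open>The probability of interpolation\<close>

text \<open>The rate 3 of the tail bounds produces \<open>\<delta> ^ 3\<close>, and
  \<open>\<delta> \<le> 1/4\<close> makes two of the three factors worth
  \<open>1/16\<close>.\<close>

lemma exp_neg_three_ln_le:
  fixes \<delta> :: real
  assumes "0 < \<delta>" "\<delta> \<le> 1/4"
  shows "exp (- (3 * ln (1 / \<delta>))) \<le> \<delta> / 16"
proof -
  have "exp (- (3 * ln (1 / \<delta>))) = exp (3 * ln \<delta>)" using assms by (simp add: ln_div)
  also have "\<dots> = exp (ln \<delta>) ^ 3" by (simp add: exp_of_nat_mult[symmetric])
  also have "\<dots> = \<delta> * (\<delta> * \<delta>)" using assms by (simp add: power3_eq_cube)
  also have "\<dots> \<le> \<delta> * (1/4 * (1/4))"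
    using assms by (intro mult_left_mono mult_mono) auto
  finally show ?thesis by simp
qed

lemma sets_Ex_All_le:
  fixes F :: "nat \<Rightarrow> nat \<Rightarrow> ('i \<Rightarrow> real) \<Rightarrow> real"
  assumes "\<And>i k. F i k \<in> borel_measurable gaussfield" "\<And>i. H i \<in> borel_measurable gaussfield"
  shows "{\<omega>. \<exists>i. \<forall>k. F i k \<omega> \<le> H i \<omega>} \<in> sets gaussfield"
proof -
  have "{\<omega> \<in> space gaussfield. \<exists>i. \<forall>k. F i k \<omega> \<le> H i \<omega>} \<in> sets gaussfield"
    by (intro sets.sets_Collect_countable_Ex sets.sets_Collect_countable_All borel_measurable_le assms)
  then show ?thesis by simp
qed

context dual_norm_field
begin

text \<open>The \<open>A\<close>-norm of \<open>v H\<close> is random, but the inequality read off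
  from the event is affine in it, so the endpoints of \<open>[0, s0]\<close> decide. They involve
  the noise \<open>g\<close> alone and the combination \<open>s0 G - \<kappa> g\<close>, which is
  \<open>\<tau>\<close> times a standard Gaussian vector. Besides the complement of
  \<open>Aset\<close> only three tail events arise: one for the dual norm and two for Euclidean
  norms.\<close>

lemma comparison_event_bound:
  fixes lam q :: "nat \<Rightarrow> vect" and n :: nat and \<kappa> :: real
  defines "AO \<equiv> {\<omega> :: (nat \<times> nat) + nat \<Rightarrow> real. \<exists>i. \<forall>k.
      (\<Sum>j<d. matvec d d (msqrt d A) (q k) j * \<omega> (Inl (0, j)))
        + anorm d A (q k) * (\<Sum>r<n. lam i r * \<omega> (Inl (r, d))) \<le> \<kappa> * (\<Sum>r<n. lam i r * \<omega> (Inr r))}"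
  assumes n: "0 < n" and l: "0 \<le> l" and \<kappa>: "0 < \<kappa>" and s0: "0 \<le> s0"
    and Aset: "Aset \<in> sets gaussfield"
      "\<And>x. x \<in> Aset \<Longrightarrow> anorm d A (v x) \<le> s0 \<and> N (proj d (colsp d A) (v x)) \<le> \<rho>"
    and num: "sqrt (s0\<^sup>2 + \<kappa>\<^sup>2) * (sqrt (real n) + 4 * sqrt l) \<le> Edual d N A - 4 * sqrt l * L"
    and lam: "\<And>i. enorm n (lam i) = 1"
    and q: "{p \<in> colsp d A. N p \<le> \<rho>} \<subseteq> closure (range q)"
  shows "measure gaussfield AO \<le> (1 - measure gaussfield Aset) + 3 * exp (- (3 * l))"
proof -
  define \<tau> where "\<tau> = sqrt (s0\<^sup>2 + \<kappa>\<^sup>2)"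
  define T where "T = sqrt (real n) + 4 * sqrt l"
  have \<tau>: "0 < \<tau>" "\<tau>\<^sup>2 = s0\<^sup>2 + \<kappa>\<^sup>2" "\<kappa> \<le> \<tau>"
  proof -
    show "0 < \<tau>" unfolding \<tau>_def using \<kappa> by (simp add: add_nonneg_pos)
    show "\<tau>\<^sup>2 = s0\<^sup>2 + \<kappa>\<^sup>2" unfolding \<tau>_def by simp
    show "\<kappa> \<le> \<tau>" unfolding \<tau>_def by (rule real_le_rsqrt) simp
  qed
  have T0: "0 \<le> T" using l by (simp add: T_def)
  let ?hH = "\<lambda>(\<omega> :: (nat \<times> nat) + nat \<Rightarrow> real) (j :: nat). \<omega> (Inl (0, j))"
  let ?hg = "\<lambda>(\<omega> :: (nat \<times> nat) + nat \<Rightarrow> real) (r :: nat). \<omega> (Inr r)"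
  let ?h3 = "\<lambda>(\<omega> :: (nat \<times> nat) + nat \<Rightarrow> real) (r :: nat). s0 / \<tau> * \<omega> (Inl (r, d)) + - (\<kappa> / \<tau>) * \<omega> (Inr r)"
  let ?B1 = "{x. f x \<le> Edual d N A - 4 * sqrt l * L}" and ?B2 = "{x. T \<le> enorm n x}"
  have mH: "?hH \<in> measurable gaussfield gaussfield" and dH: "distr gaussfield gaussfield ?hH = gaussfield"
    by (rule measurable_reindex) (rule distr_gaussfield_reindex, simp add: inj_def)
  have mg: "?hg \<in> measurable gaussfield gaussfield" and dg: "distr gaussfield gaussfield ?hg = gaussfield"
    by (rule measurable_reindex) (rule distr_gaussfield_reindex, simp add: inj_def)
  have m3: "?h3 \<in> measurable gaussfield gaussfield"
    by (intro measurable_into_gaussfield) measurable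
  have d3: "distr gaussfield gaussfield ?h3 = gaussfield"
  proof -
    let ?S = "\<lambda>r. {Inl (r, d), Inr r} :: ((nat \<times> nat) + nat) set"
    let ?c = "\<lambda>r :: nat. case_sum (\<lambda>_. s0 / \<tau>) (\<lambda>_. - (\<kappa> / \<tau>)) :: (nat \<times> nat) + nat \<Rightarrow> real"
    have "disjoint_family ?S" by (auto simp: disjoint_family_on_def)
    moreover have "(\<Sum>i\<in>?S r. (?c r i)\<^sup>2) = 1" for r
    proof -
      have "(\<Sum>i\<in>?S r. (?c r i)\<^sup>2) = (s0 / \<tau>)\<^sup>2 + (\<kappa> / \<tau>)\<^sup>2" by simp
      also have "\<dots> = (s0\<^sup>2 + \<kappa>\<^sup>2) / \<tau>\<^sup>2" by (simp add: power_divide add_divide_distrib)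
      also have "\<dots> = 1" unfolding \<tau>(2)[symmetric] using \<tau>(1) by simp
      finally show ?thesis .
    qed
    ultimately have "distr gaussfield gaussfield (\<lambda>\<omega> r. \<Sum>i\<in>?S r. ?c r i * \<omega> i) = gaussfield"
      by (intro distr_gaussfield_blocks) auto
    then show ?thesis by simp
  qed
  have sB1: "?B1 \<in> sets gaussfield"
  proof -
    have "{x \<in> space gaussfield. f x \<le> Edual d N A - 4 * sqrt l * L} \<in> sets gaussfield" by measurable
    then show ?thesis by simp
  qed
  have sB2: "?B2 \<in> sets gaussfield"
  proof -
    have "{x \<in> space gaussfield. T \<le> enorm n x} \<in> sets gaussfield" unfolding enorm_def by measurable
    then show ?thesis by simp
  qed
  have pB1: "measure gaussfield ?B1 \<le> exp (- (3 * l))"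
    using lower_tail[OF L_pos l] by (simp add: Edual_eq)
  have pB2: "measure gaussfield ?B2 \<le> exp (- (3 * l))"
    unfolding T_def by (rule enorm_upper_tail[OF n l])
  note pre = measure_preimage
  have sub: "AO \<subseteq> ((UNIV - ?hH -` Aset) \<union> ?hH -` ?B1) \<union> (?hg -` ?B2 \<union> ?h3 -` ?B2)"
  proof (rule subsetI, rule ccontr)
    fix \<omega> assume \<omega>: "\<omega> \<in> AO" and bad: "\<omega> \<notin> ((UNIV - ?hH -` Aset) \<union> ?hH -` ?B1) \<union> (?hg -` ?B2 \<union> ?h3 -` ?B2)"
    define H where "H = ?hH \<omega>"
    have good: "H \<in> Aset" "Edual d N A - 4 * sqrt l * L < f H" "enorm n (?hg \<omega>) < T" "enorm n (?h3 \<omega>) < T"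
      using bad by (auto simp: H_def)
    obtain i where i: "\<And>k. (\<Sum>j<d. matvec d d (msqrt d A) (q k) j * H j)
        + anorm d A (q k) * (\<Sum>r<n. lam i r * \<omega> (Inl (r, d))) \<le> \<kappa> * (\<Sum>r<n. lam i r * \<omega> (Inr r))"
      using \<omega> by (auto simp: AO_def H_def)
    define c where "c = (\<Sum>r<n. lam i r * \<omega> (Inl (r, d)))"
    define b where "b = \<kappa> * (\<Sum>r<n. lam i r * \<omega> (Inr r))"
    \<comment> \<open>The constraints hold along the dense sequence and are closed in
      \<open>p\<close>, so they extend to the projected minimiser.\<close>
    let ?C = "{p. ip d (matvec d d (msqrt d A) p) H + anorm d A p * c \<le> b}"
    have "closed ?C"
      unfolding anorm_def
      by (intro closed_Collect_le continuous_on_add continuous_on_mult continuous_on_const continuous_on_real_sqrt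
          continuous_on_ip continuous_on_matvec continuous_on_id)
    moreover have "range q \<subseteq> ?C" using i by (auto simp: ip_def c_def b_def)
    ultimately have "closure (range q) \<subseteq> ?C" by (intro closure_minimal)
    moreover define p where "p = proj d (colsp d A) (v H)"
    moreover have "p \<in> {p \<in> colsp d A. N p \<le> \<rho>}"
      using Aset(2)[OF good(1)] proj_in_colsp[OF A v_props(1)] by (simp add: p_def)
    ultimately have "p \<in> ?C" using q by blast
    moreover have Rp: "matvec d d (msqrt d A) p = matvec d d (msqrt d A) (v H)"
      unfolding p_def by (rule msqrt_proj[OF A v_props(1)])
    moreover have "anorm d A p = anorm d A (v H)" unfolding anorm_eq[OF A] Rp ..
    ultimately have "ip d (matvec d d (msqrt d A) (v H)) H + anorm d A (v H) * c \<le> b" by simp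
    then have fb: "f H + anorm d A (v H) * c \<le> b" by (simp add: f_eq[of H] ip_def)
    have s: "0 \<le> anorm d A (v H)" "anorm d A (v H) \<le> s0"
      using anorm_nonneg Aset(2)[OF good(1)] by auto
    have "f H < \<tau> * T"
    proof (cases "0 \<le> c")
      case True
      have "f H \<le> b" using fb s True by (smt (verit) mult_nonneg_nonneg)
      also have "b \<le> \<kappa> * (enorm n (lam i) * enorm n (?hg \<omega>))"
        unfolding b_def using \<kappa> by (intro mult_left_mono sum_mult_le_enorm) auto
      also have "\<dots> < \<kappa> * T" unfolding lam using good(3) \<kappa> by simp
      also have "\<dots> \<le> \<tau> * T" using \<tau>(3) T0 by (rule mult_right_mono)
      finally show ?thesis .
    next
      case False
      have "s0 * c \<le> anorm d A (v H) * c" using s(2) False by (intro mult_right_mono_neg) auto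
      then have "f H \<le> b - s0 * c" using fb by linarith
      also have "b - s0 * c = (\<Sum>r<n. lam i r * (\<kappa> * \<omega> (Inr r) - s0 * \<omega> (Inl (r, d))))"
        unfolding b_def c_def by (simp add: sum_distrib_left sum_subtractf right_diff_distrib mult_ac)
      also have "\<dots> = (\<Sum>r<n. lam i r * (- \<tau> * ?h3 \<omega> r))"
        using \<tau>(1) by (intro sum.cong refl) (simp add: field_simps)
      also have "\<dots> \<le> enorm n (lam i) * enorm n (\<lambda>r. - \<tau> * ?h3 \<omega> r)"
        by (rule sum_mult_le_enorm)
      also have "\<dots> = \<tau> * enorm n (?h3 \<omega>)" unfolding lam enorm_scale using \<tau>(1) by simp
      also have "\<dots> < \<tau> * T" using good(4) \<tau>(1) by simp
      finally show ?thesis .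
    qed
    also have "\<tau> * T \<le> Edual d N A - 4 * sqrt l * L" using num by (simp add: \<tau>_def T_def)
    finally show False using good(2) by simp
  qed
  have s1: "UNIV - ?hH -` Aset \<in> sets gaussfield"
    using sets.compl_sets[OF pre(1)[OF mH dH Aset(1)]] by simp
  have p1: "measure gaussfield (UNIV - ?hH -` Aset) = 1 - measure gaussfield Aset"
    using gaussfield.prob_compl[OF pre(1)[OF mH dH Aset(1)]] pre(2)[OF mH dH Aset(1)] by simp
  note sets = s1 pre(1)[OF mH dH sB1] pre(1)[OF mg dg sB2] pre(1)[OF m3 d3 sB2]
  have "measure gaussfield AO \<le> measure gaussfield (((UNIV - ?hH -` Aset) \<union> ?hH -` ?B1) \<union> (?hg -` ?B2 \<union> ?h3 -` ?B2))"
    using sets by (intro gaussfield.finite_measure_mono[OF sub] sets.Un)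
  also have "\<dots> \<le> measure gaussfield ((UNIV - ?hH -` Aset) \<union> ?hH -` ?B1) + measure gaussfield (?hg -` ?B2 \<union> ?h3 -` ?B2)"
    using sets by (intro measure_Un_le sets.Un)
  also have "\<dots> \<le> (measure gaussfield (UNIV - ?hH -` Aset) + measure gaussfield (?hH -` ?B1))
      + (measure gaussfield (?hg -` ?B2) + measure gaussfield (?h3 -` ?B2))"
    using sets by (intro add_mono measure_Un_le)
  also have "\<dots> = (1 - measure gaussfield Aset + measure gaussfield ?B1) + (measure gaussfield ?B2 + measure gaussfield ?B2)"
    unfolding p1 pre(2)[OF mH dH sB1] pre(2)[OF mg dg sB2] pre(2)[OF m3 d3 sB2] ..
  also have "\<dots> \<le> (1 - measure gaussfield Aset) + 3 * exp (- (3 * l))"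
    using pB1 pB2 by simp
  finally show ?thesis .
qed

lemma interpolation_probability:
  fixes n :: nat
  assumes n: "1 \<le> n" and \<delta>: "0 < \<delta>" "\<delta> \<le> 1/4" and \<kappa>: "0 < \<kappa>" and s0: "0 \<le> s0" and \<rho>: "0 \<le> \<rho>"
    and Aset: "Aset \<in> sets gaussfield" "1 - \<delta> / 4 \<le> measure gaussfield Aset"
      "\<And>x. x \<in> Aset \<Longrightarrow> anorm d A (v x) \<le> s0 \<and> N (proj d (colsp d A) (v x)) \<le> \<rho>"
    and num: "sqrt (s0\<^sup>2 + \<kappa>\<^sup>2) * (sqrt (real n) + 4 * sqrt (ln (1 / \<delta>))) \<le> Edual d N A - 4 * sqrt (ln (1 / \<delta>)) * L"
  shows "\<exists>B\<in>sets (gaussfield :: ((nat \<times> nat) + nat \<Rightarrow> real) measure). 1 - \<delta> \<le> measure gaussfield B \<and>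
    (\<forall>\<omega>\<in>B. \<exists>p\<in>colsp d A. N p \<le> \<rho> \<and>
      (\<forall>r<n. (\<Sum>j<d. \<omega> (Inl (r, j)) * matvec d d (msqrt d A) p j) = \<kappa> * \<omega> (Inr r)))"
proof -
  let ?R = "msqrt d A" and ?K = "{p \<in> colsp d A. N p \<le> \<rho>}" and ?U = "{x \<in> vsp n. ip n x x = 1}"
  have l: "0 \<le> ln (1 / \<delta>)" using \<delta> by simp
  have "unitvec 0 \<in> ?U"
  proof -
    have "ip n (unitvec 0) (unitvec 0) = (\<Sum>i<n. if i = 0 then 1 else 0)"
      unfolding ip_def by (intro sum.cong) (auto simp: unitvec_def)
    then show ?thesis using n unitvec_vsp by simp
  qed
  then have neU: "?U \<noteq> {}" by blast
  obtain lam :: "nat \<Rightarrow> vect" where lam: "\<And>i. lam i \<in> ?U" and dense: "?U \<subseteq> closure (range lam)"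
    by (rule dense_sequence[OF neU], rule that)
  have "(\<lambda>_. 0) \<in> colsp d A"
    unfolding colsp_def by (rule image_eqI[of _ _ "\<lambda>_. 0"]) (simp_all add: vsp_zero)
  then have "(\<lambda>_. 0) \<in> ?K" using \<rho> N_zero_iff[OF vsp_zero] by simp
  then have neK: "?K \<noteq> {}" by blast
  obtain q :: "nat \<Rightarrow> vect" where q: "\<And>i. q i \<in> ?K" and denseK: "?K \<subseteq> closure (range q)"
    by (rule dense_sequence[OF neK], rule that)
  have lam1: "(\<Sum>r<n. (lam i r)\<^sup>2) = 1" for i
    using lam[of i] by (simp add: ip_def power2_eq_square)
  define u where "u k = (\<lambda>j. if j < d then matvec d d ?R (q k) j else anorm d A (q k))" for k
  have u: "lorentz d (u k)" for k
    unfolding lorentz_def by (simp add: u_def sum_squares_anorm anorm_nonneg)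
  let ?PO = "{\<omega> :: (nat \<times> nat) + nat \<Rightarrow> real. \<exists>i. \<forall>k. (\<Sum>j<d. u k j * (\<Sum>r<n. lam i r * \<omega> (Inl (r, j))))
      \<le> \<kappa> * (\<Sum>r<n. lam i r * \<omega> (Inr r))}"
  let ?AO = "{\<omega> :: (nat \<times> nat) + nat \<Rightarrow> real. \<exists>i. \<forall>k. (\<Sum>j<d. u k j * \<omega> (Inl (0, j)))
      + u k d * (\<Sum>r<n. lam i r * \<omega> (Inl (r, d))) \<le> \<kappa> * (\<Sum>r<n. lam i r * \<omega> (Inr r))}"
  have sPO: "?PO \<in> sets gaussfield"
    by (intro sets_Ex_All_le borel_measurable_sum borel_measurable_times borel_measurable_const
        measurable_gaussfield_component)
  have sAO: "?AO \<in> sets gaussfield"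
    by (intro sets_Ex_All_le borel_measurable_sum borel_measurable_times borel_measurable_add
        borel_measurable_const measurable_gaussfield_component)
  have "measure gaussfield ?PO \<le> 2 * measure gaussfield ?AO"
  proof (rule conditional_comparison[OF sPO sAO])
    fix g :: "nat \<Rightarrow> real"
    show "measure gaussfield {z. case_sum z g \<in> ?PO} \<le> 2 * measure gaussfield {z. case_sum z g \<in> ?AO}"
      using gaussian_minmax[OF n lam1 u, where t="\<lambda>i. \<kappa> * (\<Sum>r<n. lam i r * g r)"] by simp
  qed
  also have "?AO = {\<omega> :: (nat \<times> nat) + nat \<Rightarrow> real. \<exists>i. \<forall>k.
      (\<Sum>j<d. matvec d d ?R (q k) j * \<omega> (Inl (0, j)))
        + anorm d A (q k) * (\<Sum>r<n. lam i r * \<omega> (Inl (r, d))) \<le> \<kappa> * (\<Sum>r<n. lam i r * \<omega> (Inr r))}"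
    by (simp add: u_def)
  also have "measure gaussfield \<dots> \<le> (1 - measure gaussfield Aset) + 3 * exp (- (3 * ln (1 / \<delta>)))"
    by (rule comparison_event_bound[OF _ l \<kappa> s0 Aset(1,3) num _ denseK])
       (use n lam1 in \<open>simp_all add: enorm_def\<close>)
  finally have "measure gaussfield ?PO \<le> 2 * ((1 - measure gaussfield Aset) + 3 * exp (- (3 * ln (1 / \<delta>))))"
    by simp
  \<comment> \<open>The total is \<open>2 * (1/4 + 3/16) = 7/8\<close> of \<open>\<delta>\<close>:
    the factor 2 comes from the reflection, \<open>1/4\<close> from the complement of
    \<open>Aset\<close> and \<open>3/16\<close> from the three tails.\<close>
  moreover have "a \<le> \<delta>" if "a \<le> 2 * ((1 - b) + 3 * e)" "1 - \<delta> / 4 \<le> b" "e \<le> \<delta> / 16" for a b e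
    using that \<delta> by simp
  ultimately have PO: "measure gaussfield ?PO \<le> \<delta>"
    using Aset(2) exp_neg_three_ln_le[OF \<delta>] by blast
  have "1 - \<delta> \<le> measure gaussfield (UNIV - ?PO)"
    using gaussfield.prob_compl[OF sPO] PO by simp
  moreover have "UNIV - ?PO \<in> sets gaussfield"
    using sets.compl_sets[OF sPO] by simp
  moreover have "\<exists>p\<in>colsp d A. N p \<le> \<rho> \<and>
      (\<forall>r<n. (\<Sum>j<d. \<omega> (Inl (r, j)) * matvec d d ?R p j) = \<kappa> * \<omega> (Inr r))" if \<omega>: "\<omega> \<in> UNIV - ?PO" for \<omega>
  proof -
    let ?Z = "\<lambda>r j. \<omega> (Inl (r, j))" and ?y = "\<lambda>r. \<kappa> * \<omega> (Inr r)"
    \<comment> \<open>Outside the event every direction of the sequence has a point strictly beyond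
      its threshold, which is the separation hypothesis of
      \<open>interpolating_point\<close>.\<close>
    have "\<exists>k. ip n (lam i) ?y < ip n (lam i) (matvec n d ?Z (matvec d d ?R (q k)))" for i
    proof -
      have "\<not> (\<forall>k. (\<Sum>j<d. u k j * (\<Sum>r<n. lam i r * \<omega> (Inl (r, j)))) \<le> \<kappa> * (\<Sum>r<n. lam i r * \<omega> (Inr r)))"
        using \<omega> by blast
      then obtain k where k: "\<kappa> * (\<Sum>r<n. lam i r * \<omega> (Inr r)) < (\<Sum>j<d. u k j * (\<Sum>r<n. lam i r * \<omega> (Inl (r, j))))"
        by (auto simp: not_le)
      have "ip n (lam i) (matvec n d ?Z (matvec d d ?R (q k))) = (\<Sum>r<n. \<Sum>j<d. u k j * (lam i r * \<omega> (Inl (r, j))))"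
        by (simp add: ip_def matvec_def[of n] u_def sum_distrib_left mult_ac)
      also have "\<dots> = (\<Sum>j<d. u k j * (\<Sum>r<n. lam i r * \<omega> (Inl (r, j))))"
        by (subst sum.swap) (simp add: sum_distrib_left)
      finally have "ip n (lam i) (matvec n d ?Z (matvec d d ?R (q k))) = (\<Sum>j<d. u k j * (\<Sum>r<n. lam i r * \<omega> (Inl (r, j))))" .
      moreover have "ip n (lam i) ?y = \<kappa> * (\<Sum>r<n. lam i r * \<omega> (Inr r))"
        by (simp add: ip_def sum_distrib_left mult_ac)
      ultimately show ?thesis using k by (intro exI[of _ k]) simp
    qed
    then have "\<exists>p\<in>colsp d A. N p \<le> \<rho> \<and> (\<forall>r<n. matvec n d ?Z (matvec d d ?R p) r = ?y r)"
      using q by (intro interpolating_point[OF A \<rho> dense, of q]) auto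
    then show ?thesis by (auto simp: matvec_def[of n])
  qed
  ultimately show ?thesis by blast
qed

text \<open>Identifies the integrand in \<open>rk_big\<close>, an infimum, with the norm of the
  selected minimiser that the hypothesis of the theorem speaks of.\<close>

lemma vmin_eq: "vmin d N A (gvec d x) = anorm d A (v x)"
proof -
  have "is_vstar d N A (gvec d x) (v x)" using vs[OF gvec_vsp] by (simp add: v_def)
  then show ?thesis
    unfolding vmin_def is_vstar_def by (intro cInf_eq_minimum) auto
qed

end

section \<open>From effective ranks to relative errors and the norm bound\<close>

theorem theorem4:
  shows "\<exists>C2::real. 0 < C2 \<and> C2 \<le> 64 \<and>
    (\<forall>(n::nat) (d::nat) (S::matr) (S1::matr) (S2::matr) (N::vect \<Rightarrow> real) (wstar::vect)
       (\<sigma>::real) (\<delta>::real) (vs::vect \<Rightarrow> vect) (\<epsilon>1::real) (\<epsilon>2::real).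
       1 \<le> n \<longrightarrow> n \<le> d \<longrightarrow> cov_split d S S1 S2 \<longrightarrow> S2 \<noteq> (\<lambda>i j. 0) \<longrightarrow>
       is_norm d N \<longrightarrow> wstar \<in> vsp d \<longrightarrow> 0 \<le> \<sigma> \<longrightarrow> 0 < \<delta> \<longrightarrow> \<delta> \<le> 1/4 \<longrightarrow>
       (\<forall>h\<in>vsp d. is_vstar d N S2 h (vs h)) \<longrightarrow>
       0 \<le> \<epsilon>1 \<longrightarrow> 0 \<le> \<epsilon>2 \<longrightarrow>
       (\<exists>A\<in>sets (gaussfield :: (nat \<Rightarrow> real) measure).
          1 - \<delta>/4 \<le> measure gaussfield A \<and>
          A \<subseteq> {\<omega>. anorm d S2 (vs (gvec d \<omega>))
                     \<le> (1 + \<epsilon>1) * (\<integral>\<omega>'. anorm d S2 (vs (gvec d \<omega>')) \<partial>gaussfield)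
                   \<and> (N (proj d (colsp d S2) (vs (gvec d \<omega>))))\<^sup>2 \<le> 1 + \<epsilon>2}) \<longrightarrow>
       (let \<epsilon> = C2 * (sqrt (ln (1/\<delta>) / rk_small d N S2) + sqrt (ln (1/\<delta>) / real n)
                     + (1 + \<epsilon>1)\<^sup>2 * real n / rk_big d N S2 + \<epsilon>2)
        in \<epsilon> \<le> 1 \<longrightarrow>
          (\<exists>B\<in>sets (gaussfield :: ((nat \<times> nat) + nat \<Rightarrow> real) measure).
             1 - \<delta> \<le> measure gaussfield B \<and>
             B \<subseteq> {\<omega>. \<forall>w\<in>min_interp n d N (dataX n d S \<omega>) (dataY n d S wstar \<sigma> \<omega>).
                      N w \<le> N wstar + sqrt (1 + \<epsilon>) * \<sigma> * sqrt (real n) / Edual d N S2})))"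
proof (intro exI[of _ 64] conjI allI impI)
  fix n d :: nat and S S1 S2 :: matr and N :: "vect \<Rightarrow> real" and wstar :: vect
    and \<sigma> \<delta> :: real and vs :: "vect \<Rightarrow> vect" and \<epsilon>1 \<epsilon>2 :: real
  assume n: "1 \<le> n" "n \<le> d" and split: "cov_split d S S1 S2" and nz: "S2 \<noteq> (\<lambda>i j. 0)"
    and norm: "is_norm d N" and w0: "wstar \<in> vsp d" and \<sigma>: "0 \<le> \<sigma>" and \<delta>: "0 < \<delta>" "\<delta> \<le> 1/4"
    and vs: "\<forall>h\<in>vsp d. is_vstar d N S2 h (vs h)" and \<epsilon>1: "0 \<le> \<epsilon>1" and \<epsilon>2: "0 \<le> \<epsilon>2"
    and ex: "\<exists>A\<in>sets (gaussfield :: (nat \<Rightarrow> real) measure).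
          1 - \<delta>/4 \<le> measure gaussfield A \<and>
          A \<subseteq> {\<omega>. anorm d S2 (vs (gvec d \<omega>))
                     \<le> (1 + \<epsilon>1) * (\<integral>\<omega>'. anorm d S2 (vs (gvec d \<omega>')) \<partial>gaussfield)
                   \<and> (N (proj d (colsp d S2) (vs (gvec d \<omega>))))\<^sup>2 \<le> 1 + \<epsilon>2}"
  interpret D: dual_norm_field d N S2 vs
  proof
    show "is_norm d N" by (rule norm)
    show "0 < d" using n by simp
    show "psd d S2" using split by (simp add: cov_split_def)
    show "S2 \<noteq> (\<lambda>i j. 0)" by (rule nz)
    show "is_vstar d N S2 h (vs h)" if "h \<in> vsp d" for h using vs that by blast
  qed
  define E where "E = Edual d N S2"
  define V where "V = (\<integral>\<omega>. anorm d S2 (D.v \<omega>) \<partial>gaussfield)"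
  define s0 where "s0 = (1 + \<epsilon>1) * V"
  define l where "l = ln (1 / \<delta>)"
  define x where "x = sqrt (l / rk_small d N S2)"
  define y where "y = sqrt (l / real n)"
  define z where "z = (1 + \<epsilon>1)\<^sup>2 * real n / rk_big d N S2"
  define \<epsilon> where "\<epsilon> = 64 * (x + y + z + \<epsilon>2)"
  define \<rho> where "\<rho> = sqrt (1 + \<epsilon>2)"
  have E: "0 < E" unfolding E_def by (rule D.Edual_pos)
  have V: "0 \<le> V" unfolding V_def by (rule integral_nonneg_AE) (simp add: D.anorm_nonneg)
  have s0: "0 \<le> s0" using V \<epsilon>1 by (simp add: s0_def)
  have l: "0 \<le> l" using \<delta> by (simp add: l_def)
  have n0: "0 < sqrt (real n)" using n by simp
  \<comment> \<open>Up to the factor 4, \<open>x\<close> and \<open>y\<close> are the fluctuations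
    of the dual norm and of a Gaussian norm relative to \<open>E\<close> and
    \<open>sqrt (real n)\<close>; \<open>z\<close> measures \<open>real n * s0\<^sup>2\<close>
    against \<open>E\<^sup>2\<close>.\<close>
  have x_eq: "E * x = sqrt l * D.L"
  proof -
    have "rk_small d N S2 = (E / D.L)\<^sup>2" by (simp add: rk_small_def D.L_def E_def)
    then have "x = sqrt l / \<bar>E / D.L\<bar>" by (simp add: x_def real_sqrt_divide)
    also have "\<dots> = sqrt l * D.L / E" using E D.L_pos by simp
    finally show ?thesis using E by simp
  qed
  have y_eq: "sqrt (real n) * y = sqrt l" using n0 by (simp add: y_def real_sqrt_divide)
  have z_eq: "z * E\<^sup>2 = real n * s0\<^sup>2"
  proof -
    have "rk_big d N S2 = (E / V)\<^sup>2" by (simp add: rk_big_def D.vmin_eq E_def V_def)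
    then have "z = (1 + \<epsilon>1)\<^sup>2 * real n / (E / V)\<^sup>2" by (simp add: z_def)
    \<comment> \<open>If \<open>V = 0\<close>, division by zero makes both the rank and
      \<open>z\<close> equal to 0, in agreement with \<open>s0 = 0\<close>.\<close>
    then show ?thesis
      using E by (cases "V = 0") (simp_all add: s0_def power_divide power_mult_distrib)
  qed
  have nn: "0 \<le> x" "0 \<le> y" "0 \<le> z"
  proof -
    show "0 \<le> x" unfolding x_def using l by (simp add: rk_small_def)
    show "0 \<le> y" unfolding y_def using l by simp
    show "0 \<le> z" unfolding z_def by (simp add: rk_big_def)
  qed
  have "\<exists>B\<in>sets (gaussfield :: ((nat \<times> nat) + nat \<Rightarrow> real) measure).
             1 - \<delta> \<le> measure gaussfield B \<and>
             B \<subseteq> {\<omega>. \<forall>w\<in>min_interp n d N (dataX n d S \<omega>) (dataY n d S wstar \<sigma> \<omega>).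
                      N w \<le> N wstar + sqrt (1 + \<epsilon>) * \<sigma> * sqrt (real n) / E}" if le: "\<epsilon> \<le> 1"
  proof -
    have \<epsilon>0: "0 \<le> \<epsilon>" using nn \<epsilon>2 by (simp add: \<epsilon>_def)
    \<comment> \<open>Chosen so that \<open>\<sigma> / \<kappa> * \<rho>\<close> is exactly the
      excess norm allowed by the conclusion.\<close>
    define \<kappa> where "\<kappa> = \<rho> * E / (sqrt (1 + \<epsilon>) * sqrt (real n))"
    have \<rho>: "0 < \<rho>" "\<rho>\<^sup>2 = 1 + \<epsilon>2" using \<epsilon>2 by (simp_all add: \<rho>_def)
    have \<kappa>: "0 < \<kappa>" using \<rho> E \<epsilon>0 n0 by (simp add: \<kappa>_def)
    have \<kappa>2: "real n * \<kappa>\<^sup>2 = E\<^sup>2 * ((1 + \<epsilon>2) / (1 + \<epsilon>))"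
      unfolding \<kappa>_def power_divide power_mult_distrib \<rho>(2) using n \<epsilon>0 by simp
    \<comment> \<open>Squared and divided by \<open>E\<^sup>2\<close> this is
      \<open>rate_inequality\<close>: \<open>z\<close> and
      \<open>(1 + \<epsilon>2) / (1 + \<epsilon>)\<close> are the normalised squares of
      \<open>s0\<close> and \<open>\<kappa>\<close>.\<close>
    have "sqrt (s0\<^sup>2 + \<kappa>\<^sup>2) * (sqrt (real n) + 4 * sqrt l) \<le> E * (1 - 4 * x)"
    proof (rule power2_le_imp_le)
      have "(sqrt (s0\<^sup>2 + \<kappa>\<^sup>2) * (sqrt (real n) + 4 * sqrt l))\<^sup>2 = (s0\<^sup>2 + \<kappa>\<^sup>2) * (sqrt (real n) * (1 + 4 * y))\<^sup>2"
      proof -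
        have "sqrt (real n) + 4 * sqrt l = sqrt (real n) * (1 + 4 * y)"
          unfolding y_eq[symmetric] by (simp add: algebra_simps)
        then show ?thesis unfolding power_mult_distrib[of "sqrt (s0\<^sup>2 + \<kappa>\<^sup>2)"] by simp
      qed
      also have "\<dots> = (real n * s0\<^sup>2 + real n * \<kappa>\<^sup>2) * (1 + 4 * y)\<^sup>2"
        unfolding power_mult_distrib[of "sqrt (real n)"] by (simp add: algebra_simps)
      also have "\<dots> = E\<^sup>2 * ((z + (1 + \<epsilon>2) / (1 + \<epsilon>)) * (1 + 4 * y)\<^sup>2)"
        unfolding z_eq[symmetric] \<kappa>2 by (simp add: algebra_simps)
      also have "\<dots> \<le> E\<^sup>2 * (1 - 4 * x)\<^sup>2"
        unfolding \<epsilon>_def using le by (intro mult_left_mono rate_inequality nn \<epsilon>2) (simp_all add: \<epsilon>_def)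
      also have "\<dots> = (E * (1 - 4 * x))\<^sup>2" by (rule power_mult_distrib[symmetric])
      finally show "(sqrt (s0\<^sup>2 + \<kappa>\<^sup>2) * (sqrt (real n) + 4 * sqrt l))\<^sup>2 \<le> (E * (1 - 4 * x))\<^sup>2" .
      \<comment> \<open>From \<open>\<epsilon> \<le> 1\<close> and the factor 64, \<open>x\<close>
        is at most \<open>1/64\<close>.\<close>
      show "0 \<le> E * (1 - 4 * x)" using E nn \<epsilon>2 le by (simp add: \<epsilon>_def)
    qed
    also have "E * (1 - 4 * x) = E - 4 * sqrt l * D.L"
      using x_eq by (simp add: algebra_simps)
    finally have num: "sqrt (s0\<^sup>2 + \<kappa>\<^sup>2) * (sqrt (real n) + 4 * sqrt l) \<le> E - 4 * sqrt l * D.L" .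
    obtain Aset where Aset: "Aset \<in> sets gaussfield" "1 - \<delta>/4 \<le> measure gaussfield Aset"
      and sub: "\<And>\<omega>. \<omega> \<in> Aset \<Longrightarrow> anorm d S2 (vs (gvec d \<omega>))
                     \<le> (1 + \<epsilon>1) * (\<integral>\<omega>'. anorm d S2 (vs (gvec d \<omega>')) \<partial>gaussfield)
                   \<and> (N (proj d (colsp d S2) (vs (gvec d \<omega>))))\<^sup>2 \<le> 1 + \<epsilon>2"
      using ex by blast
    have sub': "anorm d S2 (D.v \<omega>) \<le> s0 \<and> N (proj d (colsp d S2) (D.v \<omega>)) \<le> \<rho>" if "\<omega> \<in> Aset" for \<omega>
      using sub[OF that] unfolding s0_def V_def D.v_def \<rho>_def by (auto intro: real_le_rsqrt)
    have \<rho>0: "0 \<le> \<rho>" using \<rho>(1) by simp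
    obtain B where B: "B \<in> sets (gaussfield :: ((nat \<times> nat) + nat \<Rightarrow> real) measure)" "1 - \<delta> \<le> measure gaussfield B"
      "\<And>\<omega>. \<omega> \<in> B \<Longrightarrow> \<exists>p\<in>colsp d S2. N p \<le> \<rho> \<and>
        (\<forall>r<n. (\<Sum>j<d. \<omega> (Inl (r, j)) * matvec d d (msqrt d S2) p j) = \<kappa> * \<omega> (Inr r))"
      using D.interpolation_probability[OF n(1) \<delta> \<kappa> s0 \<rho>0 Aset sub' num[unfolded l_def E_def]] by blast
    have rate: "\<sigma> / \<kappa> * \<rho> = sqrt (1 + \<epsilon>) * \<sigma> * sqrt (real n) / E"
      using \<rho>(1) E \<epsilon>0 n0 by (simp add: \<kappa>_def field_simps)
    have "N w \<le> N wstar + sqrt (1 + \<epsilon>) * \<sigma> * sqrt (real n) / E"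
      if \<omega>: "\<omega> \<in> B" and w: "w \<in> min_interp n d N (dataX n d S \<omega>) (dataY n d S wstar \<sigma> \<omega>)" for \<omega> w
    proof -
      obtain p where p: "p \<in> colsp d S2" "N p \<le> \<rho>"
        "\<And>r. r < n \<Longrightarrow> (\<Sum>j<d. \<omega> (Inl (r, j)) * matvec d d (msqrt d S2) p j) = \<kappa> * \<omega> (Inr r)"
        using B(3)[OF \<omega>] by blast
      show ?thesis
        using D.min_interp_bound[OF split w0 \<sigma> \<kappa> p w] unfolding rate .
    qed
    then show ?thesis using B(1,2) by (intro bexI[of _ B]) auto
  qed
  then show "let \<epsilon> = 64 * (sqrt (ln (1/\<delta>) / rk_small d N S2) + sqrt (ln (1/\<delta>) / real n)
                     + (1 + \<epsilon>1)\<^sup>2 * real n / rk_big d N S2 + \<epsilon>2)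
        in \<epsilon> \<le> 1 \<longrightarrow>
          (\<exists>B\<in>sets (gaussfield :: ((nat \<times> nat) + nat \<Rightarrow> real) measure).
             1 - \<delta> \<le> measure gaussfield B \<and>
             B \<subseteq> {\<omega>. \<forall>w\<in>min_interp n d N (dataX n d S \<omega>) (dataY n d S wstar \<sigma> \<omega>).
                      N w \<le> N wstar + sqrt (1 + \<epsilon>) * \<sigma> * sqrt (real n) / Edual d N S2})"
    unfolding Let_def \<epsilon>_def x_def y_def z_def l_def E_def by (rule impI)
qed simp_all

end
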